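(* Let $t>0$ and let $D\subset\mathbb{C}\setminus B$ be a simply connected domain such that $\Gamma_{i,j}^D:=\{z\in D:G(z,u_t^i(z))=G(z,u_t^j(z))\}\ne\emptyset$ for exactly one pair $1\le i<j\le d+1$, and such that $\Gamma_{i,j}^D$ is a real analytic curve. Assume that $\Gamma_{i,j}^D$ separates $D=D_i\cup D_j\cup\Gamma_{i,j}^D$ into two simply connected open domains $D_i,D_j$. Then $\mu_t(\Gamma_{i,j}^D)>0$ if and only if the branch of the maximally relevant saddle point switches at $\Gamma_{i,j}^D$, which means that (with the two domains suitably named) $u_t^*(z)=u_t^i(z)$ for $z\in D_i$ and $u_t^*(z)=u_t^j(z)$ for $z\in D_j$. In this case, the density $\varrho:\Gamma_{i,j}^D\to\mathbb{R}$ of $\mu_t$ (restricted to $\Gamma_{i,j}^D$) with respect to the length measure on $\Gamma_{i,j}^D$ is given by $$\varrho(z)=\frac{|u_t^i(z)-u_t^j(z)|}{2\pi t}.$$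
   Context: Setting. $d\in\mathbb{N}$, $\lambda_1,\dots,\lambda_d\in\mathbb{C}$ are distinct, $\alpha_1,\dots,\alpha_d\in\mathbb{N}=\{1,2,\dots\}$, $\alpha=\sum_j\alpha_j$, $P(z)=\prod_{j=1}^d(z-\lambda_j)^{\alpha_j}$, $P^n$ is the $n$-th power of $P$, and $P_t^n=e^{-\frac{t}{2\alpha n}\partial_z^2}P^n=\sum_{k\ge0}\frac{1}{k!}(-\frac{t}{2\alpha n})^k\partial_z^{2k}P^n$. For $t>0$, $\mu_t$ is the weak limit as $n\to\infty$ of $\mu_{n,t}=\frac1{\alpha n}\sum_{\lambda:P_t^n(\lambda)=0}\delta_\lambda$ (zeros counted with multiplicity); this limit exists and is a compactly supported probability measure on $\mathbb{C}$. Saddle points. For $t>0$, $z\in\mathbb{C}$ put $G(z,u)=\frac1\alpha\sum_{j=1}^d\alpha_j\log|u-\lambda_j|+\operatorname{Re}\big(\frac{(z-u)^2}{2t}\big)$ (value $-\infty$ at $u=\lambda_j$). The saddle points for $z$ are the solutions $u$ of $u+\frac t\alpha\sum_{j}\frac{\alpha_j}{u-\lambda_j}=z$, equivalently the roots of $Q_{z,t}(u)=\frac t\alpha\sum_{j}\alpha_j\prod_{k\ne j}(u-\lambda_k)-(z-u)\prod_{j}(u-\lambda_j)$ (degree $d+1$ in $u$). $B$ is the set of $z$ for which $Q_{z,t}$ has a multiple root. On a simply connected domain $D\subset\mathbb{C}\setminus B$ the $d+1$ saddle points are labelled as analytic functions $u_t^1(z),\dots,u_t^{d+1}(z)$ of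 $z\in D$. The maximally relevant saddle point $u_t^*(z)$, for $z\notin B$ with pairwise different heights $G(z,u_t^k(z))$, $k=1,\dots,d+1$: let $\Sigma(h)=\{u\in\mathbb{C}:G(z,u)\le h\}$. A path connecting $-i\infty$ and $+i\infty$ is a path of the form $(-i\infty,-iC]\cup\gamma_C\cup[iC,+i\infty)$ with $C>0$ and $\gamma_C$ a curve from $-iC$ to $iC$. Then $u_t^*(z)$ is the unique saddle point $u_t^k(z)$ such that for every $\varepsilon>0$ there is no path in $\Sigma(G(z,u_t^k(z))-\varepsilon)$ connecting $-i\infty$ and $+i\infty$, whereas there is such a path in $\Sigma(G(z,u_t^k(z))+\varepsilon)$. (On $D_i\cup D_j$ all heights are pairwise different, so $u_t^*$ is defined there.) *)

theory Defs
  imports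
    "HOL-Probability.Probability"
    "HOL-Complex_Analysis.Complex_Analysis"
    "HOL-Computational_Algebra.Computational_Algebra"
begin

text \<open>
  Data: \<open>d\<close> distinct points \<open>lam 1, \<dots>, lam d\<close> with multiplicities \<open>a 1, \<dots>, a d\<close>, and a time
  \<open>t\<close>. Values of \<open>lam\<close> and \<open>a\<close> outside \<open>{1..d}\<close> are irrelevant.
\<close>

section \<open>The heat flow and the limiting zero distribution\<close>

definition total_mult :: "nat \<Rightarrow> (nat \<Rightarrow> nat) \<Rightarrow> nat" where
  "total_mult d a = (\<Sum>j=1..d. a j)"

definition base_poly :: "nat \<Rightarrow> (nat \<Rightarrow> complex) \<Rightarrow> (nat \<Rightarrow> nat) \<Rightarrow> complex poly" where
  "base_poly d lam a = (\<Prod>j=1..d. [:- lam j, 1:] ^ a j)"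

text \<open>
  \<open>exp_deriv2 c p\<close> is \<open>e\<^bsup>c \<partial>\<^sup>2\<^esup> p\<close>; the terms of the exponential series with \<open>2 * k > degree p\<close> vanish.
\<close>

definition exp_deriv2 :: "complex \<Rightarrow> complex poly \<Rightarrow> complex poly" where
  "exp_deriv2 c p = (\<Sum>k\<le>degree p. smult (c ^ k / fact k) ((pderiv ^^ (2 * k)) p))"

definition heat_poly ::
  "nat \<Rightarrow> (nat \<Rightarrow> complex) \<Rightarrow> (nat \<Rightarrow> nat) \<Rightarrow> real \<Rightarrow> nat \<Rightarrow> complex poly" where
  "heat_poly d lam a t n =
     exp_deriv2 (of_real (- t / (2 * real (total_mult d a) * real n))) (base_poly d lam a ^ n)"

text \<open>The zero counting measure: each zero carries mass \<open>multiplicity / (\<alpha> n)\<close>.\<close>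

definition zero_measure ::
  "nat \<Rightarrow> (nat \<Rightarrow> complex) \<Rightarrow> (nat \<Rightarrow> nat) \<Rightarrow> real \<Rightarrow> nat \<Rightarrow> complex measure" where
  "zero_measure d lam a t n =
     distr (point_measure {z. poly (heat_poly d lam a t n) z = 0}
              (\<lambda>z. ennreal (real (order z (heat_poly d lam a t n)) / (real (total_mult d a) * real n))))
       borel (\<lambda>z. z)"

definition weak_limit :: "(nat \<Rightarrow> 'a::topological_space measure) \<Rightarrow> 'a measure \<Rightarrow> bool" where
  "weak_limit M \<mu> \<longleftrightarrow> prob_space \<mu> \<and> sets \<mu> = sets borel \<and>
     (\<forall>f :: 'a \<Rightarrow> real. continuous_on UNIV f \<and> bounded (range f) \<longrightarrow>
        (\<lambda>n. \<integral>x. f x \<partial>M n) \<longlonglongrightarrow> (\<integral>x. f x \<partial>\<mu>))"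


section \<open>Heights and saddle points\<close>

definition height ::
  "nat \<Rightarrow> (nat \<Rightarrow> complex) \<Rightarrow> (nat \<Rightarrow> nat) \<Rightarrow> real \<Rightarrow> complex \<Rightarrow> complex \<Rightarrow> ereal" where
  "height d lam a t z u =
     (if u \<in> lam ` {1..d} then - \<infinity>
      else ereal ((\<Sum>j=1..d. real (a j) * ln (cmod (u - lam j))) / real (total_mult d a)
                  + Re ((z - u)\<^sup>2 / (2 * of_real t))))"

text \<open>Since \<open>x / 0 = 0\<close>, the points \<open>lam j\<close> have to be excluded explicitly.\<close>

definition saddle_points ::
  "nat \<Rightarrow> (nat \<Rightarrow> complex) \<Rightarrow> (nat \<Rightarrow> nat) \<Rightarrow> real \<Rightarrow> complex \<Rightarrow> complex set" where
  "saddle_points d lam a t z =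
     {u. u \<notin> lam ` {1..d} \<and>
         u + of_real t / of_nat (total_mult d a) * (\<Sum>j=1..d. of_nat (a j) / (u - lam j)) = z}"

definition saddle_poly ::
  "nat \<Rightarrow> (nat \<Rightarrow> complex) \<Rightarrow> (nat \<Rightarrow> nat) \<Rightarrow> real \<Rightarrow> complex \<Rightarrow> complex poly" where
  "saddle_poly d lam a t z =
     smult (of_real t / of_nat (total_mult d a))
       (\<Sum>j=1..d. smult (of_nat (a j)) (\<Prod>k\<in>{1..d} - {j}. [:- lam k, 1:]))
     - [:z, - 1:] * (\<Prod>j=1..d. [:- lam j, 1:])"

definition branch_set ::
  "nat \<Rightarrow> (nat \<Rightarrow> complex) \<Rightarrow> (nat \<Rightarrow> nat) \<Rightarrow> real \<Rightarrow> complex set" where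
  "branch_set d lam a t = {z. \<exists>u. order u (saddle_poly d lam a t z) \<ge> 2}"

definition saddle_branches ::
  "nat \<Rightarrow> (nat \<Rightarrow> complex) \<Rightarrow> (nat \<Rightarrow> nat) \<Rightarrow> real \<Rightarrow> complex set \<Rightarrow> (nat \<Rightarrow> complex \<Rightarrow> complex) \<Rightarrow> bool"
where
  "saddle_branches d lam a t D u \<longleftrightarrow>
     (\<forall>k\<in>{1..d+1}. u k analytic_on D) \<and>
     (\<forall>z\<in>D. bij_betw (\<lambda>k. u k z) {1..d+1} (saddle_points d lam a t z))"

definition equal_height_set ::
  "nat \<Rightarrow> (nat \<Rightarrow> complex) \<Rightarrow> (nat \<Rightarrow> nat) \<Rightarrow> real \<Rightarrow> complex set \<Rightarrow> (nat \<Rightarrow> complex \<Rightarrow> complex)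
     \<Rightarrow> nat \<Rightarrow> nat \<Rightarrow> complex set" where
  "equal_height_set d lam a t D u i j =
     {z \<in> D. height d lam a t z (u i z) = height d lam a t z (u j z)}"


section \<open>The maximally relevant saddle point\<close>

definition sublevel ::
  "nat \<Rightarrow> (nat \<Rightarrow> complex) \<Rightarrow> (nat \<Rightarrow> nat) \<Rightarrow> real \<Rightarrow> complex \<Rightarrow> ereal \<Rightarrow> complex set" where
  "sublevel d lam a t z h = {u. height d lam a t z u \<le> h}"

text \<open>\<open>S\<close> contains a path connecting \<open>- \<i>\<infinity>\<close> and \<open>+ \<i>\<infinity>\<close>.\<close>

definition connects_imaginary_infinities :: "complex set \<Rightarrow> bool" where
  "connects_imaginary_infinities S \<longleftrightarrow>
     (\<exists>C>0. \<exists>\<gamma>. path \<gamma> \<and> pathstart \<gamma> = - (\<i> * of_real C) \<and> pathfinish \<gamma> = \<i> * of_real C \<and>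
        path_image \<gamma> \<subseteq> S \<and>
        (\<forall>y\<ge>C. \<i> * of_real y \<in> S \<and> - (\<i> * of_real y) \<in> S))"

definition max_relevant_saddle ::
  "nat \<Rightarrow> (nat \<Rightarrow> complex) \<Rightarrow> (nat \<Rightarrow> nat) \<Rightarrow> real \<Rightarrow> complex \<Rightarrow> complex" where
  "max_relevant_saddle d lam a t z =
     (THE w. w \<in> saddle_points d lam a t z \<and>
        (\<forall>\<epsilon>>0. \<not> connects_imaginary_infinities
                  (sublevel d lam a t z (height d lam a t z w - ereal \<epsilon>)) \<and>
                connects_imaginary_infinities
                  (sublevel d lam a t z (height d lam a t z w + ereal \<epsilon>))))"


section \<open>Domains, analytic curves and length\<close>

definition simply_connected_domain :: "complex set \<Rightarrow> bool" where
  "simply_connected_domain S \<longleftrightarrow> open S \<and> connected S \<and> S \<noteq> {} \<and> simply_connected S"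

definition real_analytic_on :: "(real \<Rightarrow> complex) \<Rightarrow> real set \<Rightarrow> bool" where
  "real_analytic_on \<gamma> I \<longleftrightarrow>
     (\<forall>x\<in>I. \<exists>r>0. \<exists>c. \<forall>y. \<bar>y - x\<bar> < r \<longrightarrow> (\<lambda>n. (y - x) ^ n *\<^sub>R c n) sums \<gamma> y)"

text \<open>\<open>\<gamma>\<close> is a regular injective real analytic parametrization of \<open>\<Gamma>\<close> over the
  (bounded or unbounded) open interval \<open>I\<close>.\<close>

definition analytic_parametrization :: "(real \<Rightarrow> complex) \<Rightarrow> real set \<Rightarrow> complex set \<Rightarrow> bool" where
  "analytic_parametrization \<gamma> I \<Gamma> \<longleftrightarrow>
     open I \<and> is_interval I \<and> I \<noteq> {} \<and> real_analytic_on \<gamma> I \<and>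
     (\<forall>s\<in>I. vector_derivative \<gamma> (at s) \<noteq> 0) \<and> inj_on \<gamma> I \<and> \<gamma> ` I = \<Gamma>"

definition real_analytic_curve :: "complex set \<Rightarrow> bool" where
  "real_analytic_curve \<Gamma> \<longleftrightarrow> (\<exists>\<gamma> I. analytic_parametrization \<gamma> I \<Gamma>)"

text \<open>
  The length measure on \<open>\<gamma> ` I\<close>: the image under \<open>\<gamma>\<close> of \<open>\<bar>\<gamma>'(s)\<bar> ds\<close>. It does not depend on the
  choice of the parametrization.
\<close>

definition length_measure :: "(real \<Rightarrow> complex) \<Rightarrow> real set \<Rightarrow> complex measure" where
  "length_measure \<gamma> I =
     distr (density (restrict_space lborel I) (\<lambda>s. ennreal (norm (vector_derivative \<gamma> (at s)))))
       (restrict_space borel (\<gamma> ` I)) \<gamma>"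

definition has_length_density :: "complex measure \<Rightarrow> complex set \<Rightarrow> (complex \<Rightarrow> real) \<Rightarrow> bool" where
  "has_length_density \<mu> \<Gamma> \<rho> \<longleftrightarrow>
     (\<forall>\<gamma> I. analytic_parametrization \<gamma> I \<Gamma> \<longrightarrow>
        restrict_space \<mu> \<Gamma> = density (length_measure \<gamma> I) (\<lambda>z. ennreal (\<rho> z)))"

text \<open>
  The two components \<open>D1\<close>, \<open>D2\<close> carry no prescribed order relative to the branches \<open>u i\<close>, \<open>u j\<close>,
  so both namings are allowed.
\<close>

definition branch_switches ::
  "nat \<Rightarrow> (nat \<Rightarrow> complex) \<Rightarrow> (nat \<Rightarrow> nat) \<Rightarrow> real \<Rightarrow> (nat \<Rightarrow> complex \<Rightarrow> complex)
     \<Rightarrow> nat \<Rightarrow> nat \<Rightarrow> complex set \<Rightarrow> complex set \<Rightarrow> bool" where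
  "branch_switches d lam a t u i j D1 D2 \<longleftrightarrow>
     (\<forall>z\<in>D1. max_relevant_saddle d lam a t z = u i z) \<and>
     (\<forall>z\<in>D2. max_relevant_saddle d lam a t z = u j z)
   \<or> (\<forall>z\<in>D1. max_relevant_saddle d lam a t z = u j z) \<and>
     (\<forall>z\<in>D2. max_relevant_saddle d lam a t z = u i z)"

end

theory Submission
  imports Defs "HOL-Real_Asymp.Real_Asymp"
begin

text \<open>
  As a Gaussian average of \<open>P\<^sup>n\<close>, the value \<open>P\<^sub>t\<^sup>n(z)\<close> is a vertical line integral of \<open>\<Phi>\<^sup>n\<close>, where
  \<open>\<Phi>(u) = P(u) exp(\<alpha> (u - z)\<^sup>2 / 2t)\<close> is entire and \<open>\<bar>\<Phi>(u)\<bar> = exp(\<alpha> G(z, u))\<close>. Let \<open>\<eta>\<close> be the infimum of the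
  levels of \<open>\<bar>\<Phi>\<bar>\<close> at which \<open>-i\<infinity>\<close> and \<open>+i\<infinity>\<close> are connected. The two end components of \<open>{\<bar>\<Phi>\<bar> < \<eta>}\<close> are
  disjoint, yet by compactness a connecting continuum survives in \<open>{\<bar>\<Phi>\<bar> \<le> \<eta>}\<close>; near a noncritical point
  of the level set, \<open>{\<bar>\<Phi>\<bar> < \<eta>}\<close> is connected, so the continuum passes through a saddle in the closure of
  both components. Moving the contour through this saddle, Laplace's method yields
  \<open>log \<bar>P\<^sub>t\<^sup>n(z)\<bar> / \<alpha>n \<longrightarrow> G(z, u\<^sup>*(z))\<close> off \<open>\<Gamma>\<close>. Since \<open>\<eta>\<close> is continuous in \<open>z\<close>, the branch of \<open>u\<^sup>*\<close> is constant
  on \<open>D1\<close> and on \<open>D2\<close>, and only \<open>i\<close> and \<open>j\<close> can be exchanged at \<open>\<Gamma>\<close>.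

  The function \<open>f\<close> with \<open>Re f = G(z, u\<^sub>i) - G(z, u\<^sub>j)\<close> satisfies \<open>f' = (u\<^sub>j - u\<^sub>i) / t \<noteq> 0\<close>, hence is a conformal chart
  that straightens \<open>\<Gamma>\<close> to the imaginary axis. There the limiting potential is harmonic plus \<open>0\<close> or
  \<open>\<plusminus> max (Re w) 0\<close>. Jensen's formula on circles centred on the axis bounds the mass of a disc of radius
  \<open>r\<close> on both sides by difference quotients of circle means, which gives mass \<open>0\<close> or \<open>r/\<pi>\<close> and excludes the
  negative sign. Thus \<open>\<mu>\<close> restricted to \<open>\<Gamma>\<close> is \<open>\<bar>f'\<bar>/2\<pi>\<close> times arc length.
\<close>

section \<open>The heat flow as a Gaussian average\<close>

text \<open>The potentials of the zero measures are known to converge only pointwise and only off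
  \<Gamma>, and a logarithm is no test function for weak convergence. Two devices overcome this.
  Jensen's formula is applied only to differences of circle means for two radii: as a function of
  the zero, the resulting kernel is continuous and bounded, so weak convergence applies to it. The
  circle means themselves converge because differences of logarithms on two circles are bounded in
  L2, uniformly in the zero and in n; this uniform integrability tolerates the two points where the
  circle crosses \<Gamma>. Weak convergence and means then meet in one identity for the limit
  measure.

  On the topological side the obstacle is noncompactness: paths run to infinity and need not
  converge as the level decreases. They are replaced by connected subsets of a rectangle, which is
  legitimate because |\<Phi>| is large on its vertical sides and decreases strictly when one moves
  outwards beyond its horizontal edges. Contours are never deformed explicitly; the powers of \<Phi>
  have entire primitives, so only the end points of arcs matter.\<close>

lemma higher_deriv_poly: "(deriv ^^ n) (poly p) = poly ((pderiv ^^ n) (p :: complex poly))"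
proof (induction n)
  case (Suc n)
  then show ?case by (auto intro!: ext DERIV_imp_deriv poly_DERIV)
qed auto

lemma pderiv_funpow_eq_0:
  fixes p :: "complex poly"
  assumes "degree p < n" shows "(pderiv ^^ n) p = 0"
proof -
  have "degree ((pderiv ^^ k) p) = degree p - k" for k
    by (induction k) (auto simp: degree_pderiv)
  moreover obtain m where n: "n = Suc m" using assms by (cases n) auto
  ultimately have "degree ((pderiv ^^ m) p) = 0" using assms by auto
  then show ?thesis by (simp add: n pderiv_eq_0_iff)
qed

text \<open>The cutoff is left free beyond the degree because the Gaussian mean pairs even with odd
  terms and therefore sums an even number of them.\<close>

lemma poly_taylor:
  fixes p :: "complex poly"
  assumes "degree p < n"
  shows "poly p (z + h) = (\<Sum>m<n. poly ((pderiv ^^ m) p) z / fact m * h ^ m)"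
proof -
  have "(\<lambda>m. (deriv ^^ m) (poly p) z / fact m * (z + h - z) ^ m) sums poly p (z + h)"
    by (rule holomorphic_power_series[of _ z "norm h + 1"])
       (auto intro!: holomorphic_intros simp: dist_norm)
  then have "(\<lambda>m. poly ((pderiv ^^ m) p) z / fact m * h ^ m) sums poly p (z + h)"
    by (simp add: higher_deriv_poly)
  moreover have "(\<lambda>m. poly ((pderiv ^^ m) p) z / fact m * h ^ m) sums
      (\<Sum>m<n. poly ((pderiv ^^ m) p) z / fact m * h ^ m)"
    by (rule sums_finite) (use assms in \<open>auto simp: pderiv_funpow_eq_0\<close>)
  ultimately show ?thesis by (rule sums_unique2)
qed

lemma sum_even_odd:
  fixes n :: nat
  shows "(\<Sum>m<2 * n. f m) = (\<Sum>k<n. f (2 * k) + f (2 * k + 1) :: 'a :: comm_monoid_add)"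
  by (induction n) (auto simp: ac_simps)

text \<open>In the Taylor expansion at \<open>z\<close> the odd Gaussian moments vanish. The even
  moment (2k)!/(2^k k!) cancels the Taylor factorial, and the vertical direction contributes (-s)^k,
  which leaves exactly the coefficient (-s/2)^k/k! of \<open>exp_deriv2\<close>.\<close>

lemma gaussian_mean_poly:
  fixes p :: "complex poly" and s :: real
  assumes "s \<ge> 0"
  shows "has_bochner_integral lborel
    (\<lambda>x. of_real (std_normal_density x) * poly p (z + \<i> * of_real (sqrt s * x)))
    (poly (exp_deriv2 (of_real (- s / 2)) p) z)"
proof -
  define c where "c m = poly ((pderiv ^^ m) p) z / fact m * (\<i> * of_real (sqrt s)) ^ m" for m
  define g where "g m x = complex_of_real (std_normal_density x * x ^ m) * c m" for m x
  have 1: "has_bochner_integral lborel (g (2 * k))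
      (of_real (fact (2 * k) / (2 ^ k * fact k)) * c (2 * k))" for k
    unfolding g_def
    by (intro has_bochner_integral_mult_left has_bochner_integral_of_real std_normal_moment_even)
  have 2: "has_bochner_integral lborel (g (2 * k + 1)) (of_real 0 * c (2 * k + 1))" for k
    unfolding g_def
    by (intro has_bochner_integral_mult_left has_bochner_integral_of_real std_normal_moment_odd)
  \<comment> \<open>\<open>exp_deriv2\<close> lets k run up to the degree itself, so derivatives of
    up to twice that order are summed; those beyond the degree vanish.\<close>
  let ?n = "Suc (degree p)"
  have "has_bochner_integral lborel (\<lambda>x. \<Sum>k<?n. g (2 * k) x + g (2 * k + 1) x)
     (\<Sum>k<?n. of_real (fact (2 * k) / (2 ^ k * fact k)) * c (2 * k) + of_real 0 * c (2 * k + 1))"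
    by (intro has_bochner_integral_sum has_bochner_integral_add 1 2)
  moreover have "(\<Sum>k<?n. g (2 * k) x + g (2 * k + 1) x) =
      of_real (std_normal_density x) * poly p (z + \<i> * of_real (sqrt s * x))" for x
  proof -
    have "(\<Sum>k<?n. g (2 * k) x + g (2 * k + 1) x) = (\<Sum>m<2 * ?n. g m x)"
      by (rule sum_even_odd[symmetric])
    also have "\<dots> = of_real (std_normal_density x) * (\<Sum>m<2 * ?n.
        poly ((pderiv ^^ m) p) z / fact m * (\<i> * of_real (sqrt s * x)) ^ m)"
      unfolding sum_distrib_left g_def c_def
      by (intro sum.cong refl) (simp add: power_mult_distrib)
    also have "\<dots> = of_real (std_normal_density x) * poly p (z + \<i> * of_real (sqrt s * x))"
      by (subst poly_taylor[of p "2 * ?n"]) auto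
    finally show ?thesis .
  qed
  moreover have "(\<Sum>k<?n. of_real (fact (2 * k) / (2 ^ k * fact k)) * c (2 * k) + of_real 0 * c (2 * k + 1))
     = poly (exp_deriv2 (of_real (- s / 2)) p) z"
  proof -
    have "of_real (fact (2 * k) / (2 ^ k * fact k)) * c (2 * k) =
        of_real (- s / 2) ^ k / fact k * poly ((pderiv ^^ (2 * k)) p) z" for k
    proof -
      have "(\<i> * complex_of_real (sqrt s)) ^ (2 * k) = (of_real (- s)) ^ k"
        using assms by (simp add: power_mult power_mult_distrib flip: of_real_power)
      then show ?thesis
        by (simp add: c_def field_simps power_divide flip: power_mult_distrib)
    qed
    then show ?thesis
      by (simp add: exp_deriv2_def poly_sum lessThan_Suc_atMost)
  qed
  ultimately show ?thesis by (simp only:)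
qed

text \<open>Every term with k > 0 has smaller degree, so the top coefficient comes from k = 0
  alone.\<close>

lemma degree_exp_deriv2: "degree (exp_deriv2 c p) = degree p"
  and lead_coeff_exp_deriv2: "lead_coeff (exp_deriv2 c p) = lead_coeff p"
proof -
  let ?q = "exp_deriv2 c p"
  have d: "degree ((pderiv ^^ k) p) = degree p - k" for k
    by (induction k) (auto simp: degree_pderiv)
  have 1: "degree ?q \<le> degree p"
    unfolding exp_deriv2_def by (intro degree_sum_le) (auto simp: d intro: order.trans[OF degree_smult_le])
  have "coeff ?q (degree p) = (\<Sum>k\<le>degree p. if k = 0 then lead_coeff p else 0)"
    unfolding exp_deriv2_def coeff_sum
  proof (intro sum.cong refl)
    fix k assume k: "k \<in> {..degree p}"
    show "coeff (smult (c ^ k / fact k) ((pderiv ^^ (2 * k)) p)) (degree p) = (if k = 0 then lead_coeff p else 0)"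
    proof (cases "k = 0")
      case False
      then have "degree ((pderiv ^^ (2 * k)) p) < degree p" using k by (auto simp: d)
      then show ?thesis using False by (simp add: coeff_eq_0)
    qed auto
  qed
  then have 2: "coeff ?q (degree p) = lead_coeff p" by simp
  then have "degree p \<le> degree ?q"
    by (metis degree_0 le_degree leading_coeff_0_iff zero_le)
  with 1 show *: "degree ?q = degree p" by simp
  show "lead_coeff ?q = lead_coeff p" using 2 * by simp
qed

lemma degree_base_poly: "degree (base_poly d lam a) = total_mult d a"
  unfolding base_poly_def total_mult_def
  by (subst degree_prod_eq_sum_degree) (auto simp: degree_linear_power)

lemma monic_base_poly: "lead_coeff (base_poly d lam a) = 1"
  unfolding base_poly_def by (simp add: lead_coeff_prod lead_coeff_power)

lemma poly_base_poly: "poly (base_poly d lam a) z = (\<Prod>j=1..d. (z - lam j) ^ a j)"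
  unfolding base_poly_def by (simp add: poly_prod algebra_simps)

lemma degree_heat_poly: "degree (heat_poly d lam a t n) = total_mult d a * n"
  unfolding heat_poly_def degree_exp_deriv2
  by (subst degree_power_eq) (use monic_base_poly[of d lam a] in \<open>auto simp: degree_base_poly\<close>)

lemma monic_heat_poly: "lead_coeff (heat_poly d lam a t n) = 1"
  unfolding heat_poly_def lead_coeff_exp_deriv2 by (simp add: lead_coeff_power monic_base_poly)

lemma heat_poly_nonzero: "heat_poly d lam a t n \<noteq> 0"
  using monic_heat_poly[of d lam a t n] by auto

definition phi :: "nat \<Rightarrow> (nat \<Rightarrow> complex) \<Rightarrow> (nat \<Rightarrow> nat) \<Rightarrow> real \<Rightarrow> complex \<Rightarrow> complex \<Rightarrow> complex" where
  "phi d lam a t z u = poly (base_poly d lam a) u * exp (of_real (real (total_mult d a) / (2 * t)) * (u - z)\<^sup>2)"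

text \<open>The variance s satisfies 1/(2s) = \<alpha> n/(2t), so after y = sqrt(s) x the Gaussian
  weight is the n-th power of the exponential in \<open>phi\<close>. The normalising factor stays
  with the polynomial; it is a power of n up to a constant and does not affect exponential
  rates.\<close>

lemma heat_poly_integral:
  assumes t: "t > 0" and al: "total_mult d a > 0" and n: "n > 0"
  shows "has_bochner_integral lborel (\<lambda>y. phi d lam a t z (z + \<i> * of_real y) ^ n)
     (of_real (sqrt (2 * pi * t / (real (total_mult d a) * n))) * poly (heat_poly d lam a t n) z)"
proof -
  define s where "s = t / (real (total_mult d a) * n)"
  have s: "s > 0" using assms by (simp add: s_def)
  let ?f = "\<lambda>x. complex_of_real (std_normal_density x) * poly (base_poly d lam a ^ n) (z + \<i> * of_real (sqrt s * x))"
  have "has_bochner_integral lborel ?f (poly (heat_poly d lam a t n) z)"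
    using gaussian_mean_poly[of s "base_poly d lam a ^ n" z] s
    unfolding heat_poly_def s_def by (simp add: field_simps)
  then have "has_bochner_integral lborel (\<lambda>y. ?f (0 + (1 / sqrt s) * y)) (poly (heat_poly d lam a t n) z /\<^sub>R \<bar>1 / sqrt s\<bar>)"
    by (subst (asm) lborel_has_bochner_integral_real_affine_iff[of "1 / sqrt s" _ _ 0]) (use s in auto)
  then have "has_bochner_integral lborel (\<lambda>y. of_real (sqrt (2 * pi)) * ?f (0 + (1 / sqrt s) * y)) (of_real (sqrt (2 * pi)) * (poly (heat_poly d lam a t n) z /\<^sub>R \<bar>1 / sqrt s\<bar>))"
    by (intro has_bochner_integral_mult_right) auto
  moreover have "complex_of_real (sqrt (2 * pi)) * ?f (0 + (1 / sqrt s) * y) = phi d lam a t z (z + \<i> * of_real y) ^ n" for y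
  proof -
    have e: "sqrt (2 * pi) * std_normal_density (y / sqrt s) = exp (- (y\<^sup>2 / (2 * s)))"
      using s by (simp add: std_normal_density_def power_divide real_sqrt_mult)
    have "phi d lam a t z (z + \<i> * of_real y) ^ n =
       poly (base_poly d lam a ^ n) (z + \<i> * of_real y) * exp (of_nat n * (of_real (real (total_mult d a) / (2 * t)) * (\<i> * of_real y)\<^sup>2))"
      by (simp only: phi_def power_mult_distrib exp_of_nat_mult poly_power add_diff_cancel_left')
    also have "of_nat n * (of_real (real (total_mult d a) / (2 * t)) * (\<i> * of_real y)\<^sup>2) = complex_of_real (- (y\<^sup>2 / (2 * s)))"
      using t al n by (simp add: s_def field_simps power2_eq_square)
    also have "exp \<dots> = of_real (sqrt (2 * pi) * std_normal_density (y / sqrt s))"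
      unfolding e by (rule exp_of_real)
    finally show ?thesis using s by simp
  qed
  moreover have "of_real (sqrt (2 * pi)) * (poly (heat_poly d lam a t n) z /\<^sub>R \<bar>1 / sqrt s\<bar>) = of_real (sqrt (2 * pi * t / (real (total_mult d a) * n))) * poly (heat_poly d lam a t n) z"
    using s t by (simp add: s_def real_sqrt_mult real_sqrt_divide scaleR_conv_of_real)
  ultimately show ?thesis by (simp only:)
qed

lemma ln_cmod_monic_poly:
  fixes p :: "complex poly"
  assumes "lead_coeff p = 1" "poly p z \<noteq> 0"
  shows "ln (cmod (poly p z)) = (\<Sum>w | poly p w = 0. real (order w p) * ln (cmod (z - w)))"
proof -
  have p0: "p \<noteq> 0" using assms by auto
  have fin: "finite {w. poly p w = 0}" using p0 by (rule poly_roots_finite)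
  have "poly p z = poly (\<Prod>w | poly p w = 0. [:- w, 1:] ^ order w p) z"
    using complex_poly_decompose[of p] assms by simp
  also have "\<dots> = (\<Prod>w | poly p w = 0. (z - w) ^ order w p)"
    by (simp add: poly_prod algebra_simps)
  finally have "ln (cmod (poly p z)) = ln (\<Prod>w | poly p w = 0. cmod (z - w) ^ order w p)"
    by (simp add: prod_norm[symmetric] norm_power)
  also have "\<dots> = (\<Sum>w | poly p w = 0. ln (cmod (z - w) ^ order w p))"
    by (rule ln_prod) (use assms fin in auto)
  also have "\<dots> = (\<Sum>w | poly p w = 0. real (order w p) * ln (cmod (z - w)))"
    by (simp add: ln_realpow)
  finally show ?thesis .
qed

lemma sum_order_eq_degree:
  fixes p :: "complex poly"
  assumes "p \<noteq> 0"
  shows "(\<Sum>w | poly p w = 0. order w p) = degree p"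
proof -
  have "degree p = degree (\<Prod>w | poly p w = 0. [:- w, 1:] ^ order w p)"
    using complex_poly_decompose[of p] assms by (metis degree_smult_eq leading_coeff_0_iff)
  also have "\<dots> = (\<Sum>w | poly p w = 0. order w p)"
    by (subst degree_prod_eq_sum_degree) (simp_all add: degree_linear_power)
  finally show ?thesis by simp
qed

lemma integral_zero_measure:
  fixes f :: "complex \<Rightarrow> real"
  assumes "f \<in> borel_measurable borel"
  shows "(\<integral>x. f x \<partial>zero_measure d lam a t n) =
    (\<Sum>w | poly (heat_poly d lam a t n) w = 0. real (order w (heat_poly d lam a t n)) / (real (total_mult d a) * real n) * f w)"
  unfolding zero_measure_def
  by (subst integral_distr)
     (use assms poly_roots_finite[OF heat_poly_nonzero] in \<open>auto simp: lebesgue_integral_point_measure_finite mult.commute\<close>)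

section \<open>The mountain pass level\<close>

text \<open>In the local inverse of \<open>f\<close> the strict sublevel set becomes the
  intersection of a disc about \<open>f p\<close> with the disc of radius \<open>cmod (f p)\<close>
  about 0. This is convex, hence connected, and contraction towards 0 approaches its boundary points
  from inside.\<close>

lemma sublevel_locally_connected:
  fixes f :: "complex \<Rightarrow> complex"
  assumes f: "f holomorphic_on UNIV" and df: "deriv f p \<noteq> 0" and fp: "f p \<noteq> 0"
  obtains N where "open N" "p \<in> N" "connected (N \<inter> {u. cmod (f u) < cmod (f p)})"
    "N \<inter> {u. cmod (f u) \<le> cmod (f p)} \<subseteq> closure (N \<inter> {u. cmod (f u) < cmod (f p)})"
proof -
  obtain r where r: "r > 0" "open (f ` ball p r)" "inj_on f (ball p r)"
    by (rule has_complex_derivative_locally_invertible[OF f _ _ df]) auto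
  have cf: "continuous_on S f" for S
    using f holomorphic_on_imp_continuous_on continuous_on_subset by blast
  obtain g where g: "homeomorphism (ball p r) (f ` ball p r) f g"
    using invariance_of_domain_homeomorphism[OF open_ball cf _ r(3)] by auto
  obtain e where e: "e > 0" "ball (f p) e \<subseteq> f ` ball p r"
    using r(1,2) by (meson centre_in_ball imageI openE)
  define N where "N = ball p r \<inter> f -` ball (f p) e"
  let ?W = "ball (f p) e \<inter> ball 0 (cmod (f p))"
  have gf: "g (f u) = u" if "u \<in> ball p r" for u
    using g that by (auto simp: homeomorphism_def)
  have fg: "f (g v) = v" "g v \<in> ball p r" if "v \<in> ball (f p) e" for v
    using g that e by (auto simp: homeomorphism_def)
  have cg: "continuous_on (ball (f p) e) g"
    using g e continuous_on_subset by (auto simp: homeomorphism_def)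
  have eq: "N \<inter> {u. cmod (f u) < cmod (f p)} = g ` ?W"
  proof (intro equalityI subsetI)
    fix u assume "u \<in> N \<inter> {u. cmod (f u) < cmod (f p)}"
    then show "u \<in> g ` ?W" using gf by (auto simp: N_def intro!: image_eqI[of _ _ "f u"])
  next
    fix u assume "u \<in> g ` ?W"
    then show "u \<in> N \<inter> {u. cmod (f u) < cmod (f p)}" using fg by (auto simp: N_def)
  qed
  show ?thesis
  proof (rule that[of N])
    show "open N" unfolding N_def by (intro open_Int open_vimage) (use f cf in \<open>auto simp: continuous_on_eq_continuous_within\<close>)
    show "p \<in> N" using r e by (auto simp: N_def)
    show "connected (N \<inter> {u. cmod (f u) < cmod (f p)})"
      unfolding eq by (intro connected_continuous_image continuous_on_subset[OF cg] convex_connected convex_Int) auto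
    show "N \<inter> {u. cmod (f u) \<le> cmod (f p)} \<subseteq> closure (N \<inter> {u. cmod (f u) < cmod (f p)})"
    proof
      fix u assume u: "u \<in> N \<inter> {u. cmod (f u) \<le> cmod (f p)}"
      define v where "v = f u"
      have v: "v \<in> ball (f p) e" "cmod v \<le> cmod (f p)" "u = g v"
        using u gf by (auto simp: v_def N_def)
      \<comment> \<open>Contraction towards 0 makes the modulus strictly smaller while converging to
        \<open>v\<close>. At \<open>v = 0\<close> it does nothing, and strictness comes from
        \<open>f p \<noteq> 0\<close>.\<close>
      define vs where "vs n = of_real (1 - inverse (real (Suc n))) * v" for n
      have "(\<lambda>n. of_real (1 - inverse (real (Suc n))) * v) \<longlonglongrightarrow> of_real (1 - 0) * v"
        by (intro tendsto_intros LIMSEQ_inverse_real_of_nat)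
      then have lim: "vs \<longlonglongrightarrow> v" by (simp add: vs_def[abs_def])
      then have ev: "eventually (\<lambda>n. vs n \<in> ball (f p) e) sequentially"
        using topological_tendstoD[OF lim open_ball v(1)] by simp
      have small: "cmod (vs n) < cmod (f p)" for n
      proof (cases "v = 0")
        case False
        have "cmod (vs n) = (1 - inverse (real (Suc n))) * cmod v"
          unfolding vs_def norm_mult norm_of_real by (simp add: field_simps)
        also have "\<dots> < 1 * cmod v" using False by (intro mult_strict_right_mono) auto
        finally show ?thesis using v by simp
      qed (use fp in \<open>auto simp: vs_def\<close>)
      have "continuous (at v) g"
        using cg v(1) by (simp add: continuous_on_eq_continuous_at)
      then have "(\<lambda>n. g (vs n)) \<longlonglongrightarrow> g v" using lim by (rule isCont_tendsto_compose)
      moreover have "eventually (\<lambda>n. g (vs n) \<in> closure (N \<inter> {u. cmod (f u) < cmod (f p)})) sequentially"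
        using ev by eventually_elim (use small closure_subset in \<open>fastforce simp: eq\<close>)
      ultimately have "g v \<in> closure (N \<inter> {u. cmod (f u) < cmod (f p)})"
        by (intro Lim_in_closed_set[OF closed_closure]) auto
      then show "u \<in> closure (N \<inter> {u. cmod (f u) < cmod (f p)})" using v by simp
    qed
  qed
qed

text \<open>The local condition makes \<open>S \<inter> closure B\<close> relatively open in
  \<open>S\<close>: near such a point \<Omega> is connected and meets \<open>B\<close>, so it lies
  in \<open>B\<close> there, and \<open>S\<close> lies in its closure. Adding \<open>T\<close> to
  this part and \<open>T'\<close> to the rest splits \<open>E\<close> into two closed pieces. The
  abstract form serves both an open sublevel set at a higher level than \<open>S\<close> and one at
  the same level.\<close>

lemma connected_component_separation:
  fixes \<Omega> S T T' E :: "complex set"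
  assumes \<Omega>: "open \<Omega>" and S: "compact S" and T: "compact T" "compact T'" "T \<inter> T' = {}"
    and E: "connected E" "E \<subseteq> S \<union> T \<union> T'" "E \<inter> T \<noteq> {}" "E \<inter> T' \<noteq> {}"
    and B: "B = connected_component_set \<Omega> b"
    and ST: "S \<inter> T \<subseteq> closure B"
    and loc: "\<And>p. p \<in> S \<inter> closure B \<Longrightarrow> p \<notin> T' \<and>
      (\<exists>N. open N \<and> p \<in> N \<and> connected (N \<inter> \<Omega>) \<and> N \<inter> S \<subseteq> closure (N \<inter> \<Omega>))"
  shows False
proof -
  obtain N where N: "\<And>p. p \<in> S \<inter> closure B \<Longrightarrow> open (N p) \<and> p \<in> N p \<and> connected (N p \<inter> \<Omega>) \<and> N p \<inter> S \<subseteq> closure (N p \<inter> \<Omega>)"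
    using loc by metis
  have NB: "N p \<inter> S \<subseteq> closure B" if p: "p \<in> S \<inter> closure B" for p
  proof -
    have "N p \<inter> B \<noteq> {}" using N[OF p] p by (metis IntD2 disjoint_iff_not_equal inf_commute open_Int_closure_eq_empty)
    then obtain q where q: "q \<in> N p" "q \<in> B" by auto
    have "B \<subseteq> \<Omega>" by (simp add: B connected_component_subset)
    then have "N p \<inter> \<Omega> \<subseteq> connected_component_set \<Omega> q"
      using N[OF p] q by (intro connected_component_maximal) auto
    also have "\<dots> = B" using q by (metis B connected_component_eq)
    finally show ?thesis using N[OF p] closure_mono by blast
  qed
  define O1 where "O1 = (\<Union>p\<in>S \<inter> closure B. N p)"
  have O1: "open O1" "S \<inter> closure B = S \<inter> O1"
    using N NB by (auto simp: O1_def)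
  have c1: "closed (S \<inter> closure B \<union> T)" using S T by (intro closed_Un closed_Int compact_imp_closed closed_closure)
  have "S - closure B = S - O1" using O1 by auto
  then have c2: "closed ((S - closure B) \<union> T')" using S T O1 by (auto intro!: closed_Un closed_Diff intro: compact_imp_closed)
  have "(S \<inter> closure B \<union> T) \<inter> ((S - closure B) \<union> T') \<inter> E = {}"
    using loc ST T by blast
  then show False using E c1 c2 by (auto simp: connected_closed)
qed

section \<open>Growth of \<Phi> in the vertical and horizontal directions\<close>

locale heat_data =
  fixes d :: nat and lam :: "nat \<Rightarrow> complex" and a :: "nat \<Rightarrow> nat" and t :: real
  assumes d: "d \<ge> 1" and a: "\<And>k. k \<in> {1..d} \<Longrightarrow> a k \<ge> 1" and t: "t > 0"
begin

abbreviation "al \<equiv> real (total_mult d a)"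
abbreviation "\<Phi> \<equiv> phi d lam a t"
definition "lam_bound = (\<Sum>j=1..d. cmod (lam j))"

lemma al_pos: "al > 0"
proof -
  have "a 1 \<le> total_mult d a" unfolding total_mult_def by (rule member_le_sum) (use d in auto)
  then show ?thesis using a[of 1] d by simp
qed

lemma lam_le: "j \<in> {1..d} \<Longrightarrow> cmod (lam j) \<le> lam_bound"
  unfolding lam_bound_def by (rule member_le_sum) auto

lemma lam_bound_nonneg: "lam_bound \<ge> 0" by (simp add: lam_bound_def sum_nonneg)

lemma cmod_phi: "cmod (\<Phi> z u) = (\<Prod>j=1..d. cmod (u - lam j) ^ a j) *
    exp (al / (2 * t) * ((Re u - Re z)\<^sup>2 - (Im u - Im z)\<^sup>2))"
  unfolding phi_def norm_mult poly_base_poly prod_norm[symmetric] norm_power norm_exp_eq_Re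
  using t by (simp add: power2_eq_square)

lemma prod_exp_bound: "(\<Prod>j=1..d. exp x ^ a j) = exp (al * x)"
  unfolding total_mult_def by (simp add: exp_sum sum_distrib_right flip: exp_of_nat_mult)

lemma phi_continuous: "continuous_on UNIV (\<lambda>(z, u). \<Phi> z u)"
  unfolding phi_def using t by (auto intro!: continuous_intros simp: case_prod_beta)

lemma phi_holomorphic: "\<Phi> z holomorphic_on S"
  unfolding phi_def by (intro holomorphic_intros)

lemma phi_continuous_on: "continuous_on S (\<Phi> z)"
  by (rule holomorphic_on_imp_continuous_on[OF phi_holomorphic])

lemma open_sub: "open {u. cmod (\<Phi> z u) < \<eta>}"
  by (intro open_Collect_less continuous_intros phi_continuous_on)

lemma closed_sub: "closed {u. cmod (\<Phi> z u) \<le> \<eta>}"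
  by (intro closed_Collect_le continuous_intros phi_continuous_on)

text \<open>On a vertical strip the Gaussian factor in Im u beats a polynomial of degree \<alpha>,
  which is bounded by an exponential through x \<le> exp x. All bounds are uniform in
  \<open>z\<close>.\<close>

lemma phi_decay:
  assumes "\<epsilon> > 0"
  obtains Y where "Y > 0" "\<And>z u. cmod z \<le> Z \<Longrightarrow> \<bar>Re u\<bar> \<le> X \<Longrightarrow> \<bar>Im u\<bar> \<ge> Y \<Longrightarrow> cmod (\<Phi> z u) \<le> \<epsilon> * exp (- \<bar>Im u\<bar>)"
proof -
  define \<beta> where "\<beta> = al / (2 * t)"
  have \<beta>: "\<beta> > 0" using al_pos t by (simp add: \<beta>_def)
  define c where "c = al * (X + lam_bound) + \<beta> * (X + Z)\<^sup>2 - ln \<epsilon>"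
  have "filterlim (\<lambda>y. \<beta> * (y - Z)\<^sup>2 - A * y - c) at_top at_top" for A
    using \<beta> by real_asymp
  \<comment> \<open>In the linear term, \<open>al\<close> pays for the polynomial and 1 for the
    promised factor exp(-|Im u|).\<close>
  from this[of "al + 1"] have "eventually (\<lambda>y. \<beta> * (y - Z)\<^sup>2 - (al + 1) * y - c > 0) at_top"
    unfolding filterlim_at_top_dense by blast
  then obtain Y0 where Y0: "\<And>y. y \<ge> Y0 \<Longrightarrow> \<beta> * (y - Z)\<^sup>2 - (al + 1) * y - c > 0"
    by (auto simp: eventually_at_top_linorder)
  show ?thesis
  proof (rule that[of "max 1 (max Y0 Z)"])
    fix z u assume z: "cmod z \<le> Z" and u: "\<bar>Re u\<bar> \<le> X" "\<bar>Im u\<bar> \<ge> max 1 (max Y0 Z)"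
    define y where "y = \<bar>Im u\<bar>"
    have "cmod (u - lam j) \<le> exp (X + y + lam_bound)" if "j \<in> {1..d}" for j
    proof -
      have "cmod (u - lam j) \<le> cmod u + cmod (lam j)" by (rule norm_triangle_ineq4)
      also have "\<dots> \<le> X + y + lam_bound"
        using cmod_le[of u] lam_le[OF that] u by (simp add: y_def)
      also have "\<dots> \<le> exp (X + y + lam_bound)" using exp_ge_add_one_self[of "X + y + lam_bound"] by linarith
      finally show ?thesis .
    qed
    then have 1: "(\<Prod>j=1..d. cmod (u - lam j) ^ a j) \<le> (\<Prod>j=1..d. exp (X + y + lam_bound) ^ a j)"
      by (intro prod_mono conjI power_mono) auto
    have "(Re u - Re z)\<^sup>2 \<le> (X + Z)\<^sup>2"
      by (rule power2_le_iff_abs_le[THEN iffD2]) (use z u abs_Re_le_cmod[of z] in auto)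
    moreover have "(Im u - Im z)\<^sup>2 \<ge> (y - Z)\<^sup>2"
      by (rule abs_le_square_iff[THEN iffD1]) (use z u abs_Im_le_cmod[of z] in \<open>auto simp: y_def\<close>)
    ultimately have 2: "al / (2 * t) * ((Re u - Re z)\<^sup>2 - (Im u - Im z)\<^sup>2) \<le> \<beta> * ((X + Z)\<^sup>2 - (y - Z)\<^sup>2)"
      unfolding \<beta>_def[symmetric] using \<beta> by (intro mult_left_mono) auto
    have "cmod (\<Phi> z u) \<le> exp (al * (X + y + lam_bound)) * exp (\<beta> * ((X + Z)\<^sup>2 - (y - Z)\<^sup>2))"
      unfolding cmod_phi using 1[unfolded prod_exp_bound] 2 by (intro mult_mono) auto
    also have "\<dots> = exp (al * (X + y + lam_bound) + \<beta> * ((X + Z)\<^sup>2 - (y - Z)\<^sup>2))" by (simp add: exp_add)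
    also have "\<dots> \<le> exp (ln \<epsilon> + - y)"
      using Y0[of y] u by (simp add: c_def y_def algebra_simps)
    also have "\<dots> = \<epsilon> * exp (- \<bar>Im u\<bar>)" using assms by (simp add: exp_add exp_diff exp_minus field_simps y_def)
    finally show "cmod (\<Phi> z u) \<le> \<epsilon> * exp (- \<bar>Im u\<bar>)" .
  qed auto
qed

text \<open>On a horizontal strip the exponent grows like \<beta> (Re u)^2, while the polynomial has
  modulus at least 1 far from its zeros. The sublevel sets in the strip therefore stay in a bounded
  rectangle.\<close>

lemma phi_sides:
  obtains X where "X > 0" "\<And>z u. cmod z \<le> Z \<Longrightarrow> \<bar>Im u\<bar> \<le> Y \<Longrightarrow> \<bar>Re u\<bar> \<ge> X \<Longrightarrow> cmod (\<Phi> z u) > \<eta>0"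
proof -
  define \<beta> where "\<beta> = al / (2 * t)"
  have \<beta>: "\<beta> > 0" using al_pos t by (simp add: \<beta>_def)
  have "filterlim (\<lambda>x. \<beta> * ((x - Z)\<^sup>2 - (Y + Z)\<^sup>2)) at_top at_top"
    using \<beta> by real_asymp
  then have "eventually (\<lambda>x. \<beta> * ((x - Z)\<^sup>2 - (Y + Z)\<^sup>2) > \<eta>0) at_top"
    by (auto simp: filterlim_at_top_dense)
  then obtain X0 where X0: "\<And>x. x \<ge> X0 \<Longrightarrow> \<beta> * ((x - Z)\<^sup>2 - (Y + Z)\<^sup>2) > \<eta>0"
    by (auto simp: eventually_at_top_linorder)
  show ?thesis
  proof (rule that[of "max (1 + lam_bound) (max X0 Z)"])
    show "0 < max (1 + lam_bound) (max X0 Z)" using lam_bound_nonneg by auto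
    fix z u assume z: "cmod z \<le> Z" and u: "\<bar>Im u\<bar> \<le> Y" "\<bar>Re u\<bar> \<ge> max (1 + lam_bound) (max X0 Z)"
    define x where "x = \<bar>Re u\<bar>"
    have "cmod (u - lam j) \<ge> 1" if "j \<in> {1..d}" for j
      using norm_triangle_ineq2[of u "lam j"] lam_le[OF that] u abs_Re_le_cmod[of u] by simp
    then have 1: "(\<Prod>j=1..d. cmod (u - lam j) ^ a j) \<ge> 1"
      by (intro prod_ge_1) auto
    have "(Im u - Im z)\<^sup>2 \<le> (Y + Z)\<^sup>2"
      by (rule power2_le_iff_abs_le[THEN iffD2]) (use z u abs_Im_le_cmod[of z] in auto)
    moreover have "(Re u - Re z)\<^sup>2 \<ge> (x - Z)\<^sup>2"
      by (rule abs_le_square_iff[THEN iffD1]) (use z u abs_Re_le_cmod[of z] in \<open>auto simp: x_def\<close>)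
    ultimately have 2: "al / (2 * t) * ((Re u - Re z)\<^sup>2 - (Im u - Im z)\<^sup>2) \<ge> \<beta> * ((x - Z)\<^sup>2 - (Y + Z)\<^sup>2)"
      unfolding \<beta>_def[symmetric] using \<beta> by (intro mult_left_mono) auto
    have "\<eta>0 < \<beta> * ((x - Z)\<^sup>2 - (Y + Z)\<^sup>2)" using X0[of x] u by (simp add: x_def)
    also have "\<dots> < exp (\<beta> * ((x - Z)\<^sup>2 - (Y + Z)\<^sup>2))" 
      using exp_ge_add_one_self[of "\<beta> * ((x - Z)\<^sup>2 - (Y + Z)\<^sup>2)"] by linarith
    also have "\<dots> \<le> 1 * exp (al / (2 * t) * ((Re u - Re z)\<^sup>2 - (Im u - Im z)\<^sup>2))" using 2 by simp
    also have "\<dots> \<le> cmod (\<Phi> z u)" unfolding cmod_phi using 1 by (intro mult_right_mono) auto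
    finally show "\<eta>0 < cmod (\<Phi> z u)" .
  qed
qed

text \<open>A vertical move by s multiplies each distance to a zero by at most 1 + s \<le> exp s,
  hence the polynomial by at most exp(\<alpha> s). The Gaussian factor loses more than that once the
  vertical distance to \<open>z\<close> exceeds \<open>t\<close>. The sign \<sigma> treats both ends
  at once.\<close>

lemma phi_vertical:
  obtains Y where "Y > 0" "\<And>z u s \<sigma>. cmod z \<le> Z \<Longrightarrow> \<sigma> \<in> {1, -1} \<Longrightarrow> \<sigma> * Im u \<ge> Y \<Longrightarrow> s > 0 \<Longrightarrow>
     cmod (\<Phi> z (u + \<i> * of_real (\<sigma> * s))) < cmod (\<Phi> z u)"
\<comment> \<open>\<open>1 + lam_bound\<close> keeps all distances to the zeros at least 1; the
  other two terms make the vertical distance to \<open>z\<close> exceed \<open>t\<close>.\<close>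
proof (rule that[of "1 + lam_bound + \<bar>Z\<bar> + t"])
  show "1 + lam_bound + \<bar>Z\<bar> + t > 0" using lam_bound_nonneg t by simp
  fix z u :: complex and s \<sigma> :: real
  assume z: "cmod z \<le> Z" and \<sigma>: "\<sigma> \<in> {1, -1}" and u: "\<sigma> * Im u \<ge> 1 + lam_bound + \<bar>Z\<bar> + t" and s: "s > 0"
  have \<sigma>2: "\<sigma> * \<sigma> = 1" "\<bar>\<sigma>\<bar> = 1" using \<sigma> by auto
  have u': "\<bar>Im u\<bar> \<ge> 1 + lam_bound" using u \<sigma> t by auto
  have dist: "cmod (u - lam j) \<ge> 1" if "j \<in> {1..d}" for j
    using norm_triangle_ineq2[of u "lam j"] lam_le[OF that] u' abs_Im_le_cmod[of u] by simp
  have "cmod (u + \<i> * of_real (\<sigma> * s) - lam j) \<le> cmod (u - lam j) * exp s" if j: "j \<in> {1..d}" for j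
  proof -
    have "cmod (u + \<i> * of_real (\<sigma> * s) - lam j) \<le> cmod (u - lam j) + cmod (\<i> * of_real (\<sigma> * s))"
      using norm_triangle_ineq[of "u - lam j" "\<i> * of_real (\<sigma> * s)"] by (simp add: algebra_simps)
    also have "\<dots> = cmod (u - lam j) + s" using s \<sigma>2 by (simp add: norm_mult abs_mult)
    also have "\<dots> \<le> cmod (u - lam j) * (1 + s)" using dist[OF j] s by (simp add: algebra_simps)
    also have "\<dots> \<le> cmod (u - lam j) * exp s" by (intro mult_left_mono) auto
    finally show ?thesis .
  qed
  then have "(\<Prod>j=1..d. cmod (u + \<i> * of_real (\<sigma> * s) - lam j) ^ a j) \<le> (\<Prod>j=1..d. (cmod (u - lam j) * exp s) ^ a j)"
    by (intro prod_mono conjI power_mono) auto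
  also have "\<dots> = (\<Prod>j=1..d. cmod (u - lam j) ^ a j) * exp (al * s)"
    unfolding power_mult_distrib prod.distrib prod_exp_bound ..
  finally have 1: "(\<Prod>j=1..d. cmod (u + \<i> * of_real (\<sigma> * s) - lam j) ^ a j) \<le> (\<Prod>j=1..d. cmod (u - lam j) ^ a j) * exp (al * s)" .
  have pos: "(\<Prod>j=1..d. cmod (u - lam j) ^ a j) > 0"
    by (intro prod_pos zero_less_power) (use dist in force)
  define v where "v = \<sigma> * (Im u - Im z)"
  have v: "v > t"
  proof -
    have "\<bar>\<sigma> * Im z\<bar> \<le> \<bar>Z\<bar>" using z \<sigma>2 abs_Im_le_cmod[of z] by (simp add: abs_mult)
    then show ?thesis using u lam_bound_nonneg unfolding v_def right_diff_distrib by linarith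
  qed
  have "(Im u + \<sigma> * s - Im z)\<^sup>2 - (Im u - Im z)\<^sup>2 = 2 * s * v + (\<sigma> * \<sigma>) * s\<^sup>2"
    by (simp add: v_def power2_eq_square algebra_simps)
  also have "\<dots> > 2 * s * t"
  proof -
    have "2 * s * t < 2 * s * v" using v s by simp
    moreover have "\<sigma> * \<sigma> * s\<^sup>2 \<ge> 0" by (simp add: \<sigma>2)
    ultimately show ?thesis by linarith
  qed
  finally have "al / (2 * t) * (2 * s * t) < al / (2 * t) * ((Im u + \<sigma> * s - Im z)\<^sup>2 - (Im u - Im z)\<^sup>2)"
    using al_pos t by (intro mult_strict_left_mono) auto
  then have 2: "al * s + al / (2 * t) * ((Re u - Re z)\<^sup>2 - (Im u + \<sigma> * s - Im z)\<^sup>2) < al / (2 * t) * ((Re u - Re z)\<^sup>2 - (Im u - Im z)\<^sup>2)"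
    using t by (simp add: algebra_simps)
  have "cmod (\<Phi> z (u + \<i> * of_real (\<sigma> * s))) \<le> ((\<Prod>j=1..d. cmod (u - lam j) ^ a j) * exp (al * s)) * exp (al / (2 * t) * ((Re u - Re z)\<^sup>2 - (Im u + \<sigma> * s - Im z)\<^sup>2))"
    unfolding cmod_phi using 1 by (intro mult_mono) (auto intro!: mult_nonneg_nonneg prod_nonneg)
  also have "\<dots> = (\<Prod>j=1..d. cmod (u - lam j) ^ a j) * exp (al * s + al / (2 * t) * ((Re u - Re z)\<^sup>2 - (Im u + \<sigma> * s - Im z)\<^sup>2))"
    by (simp add: exp_add)
  also have "\<dots> < cmod (\<Phi> z u)"
    unfolding cmod_phi using 2 pos by (intro mult_strict_left_mono) auto
  finally show "cmod (\<Phi> z (u + \<i> * of_real (\<sigma> * s))) < cmod (\<Phi> z u)" .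
qed

end

text \<open>The component of \<open>p\<close> serves as \<open>N\<close>. This supplies the local
  hypothesis of \<open>connected_component_separation\<close> at points inside the open set.\<close>

lemma open_component_local:
  fixes U :: "complex set"
  assumes "open U" "p \<in> U"
  shows "\<exists>N. open N \<and> p \<in> N \<and> connected (N \<inter> U) \<and> N \<inter> T \<subseteq> closure (N \<inter> U)"
proof -
  let ?N = "connected_component_set U p"
  have eq: "?N \<inter> U = ?N" using connected_component_subset[of U p] by (rule Int_absorb2)
  have "open ?N" using assms(1) by (rule open_connected_component)
  moreover have "p \<in> ?N" using assms(2) by (simp add: connected_component_refl_eq)
  moreover have "connected (?N \<inter> U)" unfolding eq by (rule connected_connected_component)
  moreover have "?N \<inter> T \<subseteq> closure (?N \<inter> U)" unfolding eq using closure_subset[of ?N] by blast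
  ultimately show ?thesis by blast
qed

section \<open>End components and connections inside a rectangle\<close>

context heat_data begin

abbreviation "\<Omega> z \<eta> \<equiv> {u. cmod (\<Phi> z u) < \<eta>}"
abbreviation "Sub z \<eta> \<equiv> {u. cmod (\<Phi> z u) \<le> \<eta>}"
abbreviation "conn z \<eta> \<equiv> connects_imaginary_infinities (Sub z \<eta>)"

text \<open>The tail condition picks out the component containing the far end of an imaginary
  half-axis, without fixing where the half-axis enters the sublevel set for good.\<close>

definition endcomp :: "complex \<Rightarrow> real \<Rightarrow> real \<Rightarrow> complex set" where
  "endcomp z \<eta> \<sigma> = {u. \<exists>y0. \<forall>y\<ge>y0. connected_component (\<Omega> z \<eta>) u (\<i> * of_real (\<sigma> * y))}"

definition decays_vertically :: "complex \<Rightarrow> real \<Rightarrow> bool" where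
  "decays_vertically z Y \<longleftrightarrow> Y > 0 \<and> (\<forall>u s \<sigma>. \<sigma> \<in> {1, -1} \<longrightarrow> \<sigma> * Im u \<ge> Y \<longrightarrow> s > 0 \<longrightarrow>
     cmod (\<Phi> z (u + \<i> * of_real (\<sigma> * s))) < cmod (\<Phi> z u))"

definition rectangle :: "real \<Rightarrow> real \<Rightarrow> complex set" where
  "rectangle X Y = {u. \<bar>Re u\<bar> \<le> X \<and> \<bar>Im u\<bar> \<le> Y}"

definition edge :: "real \<Rightarrow> real \<Rightarrow> real \<Rightarrow> complex set" where
  "edge X Y \<sigma> = {u. \<bar>Re u\<bar> \<le> X \<and> Im u = \<sigma> * Y}"

text \<open>A compact substitute for connecting the two infinities. Connected sets replace paths
  because they survive decreasing intersections of compacta, and the edges count in full because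
  clamping sends everything above and below the rectangle onto them.\<close>

definition boxconn :: "complex \<Rightarrow> real \<Rightarrow> real \<Rightarrow> real \<Rightarrow> bool" where
  "boxconn z \<eta> X Y \<longleftrightarrow> (\<exists>E. connected E \<and> E \<subseteq> (Sub z \<eta> \<inter> rectangle X Y) \<union> edge X Y 1 \<union> edge X Y (-1) \<and>
      E \<inter> edge X Y 1 \<noteq> {} \<and> E \<inter> edge X Y (-1) \<noteq> {})"

definition pass_level :: "complex \<Rightarrow> real" where
  "pass_level z = Inf {\<eta>. \<eta> > 0 \<and> conn z \<eta>}"

lemma rectangle_eq_cbox: "rectangle X Y = cbox (Complex (-X) (-Y)) (Complex X Y)"
  by (auto simp: rectangle_def in_cbox_complex_iff)

lemma edge_eq_cbox: "edge X Y \<sigma> = cbox (Complex (-X) (\<sigma> * Y)) (Complex X (\<sigma> * Y))"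
  by (auto simp: edge_def in_cbox_complex_iff)

lemma compact_rectangle: "compact (rectangle X Y)" and compact_edge: "compact (edge X Y \<sigma>)"
  and connected_edge: "connected (edge X Y \<sigma>)"
  by (auto simp: rectangle_eq_cbox edge_eq_cbox intro: convex_connected convex_box)

lemma compact_Sub_box: "compact (Sub z \<eta> \<inter> rectangle X Y)"
  using compact_rectangle closed_sub by (metis closed_Int_compact)

lemma axis_tail:
  assumes "\<eta> > 0"
  obtains C where "C > 0" "\<And>y. \<bar>y\<bar> \<ge> C \<Longrightarrow> cmod (\<Phi> z (\<i> * of_real y)) \<le> \<eta> / 2"
proof -
  obtain C where C: "C > 0" "\<And>z' u. cmod z' \<le> cmod z \<Longrightarrow> \<bar>Re u\<bar> \<le> 0 \<Longrightarrow> \<bar>Im u\<bar> \<ge> C \<Longrightarrow> cmod (\<Phi> z' u) \<le> \<eta> / 2 * exp (- \<bar>Im u\<bar>)"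
    using phi_decay[of "\<eta> / 2" "cmod z" 0] assms by auto
  show ?thesis
  proof (rule that[OF C(1)])
    fix y :: real assume "\<bar>y\<bar> \<ge> C"
    then have "cmod (\<Phi> z (\<i> * of_real y)) \<le> \<eta> / 2 * exp (- \<bar>y\<bar>)" using C(2)[of z "\<i> * of_real y"] by simp
    also have "\<dots> \<le> \<eta> / 2 * 1" using assms by (intro mult_left_mono) auto
    finally show "cmod (\<Phi> z (\<i> * of_real y)) \<le> \<eta> / 2" by simp
  qed
qed

lemma connected_component_segment: "closed_segment x y \<subseteq> S \<Longrightarrow> connected_component S x y"
  for x y :: complex
  by (rule connected_componentI[of "closed_segment x y"]) auto

lemma closed_segment_Complex:
  "u \<in> closed_segment (Complex x y) (Complex x y') \<Longrightarrow> \<exists>v\<in>closed_segment y y'. u = Complex x v"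
  "u \<in> closed_segment (Complex x y) (Complex x' y) \<Longrightarrow> \<exists>v\<in>closed_segment x x'. u = Complex v y"
  by (auto simp: closed_segment_def complex_eq_iff algebra_simps)

lemma endcomp_eq:
  assumes \<sigma>: "\<sigma> \<in> {1, -1}" and C: "C > 0" "\<And>y. \<bar>y\<bar> \<ge> C \<Longrightarrow> cmod (\<Phi> z (\<i> * of_real y)) < \<eta>"
  shows "endcomp z \<eta> \<sigma> = connected_component_set (\<Omega> z \<eta>) (\<i> * of_real (\<sigma> * C))"
proof -
  have *: "connected_component (\<Omega> z \<eta>) (\<i> * of_real (\<sigma> * C)) (\<i> * of_real (\<sigma> * y))" if "y \<ge> C" for y
  proof (rule connected_component_segment, rule subsetI)
    fix u assume "u \<in> closed_segment (\<i> * of_real (\<sigma> * C)) (\<i> * complex_of_real (\<sigma> * y))"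
    then have "u \<in> closed_segment (Complex 0 (\<sigma> * C)) (Complex 0 (\<sigma> * y))" by (simp add: Complex_eq)
    then obtain v where v: "v \<in> closed_segment (\<sigma> * C) (\<sigma> * y)" "u = Complex 0 v"
      using closed_segment_Complex(1) by blast
    have "\<bar>v\<bar> \<ge> C" using v(1) \<sigma> that by (auto simp: closed_segment_eq_real_ivl split: if_splits)
    then show "u \<in> \<Omega> z \<eta>" using C(2)[of v] v by (simp add: Complex_eq)
  qed
  show ?thesis
  proof (intro equalityI subsetI)
    fix u assume "u \<in> endcomp z \<eta> \<sigma>"
    then obtain y0 where y0: "\<forall>y\<ge>y0. connected_component (\<Omega> z \<eta>) u (\<i> * of_real (\<sigma> * y))" by (auto simp: endcomp_def)
    have "connected_component (\<Omega> z \<eta>) u (\<i> * of_real (\<sigma> * max y0 C))"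
      by (rule y0[THEN spec, THEN mp, OF max.cobounded1])
    then have "connected_component (\<Omega> z \<eta>) (\<i> * of_real (\<sigma> * C)) u"
      by (rule connected_component_trans[OF *[OF max.cobounded2] connected_component_sym])
    then show "u \<in> connected_component_set (\<Omega> z \<eta>) (\<i> * of_real (\<sigma> * C))" by (rule CollectI)
  next
    fix u assume "u \<in> connected_component_set (\<Omega> z \<eta>) (\<i> * of_real (\<sigma> * C))"
    then have "connected_component (\<Omega> z \<eta>) u (\<i> * of_real (\<sigma> * C))" using connected_component_sym by blast
    then have "connected_component (\<Omega> z \<eta>) u (\<i> * of_real (\<sigma> * y))" if "y \<ge> C" for y
      using *[OF that] by (rule connected_component_trans)
    then show "u \<in> endcomp z \<eta> \<sigma>" unfolding endcomp_def by blast
  qed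
qed

text \<open>Moving outwards vertically only lowers the modulus of \<Phi>. Far enough out the whole
  horizontal segment to the axis lies below \<eta>, and there the path turns towards the
  axis.\<close>

lemma ray_endcomp:
  assumes V: "decays_vertically z Y" and \<sigma>: "\<sigma> \<in> {1, -1}" and u: "cmod (\<Phi> z u) < \<eta>" "\<sigma> * Im u \<ge> Y"
  shows "u \<in> endcomp z \<eta> \<sigma>"
proof -
  have \<sigma>2: "\<sigma> * \<sigma> = 1" "\<bar>\<sigma>\<bar> = 1" using \<sigma> by auto
  have \<eta>: "\<eta> > 0" using u(1) norm_ge_zero le_less_trans by blast
  obtain C where C: "C > 0" "\<And>z' w. cmod z' \<le> cmod z \<Longrightarrow> \<bar>Re w\<bar> \<le> \<bar>Re u\<bar> \<Longrightarrow> \<bar>Im w\<bar> \<ge> C \<Longrightarrow> cmod (\<Phi> z' w) \<le> \<eta> / 2 * exp (- \<bar>Im w\<bar>)"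
    using phi_decay[of "\<eta> / 2" "cmod z" "\<bar>Re u\<bar>"] \<eta> by auto
  have C': "cmod (\<Phi> z w) < \<eta>" if "\<bar>Re w\<bar> \<le> \<bar>Re u\<bar>" "\<bar>Im w\<bar> \<ge> C" for w
  proof -
    have "cmod (\<Phi> z w) \<le> \<eta> / 2 * exp (- \<bar>Im w\<bar>)" using C(2)[of z w] that by simp
    also have "\<dots> \<le> \<eta> / 2 * 1" using \<eta> by (intro mult_left_mono) auto
    finally show ?thesis using \<eta> by simp
  qed
  have "connected_component (\<Omega> z \<eta>) u (\<i> * of_real (\<sigma> * y))" if y: "y \<ge> max C (\<sigma> * Im u)" for y
  proof -
    have u_eq: "u = Complex (Re u) (Im u)" by simp
    have "connected_component (\<Omega> z \<eta>) u (Complex (Re u) (\<sigma> * y))"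
    proof (rule connected_component_segment, rule subsetI)
      fix w assume "w \<in> closed_segment u (Complex (Re u) (\<sigma> * y))"
      then obtain v where v: "v \<in> closed_segment (Im u) (\<sigma> * y)" "w = Complex (Re u) v"
        using closed_segment_Complex(1) u_eq by metis
      define s where "s = \<sigma> * (v - Im u)"
      have s: "s \<ge> 0" using v(1) \<sigma> y by (auto simp: s_def closed_segment_eq_real_ivl split: if_splits)
      have w: "w = u + \<i> * of_real (\<sigma> * s)" using v(2) \<sigma>2 by (simp add: complex_eq_iff s_def flip: mult.assoc)
      show "w \<in> \<Omega> z \<eta>"
      proof (cases "s = 0")
        case False
        then have "cmod (\<Phi> z w) < cmod (\<Phi> z u)" using V \<sigma> u(2) s unfolding w decays_vertically_def by auto
        then show ?thesis using u by simp
      qed (use w u in auto)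
    qed
    moreover have "connected_component (\<Omega> z \<eta>) (Complex (Re u) (\<sigma> * y)) (Complex 0 (\<sigma> * y))"
    proof (rule connected_component_segment, rule subsetI)
      fix w assume "w \<in> closed_segment (Complex (Re u) (\<sigma> * y)) (Complex 0 (\<sigma> * y))"
      then obtain v where v: "v \<in> closed_segment (Re u) 0" "w = Complex v (\<sigma> * y)"
        using closed_segment_Complex(2) by blast
      have "\<bar>v\<bar> \<le> \<bar>Re u\<bar>" using v(1) by (auto simp: closed_segment_eq_real_ivl split: if_splits)
      then show "w \<in> \<Omega> z \<eta>" using C'[of w] v y \<sigma>2 C(1) by (simp add: abs_mult)
    qed
    moreover have "Complex 0 (\<sigma> * y) = \<i> * of_real (\<sigma> * y)" by (simp add: complex_eq_iff)
    ultimately show ?thesis by (metis connected_component_trans)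
  qed
  then show ?thesis unfolding endcomp_def by blast
qed

text \<open>A point on the level itself is outside the strict sublevel set, but an arbitrarily small
  outward push lowers the value strictly.\<close>

lemma ray_closure_endcomp:
  assumes V: "decays_vertically z Y" and \<sigma>: "\<sigma> \<in> {1, -1}" and u: "cmod (\<Phi> z u) \<le> \<eta>" "\<sigma> * Im u \<ge> Y"
  shows "u \<in> closure (endcomp z \<eta> \<sigma>)"
  unfolding closure_approachable
proof (intro allI impI)
  fix e :: real assume e: "e > 0"
  let ?w = "u + \<i> * of_real (\<sigma> * (e / 2))"
  have "cmod (\<Phi> z ?w) < cmod (\<Phi> z u)" using V \<sigma> u(2) half_gt_zero[OF e] unfolding decays_vertically_def by blast
  moreover have "\<sigma> * Im ?w \<ge> Y" using \<sigma> u(2) e by auto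
  ultimately have "?w \<in> endcomp z \<eta> \<sigma>" using ray_endcomp[OF V \<sigma>, of ?w] u(1) by simp
  moreover have "dist ?w u < e" using \<sigma> e by (auto simp: dist_norm norm_mult)
  ultimately show "\<exists>y\<in>endcomp z \<eta> \<sigma>. dist y u < e" by blast
qed

lemma conn_mono: "conn z \<eta> \<Longrightarrow> \<eta> \<le> \<eta>' \<Longrightarrow> conn z \<eta>'"
  unfolding connects_imaginary_infinities_def by (elim ex_forward conj_forward) (auto intro: order.trans)

text \<open>A joining path inside the strict sublevel set is compact, so the maximum on it is
  smaller than \<eta>. This gain is what keeps the end components apart at the critical
  level.\<close>

lemma endcomp_joined:
  assumes \<eta>: "\<eta> > 0" and ne: "endcomp z \<eta> 1 \<inter> endcomp z \<eta> (-1) \<noteq> {}"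
  obtains \<eta>' where "0 < \<eta>'" "\<eta>' < \<eta>" "conn z \<eta>'"
proof -
  obtain C where C: "C > 0" "\<And>y. \<bar>y\<bar> \<ge> C \<Longrightarrow> cmod (\<Phi> z (\<i> * of_real y)) \<le> \<eta> / 2"
    using axis_tail[OF \<eta>] by blast
  have C': "cmod (\<Phi> z (\<i> * of_real y)) < \<eta>" if "\<bar>y\<bar> \<ge> C" for y using C(2)[OF that] \<eta> by simp
  have e1: "endcomp z \<eta> 1 = connected_component_set (\<Omega> z \<eta>) (\<i> * of_real (1 * C))"
    and e2: "endcomp z \<eta> (-1) = connected_component_set (\<Omega> z \<eta>) (\<i> * of_real (-1 * C))"
    by (rule endcomp_eq; use C(1) C' in auto)+
  obtain q where "q \<in> endcomp z \<eta> 1" "q \<in> endcomp z \<eta> (-1)" using ne by blast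
  then have "connected_component (\<Omega> z \<eta>) (\<i> * of_real (-1 * C)) (\<i> * of_real (1 * C))"
    unfolding e1 e2 mem_Collect_eq by (meson connected_component_sym connected_component_trans)
  then have "path_component (\<Omega> z \<eta>) (- (\<i> * of_real C)) (\<i> * of_real C)"
    using open_sub[of z \<eta>] by (simp add: path_component_eq_connected_component open_imp_locally_path_connected)
  then obtain g where g: "path g" "path_image g \<subseteq> \<Omega> z \<eta>" "pathstart g = - (\<i> * of_real C)" "pathfinish g = \<i> * of_real C"
    by (auto simp: path_component_def)
  obtain w where w: "w \<in> path_image g" "\<And>v. v \<in> path_image g \<Longrightarrow> cmod (\<Phi> z v) \<le> cmod (\<Phi> z w)"
    using continuous_attains_sup[OF compact_path_image[OF g(1)] path_image_nonempty, of "\<lambda>v. cmod (\<Phi> z v)"]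
    by (auto intro: continuous_intros phi_continuous_on)
  show ?thesis
  \<comment> \<open>The path requires its own maximum; the half-axes beyond it require
    \<open>\<eta> / 2\<close>.\<close>
  proof (rule that[of "max (\<eta> / 2) (cmod (\<Phi> z w))"])
    show "max (\<eta> / 2) (cmod (\<Phi> z w)) < \<eta>" using g(2) w(1) \<eta> by auto
    show "conn z (max (\<eta> / 2) (cmod (\<Phi> z w)))"
      unfolding connects_imaginary_infinities_def
    proof (intro exI[of _ C] exI[of _ g] conjI g C(1) allI impI)
      show "path_image g \<subseteq> Sub z (max (\<eta> / 2) (cmod (\<Phi> z w)))" using w by force
      fix y assume "y \<ge> C"
      then show "\<i> * of_real y \<in> Sub z (max (\<eta> / 2) (cmod (\<Phi> z w)))"
        "- (\<i> * of_real y) \<in> Sub z (max (\<eta> / 2) (cmod (\<Phi> z w)))"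
        using C(2)[of y] C(2)[of "-y"] C(1) by auto
    qed
  qed (use \<eta> in auto)
qed

text \<open>Attaching both half-axes gives a connected set that reaches every height, so it can be
  clamped to a rectangle or cut by any horizontal line.\<close>

lemma conn_connected:
  assumes "conn z \<eta>"
  obtains E where "connected E" "E \<subseteq> Sub z \<eta>" "\<And>Y. \<exists>u\<in>E. Im u \<ge> Y" "\<And>Y. \<exists>u\<in>E. Im u \<le> - Y"
proof -
  obtain C g where C: "C > 0" and g: "path g" "pathstart g = - (\<i> * of_real C)" "pathfinish g = \<i> * of_real C"
     "path_image g \<subseteq> Sub z \<eta>" and tail: "\<forall>y\<ge>C. \<i> * of_real y \<in> Sub z \<eta> \<and> - (\<i> * of_real y) \<in> Sub z \<eta>"
    using assms unfolding connects_imaginary_infinities_def by blast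
  let ?P = "(\<lambda>y. \<i> * complex_of_real y) ` {C..}" and ?M = "(\<lambda>y. - (\<i> * complex_of_real y)) ` {C..}"
  have cP: "connected ?P" "connected ?M"
    by (intro connected_continuous_image continuous_intros; simp)+
  have gi: "pathstart g \<in> path_image g" "pathfinish g \<in> path_image g" by auto
  have "connected (path_image g \<union> ?P)"
  proof (rule connected_Un[OF connected_path_image[OF g(1)] cP(1)])
    have "pathfinish g \<in> ?P" unfolding g(3) by auto
    then show "path_image g \<inter> ?P \<noteq> {}" using gi by blast
  qed
  then have "connected (path_image g \<union> ?P \<union> ?M)"
  proof (rule connected_Un[OF _ cP(2)])
    have "pathstart g \<in> ?M" unfolding g(2) by auto
    then show "(path_image g \<union> ?P) \<inter> ?M \<noteq> {}" using gi by blast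
  qed
  moreover have "\<exists>u\<in>path_image g \<union> ?P \<union> ?M. Im u \<ge> Y" for Y
    by (rule bexI[of _ "\<i> * of_real (max C Y)"]) auto
  moreover have "\<exists>u\<in>path_image g \<union> ?P \<union> ?M. Im u \<le> - Y" for Y
    by (rule bexI[of _ "- (\<i> * of_real (max C Y))"]) (auto simp: image_iff intro!: bexI[of _ "max C Y"])
  ultimately show ?thesis using that[of "path_image g \<union> ?P \<union> ?M"] g(4) tail by auto
qed

text \<open>The coordinatewise clamp to the rectangle retracts a connecting set onto the required one.\<close>

lemma conn_imp_boxconn:
  assumes "conn z \<eta>" and X: "X > 0" "\<And>u. \<bar>Im u\<bar> \<le> Y \<Longrightarrow> \<bar>Re u\<bar> \<ge> X \<Longrightarrow> cmod (\<Phi> z u) > \<eta>" and Y: "Y > 0"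
  shows "boxconn z \<eta> X Y"
proof -
  obtain E where E: "connected E" "E \<subseteq> Sub z \<eta>" "\<And>Y. \<exists>u\<in>E. Im u \<ge> Y" "\<And>Y. \<exists>u\<in>E. Im u \<le> - Y"
    using conn_connected[OF assms(1)] by blast
  define r where "r u = Complex (max (-X) (min X (Re u))) (max (-Y) (min Y (Im u)))" for u
  have "continuous_on E r" unfolding r_def Complex_eq by (intro continuous_intros)
  then have "connected (r ` E)" using E(1) by (rule connected_continuous_image)
  moreover have "r ` E \<subseteq> (Sub z \<eta> \<inter> rectangle X Y) \<union> edge X Y 1 \<union> edge X Y (-1)"
  proof
    fix w assume "w \<in> r ` E"
    then obtain u where u: "u \<in> E" "w = r u" by auto
    show "w \<in> (Sub z \<eta> \<inter> rectangle X Y) \<union> edge X Y 1 \<union> edge X Y (-1)"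
    proof (cases "\<bar>Im u\<bar> \<le> Y")
      case True
      then have "\<bar>Re u\<bar> \<le> X" using X(2)[of u] u E(2) by fastforce
      then have "r u = u" using True by (auto simp: r_def complex_eq_iff)
      then show ?thesis using u E(2) True \<open>\<bar>Re u\<bar> \<le> X\<close> by (auto simp: rectangle_def)
    next
      case False
      then show ?thesis using X(1) Y u by (auto simp: edge_def r_def)
    qed
  qed
  moreover have "r ` E \<inter> edge X Y 1 \<noteq> {}"
  proof -
    obtain u where "u \<in> E" "Im u \<ge> Y" using E(3) by blast
    then have "r u \<in> r ` E \<inter> edge X Y 1" using X(1) Y by (auto simp: edge_def r_def)
    then show ?thesis by blast
  qed
  moreover have "r ` E \<inter> edge X Y (-1) \<noteq> {}"
  proof -
    obtain u where "u \<in> E" "Im u \<le> - Y" using E(4) by blast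
    then have "r u \<in> r ` E \<inter> edge X Y (-1)" using X(1) Y by (auto simp: edge_def r_def)
    then show ?thesis by blast
  qed
  ultimately show ?thesis unfolding boxconn_def by blast
qed

lemma edge_disjoint: "Y > 0 \<Longrightarrow> edge X Y 1 \<inter> edge X Y (-1) = {}"
  by (auto simp: edge_def)

lemma endcomp_component:
  assumes "\<eta> > 0" "\<sigma> \<in> {1, -1}"
  obtains b where "endcomp z \<eta> \<sigma> = connected_component_set (\<Omega> z \<eta>) b"
proof -
  obtain C where C: "C > 0" "\<And>y. \<bar>y\<bar> \<ge> C \<Longrightarrow> cmod (\<Phi> z (\<i> * of_real y)) \<le> \<eta> / 2"
    using axis_tail[OF assms(1)] by blast
  then have "cmod (\<Phi> z (\<i> * of_real y)) < \<eta>" if "\<bar>y\<bar> \<ge> C" for y using C(2)[OF that] assms by simp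
  from endcomp_eq[OF assms(2) C(1) this] show ?thesis using that by blast
qed

text \<open>Were the end components at \<open>\<eta>'\<close> disjoint, the closure of the upper one
  would cut \<open>E\<close> by \<open>connected_component_separation\<close>. So they meet, and
  \<open>endcomp_joined\<close> applies. The loss from \<open>\<eta>\<close> to
  \<open>\<eta>'\<close> may be arbitrarily small.\<close>

lemma boxconn_imp_conn:
  assumes B: "boxconn z \<eta> X Y" and V: "decays_vertically z Y" and \<eta>: "\<eta> < \<eta>'" "0 < \<eta>'"
  obtains \<eta>'' where "0 < \<eta>''" "\<eta>'' < \<eta>'" "conn z \<eta>''"
proof (rule ccontr)
  assume neg: "\<not> thesis"
  have dis: "endcomp z \<eta>' 1 \<inter> endcomp z \<eta>' (-1) = {}"
    using endcomp_joined[OF \<eta>(2), of z] that neg by blast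
  have Y: "Y > 0" using V by (simp add: decays_vertically_def)
  obtain E where E: "connected E" "E \<subseteq> (Sub z \<eta> \<inter> rectangle X Y) \<union> edge X Y 1 \<union> edge X Y (-1)"
      "E \<inter> edge X Y 1 \<noteq> {}" "E \<inter> edge X Y (-1) \<noteq> {}"
    using B unfolding boxconn_def by blast
  obtain b where b: "endcomp z \<eta>' 1 = connected_component_set (\<Omega> z \<eta>') b"
    using endcomp_component[OF \<eta>(2), of 1] by auto
  have op: "open (endcomp z \<eta>' \<sigma>)" if "\<sigma> \<in> {1, -1}" for \<sigma>
    using endcomp_component[OF \<eta>(2) that] open_connected_component[OF open_sub] by metis
  show False
  proof (rule connected_component_separation[OF open_sub compact_Sub_box compact_edge compact_edge edge_disjoint[OF Y] E b])
    show "Sub z \<eta> \<inter> rectangle X Y \<inter> edge X Y 1 \<subseteq> closure (endcomp z \<eta>' 1)"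
    proof
      fix u assume u: "u \<in> Sub z \<eta> \<inter> rectangle X Y \<inter> edge X Y 1"
      then have "u \<in> endcomp z \<eta>' 1" by (intro ray_endcomp[OF V]) (use \<eta> in \<open>auto simp: edge_def\<close>)
      then show "u \<in> closure (endcomp z \<eta>' 1)" using closure_subset by blast
    qed
  next
    fix p assume p: "p \<in> Sub z \<eta> \<inter> rectangle X Y \<inter> closure (endcomp z \<eta>' 1)"
    have "p \<notin> edge X Y (-1)"
    proof
      assume "p \<in> edge X Y (-1)"
      then have "p \<in> endcomp z \<eta>' (-1)" by (intro ray_endcomp[OF V]) (use p \<eta> in \<open>auto simp: edge_def\<close>)
      moreover have "endcomp z \<eta>' (-1) \<inter> closure (endcomp z \<eta>' 1) = {}"
        using dis open_Int_closure_eq_empty[OF op[of "-1"]] by (simp add: Int_commute)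
      ultimately show False using p by blast
    qed
    moreover have "\<exists>N. open N \<and> p \<in> N \<and> connected (N \<inter> \<Omega> z \<eta>') \<and> N \<inter> (Sub z \<eta> \<inter> rectangle X Y) \<subseteq> closure (N \<inter> \<Omega> z \<eta>')"
      by (rule open_component_local[OF open_sub]) (use p \<eta> in auto)
    ultimately show "p \<notin> edge X Y (-1) \<and> (\<exists>N. open N \<and> p \<in> N \<and> connected (N \<inter> \<Omega> z \<eta>') \<and> N \<inter> (Sub z \<eta> \<inter> rectangle X Y) \<subseteq> closure (N \<inter> \<Omega> z \<eta>'))" by blast
  qed
qed

text \<open>The imaginary axis is itself a path. Decay beyond a height \<open>C\<close> and
  compactness below it bound \<Phi> there uniformly in \<open>z\<close>.\<close>

lemma conn_exists:
  obtains K where "K > 0" "\<And>z. cmod z \<le> Z \<Longrightarrow> conn z K"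
proof -
  obtain C where C: "C > 0" "\<And>z u. cmod z \<le> Z \<Longrightarrow> \<bar>Re u\<bar> \<le> 0 \<Longrightarrow> \<bar>Im u\<bar> \<ge> C \<Longrightarrow> cmod (\<Phi> z u) \<le> 1 * exp (- \<bar>Im u\<bar>)"
    using phi_decay[of 1 Z 0] by (metis zero_less_one)
  have "compact ((\<lambda>(z, u). \<Phi> z u) ` (cball 0 Z \<times> rectangle 0 C))"
    by (intro compact_continuous_image compact_Times compact_rectangle continuous_on_subset[OF phi_continuous]) auto
  then have "bounded ((\<lambda>(z, u). \<Phi> z u) ` (cball 0 Z \<times> rectangle 0 C))" by (rule compact_imp_bounded)
  then obtain M where M: "M > 0" "\<And>z u. cmod z \<le> Z \<Longrightarrow> u \<in> rectangle 0 C \<Longrightarrow> cmod (\<Phi> z u) \<le> M"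
    by (force simp: bounded_pos)
  show ?thesis
  proof (rule that[of "max M 1"])
    fix z assume z: "cmod z \<le> Z"
    have S: "cmod (\<Phi> z (Complex 0 y)) \<le> max M 1" for y
    proof (cases "\<bar>y\<bar> \<le> C")
      case True
      then show ?thesis using M(2)[OF z, of "Complex 0 y"] by (simp add: rectangle_def)
    next
      case False
      then have "cmod (\<Phi> z (Complex 0 y)) \<le> exp (- \<bar>y\<bar>)" using C(2)[OF z, of "Complex 0 y"] by simp
      also have "\<dots> \<le> 1" by simp
      finally show ?thesis by simp
    qed
    show "conn z (max M 1)"
      unfolding connects_imaginary_infinities_def
    proof (intro exI[of _ C] exI[of _ "linepath (- (\<i> * of_real C)) (\<i> * of_real C)"] conjI allI impI C(1))
      show "path_image (linepath (- (\<i> * complex_of_real C)) (\<i> * complex_of_real C)) \<subseteq> Sub z (max M 1)"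
      proof
        fix u assume "u \<in> path_image (linepath (- (\<i> * complex_of_real C)) (\<i> * complex_of_real C))"
        then have "u \<in> closed_segment (Complex 0 (-C)) (Complex 0 C)" by (simp add: Complex_eq)
        then show "u \<in> Sub z (max M 1)" using closed_segment_Complex(1) S by blast
      qed
      fix y :: real
      show "\<i> * of_real y \<in> Sub z (max M 1)" "- (\<i> * of_real y) \<in> Sub z (max M 1)"
        using S[of y] S[of "-y"] by (auto simp: Complex_eq)
    qed auto
  qed (use M in auto)
qed

lemma phi_eq_0_iff: "\<Phi> z u = 0 \<longleftrightarrow> u \<in> lam ` {1..d}"
proof -
  have "\<Phi> z u = 0 \<longleftrightarrow> (\<exists>j\<in>{1..d}. u = lam j \<and> a j > 0)"
    unfolding phi_def poly_base_poly by auto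
  then show ?thesis using a by force
qed

text \<open>Some horizontal line avoids the finitely many zeros. Every connecting set crosses it,
  and on it |\<Phi>| is bounded away from 0 by \<open>phi_sides\<close> and compactness.\<close>

lemma conn_lower:
  obtains m where "m > 0" "\<And>\<eta>. conn z \<eta> \<Longrightarrow> m \<le> \<eta>"
proof -
  have "\<exists>c. c \<notin> Im ` lam ` {1..d}"
    by (rule ex_new_if_finite[OF infinite_UNIV_char_0]) auto
  then obtain c where "c \<notin> Im ` lam ` {1..d}" by blast
  then have c: "\<And>u. Im u = c \<Longrightarrow> \<Phi> z u \<noteq> 0" unfolding phi_eq_0_iff by blast
  obtain X where X: "X > 0" "\<And>z' u. cmod z' \<le> cmod z \<Longrightarrow> \<bar>Im u\<bar> \<le> \<bar>c\<bar> \<Longrightarrow> \<bar>Re u\<bar> \<ge> X \<Longrightarrow> cmod (\<Phi> z' u) > 1"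
    using phi_sides[of "cmod z" "\<bar>c\<bar>" 1] by blast
  have "Complex 0 c \<in> edge X c 1" using X by (auto simp: edge_def)
  then obtain w where w: "w \<in> edge X c 1" "\<And>v. v \<in> edge X c 1 \<Longrightarrow> cmod (\<Phi> z w) \<le> cmod (\<Phi> z v)"
    using continuous_attains_inf[OF compact_edge, of X c 1 "\<lambda>v. cmod (\<Phi> z v)"]
    by (auto intro: continuous_intros phi_continuous_on)
  show ?thesis
  proof (rule that[of "min 1 (cmod (\<Phi> z w))"])
    show "min 1 (cmod (\<Phi> z w)) > 0" using c[of w] w(1) by (auto simp: edge_def)
    fix \<eta> assume "conn z \<eta>"
    then obtain E where E: "connected E" "E \<subseteq> Sub z \<eta>" "\<And>Y. \<exists>u\<in>E. Im u \<ge> Y" "\<And>Y. \<exists>u\<in>E. Im u \<le> - Y"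
      using conn_connected by blast
    obtain x y where "x \<in> E" "y \<in> E" "Im x \<le> c" "c \<le> Im y" using E(3)[of c] E(4)[of "-c"] by auto
    then obtain u where u: "u \<in> E" "Im u = c"
      using connected_ivt_component[OF E(1), of x y \<i> c] by auto
    have "min 1 (cmod (\<Phi> z w)) \<le> cmod (\<Phi> z u)"
    proof (cases "\<bar>Re u\<bar> \<ge> X")
      case True
      then show ?thesis using X(2)[of z u] u by simp
    next
      case False
      then show ?thesis using w(2)[of u] u by (simp add: edge_def)
    qed
    then show "min 1 (cmod (\<Phi> z w)) \<le> \<eta>" using u E(2) by fastforce
  qed
qed

lemma pass_level_pos: "pass_level z > 0"
  and pass_level_lower: "\<And>\<eta>. 0 < \<eta> \<Longrightarrow> conn z \<eta> \<Longrightarrow> pass_level z \<le> \<eta>"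
  and pass_level_conn: "\<And>\<eta>. pass_level z < \<eta> \<Longrightarrow> conn z \<eta>"
proof -
  let ?A = "{\<eta>. \<eta> > 0 \<and> conn z \<eta>}"
  obtain m where m: "m > 0" "\<And>\<eta>. conn z \<eta> \<Longrightarrow> m \<le> \<eta>" using conn_lower by blast
  obtain K where K: "K > 0" "conn z K" using conn_exists[of "cmod z"] by (metis order_refl)
  have bdd: "bdd_below ?A" by (rule bdd_belowI[of _ m]) (use m in auto)
  have "m \<le> pass_level z" unfolding pass_level_def using K m by (intro cInf_greatest) auto
  then show "pass_level z > 0" using m by simp
  show "pass_level z \<le> \<eta>" if "0 < \<eta>" "conn z \<eta>" for \<eta>
    unfolding pass_level_def using that bdd by (intro cInf_lower) auto
  show "conn z \<eta>" if "pass_level z < \<eta>" for \<eta>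
  proof -
    have ne: "?A \<noteq> {}" using K by auto
    have "Inf ?A < \<eta>" using that by (simp only: pass_level_def)
    from cInf_lessD[OF ne this] obtain x where "x \<in> ?A" "x < \<eta>" by (elim bexE)
    then show ?thesis using conn_mono[of z x \<eta>] by auto
  qed
qed

lemma pass_level_not_conn: "\<eta> < pass_level z \<Longrightarrow> \<not> conn z \<eta>"
proof
  assume *: "\<eta> < pass_level z" "conn z \<eta>"
  have "conn z ((max \<eta> 0 + pass_level z) / 2)" by (rule conn_mono[OF *(2)]) (use * pass_level_pos[of z] in \<open>auto simp: field_simps max_def\<close>)
  then have "pass_level z \<le> (max \<eta> 0 + pass_level z) / 2" by (rule pass_level_lower[rotated]) (use pass_level_pos[of z] in auto)
  then show False using * pass_level_pos[of z] by (auto simp: field_simps max_def split: if_splits)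
qed

lemma decays_vertically_exists: obtains Y where "Y > 0" "\<And>z. cmod z \<le> Z \<Longrightarrow> decays_vertically z Y"
proof -
  obtain Y where "Y > 0" "\<And>z u s \<sigma>. cmod z \<le> Z \<Longrightarrow> \<sigma> \<in> {1, -1} \<Longrightarrow> \<sigma> * Im u \<ge> Y \<Longrightarrow> s > 0 \<Longrightarrow>
     cmod (\<Phi> z (u + \<i> * of_real (\<sigma> * s))) < cmod (\<Phi> z u)"
    using phi_vertical[of Z] by blast
  then show ?thesis using that unfolding decays_vertically_def by blast
qed

text \<open>The levels decrease to the infimum, and connected compacta pass to the limit by
  intersection where paths would not. Keeping them at most \<open>pass_level z + 1\<close> makes one
  rectangle valid for all.\<close>

lemma critical_boxconn:
  assumes V: "decays_vertically z Y" and X: "X > 0" "\<And>u. \<bar>Im u\<bar> \<le> Y \<Longrightarrow> \<bar>Re u\<bar> \<ge> X \<Longrightarrow> cmod (\<Phi> z u) > pass_level z + 1"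
  shows "boxconn z (pass_level z) X Y"
proof -
  have Y: "Y > 0" using V by (simp add: decays_vertically_def)
  define \<eta> where "\<eta> n = pass_level z + 1 / (real n + 1)" for n :: nat
  have \<eta>1: "pass_level z < \<eta> n" "\<eta> n \<le> pass_level z + 1" for n by (auto simp: \<eta>_def field_simps)
  have \<eta>mono: "\<eta> n \<le> \<eta> m" if "m \<le> n" for m n using that by (auto simp: \<eta>_def frac_le)
  have bc: "boxconn z (\<eta> n) X Y" for n
  proof (rule conn_imp_boxconn[OF pass_level_conn[OF \<eta>1(1)] X(1) _ Y])
    fix u assume "\<bar>Im u\<bar> \<le> Y" "X \<le> \<bar>Re u\<bar>"
    then show "\<eta> n < cmod (\<Phi> z u)" using X(2)[of u] \<eta>1(2)[of n] by linarith
  qed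
  define S where "S n = (Sub z (\<eta> n) \<inter> rectangle X Y) \<union> edge X Y 1 \<union> edge X Y (-1)" for n
  define p where "p = Complex 0 Y"
  define q where "q = Complex 0 (-Y)"
  have pq: "p \<in> edge X Y 1" "q \<in> edge X Y (-1)" using X(1) by (auto simp: edge_def p_def q_def)
  \<comment> \<open>Components of one fixed point are automatically nested, as the intersection
    requires; arbitrary connecting sets need not be. The full edges ensure that the component of
    \<open>p\<close> reaches \<open>q\<close>.\<close>
  define K where "K n = connected_component_set (S n) p" for n
  have Scomp: "compact (S n)" for n
    unfolding S_def by (intro compact_Un compact_Sub_box compact_edge)
  have Kcomp: "compact (K n)" for n
    unfolding K_def using Scomp by (metis closed_connected_component closed_Int_compact compact_imp_closed connected_component_subset inf.absorb1)
  have qK: "q \<in> K n" for n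
  proof -
    obtain E where E: "connected E" "E \<subseteq> S n" "E \<inter> edge X Y 1 \<noteq> {}" "E \<inter> edge X Y (-1) \<noteq> {}"
      using bc[of n] unfolding boxconn_def S_def by blast
    have "connected (E \<union> edge X Y 1)" using E by (intro connected_Un connected_edge) auto
    then have "connected (E \<union> edge X Y 1 \<union> edge X Y (-1))" using E by (intro connected_Un connected_edge) auto
    moreover have "E \<union> edge X Y 1 \<union> edge X Y (-1) \<subseteq> S n" using E by (auto simp: S_def)
    ultimately have "connected_component (S n) p q" using pq by (intro connected_componentI[of "E \<union> edge X Y 1 \<union> edge X Y (-1)"]) auto
    then show ?thesis by (simp add: K_def)
  qed
  have pK: "p \<in> K n" for n using pq by (auto simp: K_def S_def connected_component_refl_eq)
  have "connected (\<Inter> (range K))"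
  proof (rule connected_nest[OF Kcomp])
    show "connected (K n)" for n by (simp add: K_def)
    fix m n :: nat assume "m \<le> n"
    then have "S n \<subseteq> S m" using \<eta>mono by (force simp: S_def)
    then show "K n \<subseteq> K m" unfolding K_def by (rule connected_component_mono)
  qed
  moreover have "\<Inter> (range K) \<subseteq> (Sub z (pass_level z) \<inter> rectangle X Y) \<union> edge X Y 1 \<union> edge X Y (-1)"
  proof
    fix u assume u: "u \<in> \<Inter> (range K)"
    have uS: "u \<in> S n" for n using u connected_component_subset[of "S n" p] by (auto simp: K_def)
    show "u \<in> (Sub z (pass_level z) \<inter> rectangle X Y) \<union> edge X Y 1 \<union> edge X Y (-1)"
    proof (rule ccontr)
      assume neg: "\<not> ?thesis"
      then have "u \<in> rectangle X Y" "\<And>n. cmod (\<Phi> z u) \<le> \<eta> n" using uS by (auto simp: S_def)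
      moreover have "\<eta> \<longlonglongrightarrow> pass_level z + 0" unfolding \<eta>_def
        by (intro tendsto_intros) real_asymp
      ultimately have "cmod (\<Phi> z u) \<le> pass_level z" using LIMSEQ_le_const by fastforce
      then show False using neg \<open>u \<in> rectangle X Y\<close> by auto
    qed
  qed
  moreover have "\<Inter> (range K) \<inter> edge X Y 1 \<noteq> {}" "\<Inter> (range K) \<inter> edge X Y (-1) \<noteq> {}"
    using pK qK pq by blast+
  ultimately show ?thesis unfolding boxconn_def by blast
qed

text \<open>A common point would connect the ends strictly below the infimum, by the gain in
  \<open>endcomp_joined\<close>.\<close>

lemma endcomp_pass_level_disjoint: "endcomp z (pass_level z) 1 \<inter> endcomp z (pass_level z) (-1) = {}"
proof (rule ccontr)
  assume ne: "\<not> ?thesis"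
  obtain \<eta> where "\<eta> < pass_level z" "conn z \<eta>" by (rule endcomp_joined[OF pass_level_pos ne])
  then show False using pass_level_not_conn by simp
qed

text \<open>Every connecting continuum at the critical level has to leave the closure of either end
  component, and it can do so only through a critical point.\<close>

lemma critical_point_endcomp:
  assumes \<sigma>: "\<sigma> \<in> {1, -1}"
  obtains p where "cmod (\<Phi> z p) = pass_level z" "deriv (\<Phi> z) p = 0" "p \<in> closure (endcomp z (pass_level z) \<sigma>)"
proof (rule ccontr)
  assume neg: "\<not> thesis"
  obtain Y where Y0: "Y > 0" "\<And>z'. cmod z' \<le> cmod z \<Longrightarrow> decays_vertically z' Y" using decays_vertically_exists[of "cmod z"] by blast
  have Y: "Y > 0" "decays_vertically z Y" using Y0 by simp_all
  obtain X where X: "X > 0" "\<And>u. \<bar>Im u\<bar> \<le> Y \<Longrightarrow> \<bar>Re u\<bar> \<ge> X \<Longrightarrow> cmod (\<Phi> z u) > pass_level z + 1"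
  proof (rule phi_sides[of "cmod z" Y "pass_level z + 1"])
    fix X assume "0 < X" "\<And>z' u. cmod z' \<le> cmod z \<Longrightarrow> \<bar>Im u\<bar> \<le> Y \<Longrightarrow> X \<le> \<bar>Re u\<bar> \<Longrightarrow> pass_level z + 1 < cmod (\<Phi> z' u)"
    then show thesis by (intro that[of X]) simp_all
  qed
  obtain E where E: "connected E" "E \<subseteq> (Sub z (pass_level z) \<inter> rectangle X Y) \<union> edge X Y 1 \<union> edge X Y (-1)"
      "E \<inter> edge X Y 1 \<noteq> {}" "E \<inter> edge X Y (-1) \<noteq> {}"
    using critical_boxconn[OF Y(2) X] unfolding boxconn_def by blast
  have E': "E \<subseteq> (Sub z (pass_level z) \<inter> rectangle X Y) \<union> edge X Y \<sigma> \<union> edge X Y (-\<sigma>)"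
      "E \<inter> edge X Y \<sigma> \<noteq> {}" "E \<inter> edge X Y (-\<sigma>) \<noteq> {}" "edge X Y \<sigma> \<inter> edge X Y (-\<sigma>) = {}"
    using \<sigma> E Y by (auto simp: edge_def)
  let ?B = "endcomp z (pass_level z)"
  have dis: "?B \<sigma> \<inter> ?B (-\<sigma>) = {}" using endcomp_pass_level_disjoint[of z] \<sigma> by auto
  have m\<sigma>: "-\<sigma> \<in> {1, -1}" using \<sigma> by auto
  obtain b where b: "?B \<sigma> = connected_component_set (\<Omega> z (pass_level z)) b"
    using endcomp_component[OF pass_level_pos \<sigma>] by blast
  have touch: "C \<inter> ?B \<tau> \<noteq> {}" if "p \<in> N" "open N" "p \<in> closure (?B \<tau>)" "C = N \<inter> \<Omega> z (pass_level z)" for C p N \<tau>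
  proof -
    have "N \<inter> ?B \<tau> \<noteq> {}" using that by (metis IntI empty_iff open_Int_closure_eq_empty)
    moreover have "?B \<tau> \<subseteq> \<Omega> z (pass_level z)"
      unfolding endcomp_def using connected_component_in by fast
    ultimately show ?thesis using that(4) by blast
  qed
  show False
  proof (rule connected_component_separation[OF open_sub compact_Sub_box compact_edge compact_edge E'(4) E(1) E'(1-3) b])
    show "Sub z (pass_level z) \<inter> rectangle X Y \<inter> edge X Y \<sigma> \<subseteq> closure (?B \<sigma>)"
    proof
      fix u assume u: "u \<in> Sub z (pass_level z) \<inter> rectangle X Y \<inter> edge X Y \<sigma>"
      then show "u \<in> closure (?B \<sigma>)" by (intro ray_closure_endcomp[OF Y(2) \<sigma>]) (use \<sigma> in \<open>auto simp: edge_def\<close>)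
    qed
  next
    fix p assume p: "p \<in> Sub z (pass_level z) \<inter> rectangle X Y \<inter> closure (?B \<sigma>)"
    have "\<exists>N. open N \<and> p \<in> N \<and> connected (N \<inter> \<Omega> z (pass_level z)) \<and> N \<inter> (Sub z (pass_level z) \<inter> rectangle X Y) \<subseteq> closure (N \<inter> \<Omega> z (pass_level z))"
    proof (cases "cmod (\<Phi> z p) < pass_level z")
      case True
      then show ?thesis by (intro open_component_local open_sub) simp
    next
      case False
      then have eq: "cmod (\<Phi> z p) = pass_level z" using p by auto
      have dz: "deriv (\<Phi> z) p \<noteq> 0" using neg that[of p] eq p by blast
      have pz: "\<Phi> z p \<noteq> 0" using eq pass_level_pos[of z] by auto
      show ?thesis
      proof (rule sublevel_locally_connected[OF phi_holomorphic dz pz])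
        fix N assume "open N" "p \<in> N" "connected (N \<inter> {u. cmod (\<Phi> z u) < cmod (\<Phi> z p)})"
          "N \<inter> {u. cmod (\<Phi> z u) \<le> cmod (\<Phi> z p)} \<subseteq> closure (N \<inter> {u. cmod (\<Phi> z u) < cmod (\<Phi> z p)})"
        then show ?thesis unfolding eq by (intro exI[of _ N]) auto
      qed
    qed
    then obtain N where N: "open N" "p \<in> N" "connected (N \<inter> \<Omega> z (pass_level z))" "N \<inter> (Sub z (pass_level z) \<inter> rectangle X Y) \<subseteq> closure (N \<inter> \<Omega> z (pass_level z))"
      by blast
    \<comment> \<open>On the opposite edge \<open>p\<close> would be in the closure of both end
      components; the connected set \<open>N \<inter> \<Omega> z (pass_level z)\<close> would then
      meet both and join them.\<close>
    have "p \<notin> edge X Y (-\<sigma>)"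
    proof
      assume "p \<in> edge X Y (-\<sigma>)"
      then have "p \<in> closure (?B (-\<sigma>))" by (intro ray_closure_endcomp[OF Y(2) m\<sigma>]) (use \<sigma> p in \<open>auto simp: edge_def\<close>)
      then obtain q' where q': "q' \<in> N \<inter> \<Omega> z (pass_level z)" "q' \<in> ?B (-\<sigma>)" using touch[OF N(2,1) _ refl] by blast
      obtain q where q: "q \<in> N \<inter> \<Omega> z (pass_level z)" "q \<in> ?B \<sigma>" using touch[OF N(2,1) _ refl] p by blast
      have "connected_component (\<Omega> z (pass_level z)) q q'"
        using N(3) q(1) q'(1) by (intro connected_componentI[of "N \<inter> \<Omega> z (pass_level z)"]) auto
      then have "q' \<in> ?B \<sigma>" using q(2) unfolding b by (auto intro: connected_component_trans)
      then show False using q' dis by blast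
    qed
    then show "p \<notin> edge X Y (-\<sigma>) \<and> (\<exists>N. open N \<and> p \<in> N \<and> connected (N \<inter> \<Omega> z (pass_level z)) \<and>
        N \<inter> (Sub z (pass_level z) \<inter> rectangle X Y) \<subseteq> closure (N \<inter> \<Omega> z (pass_level z)))" using N by blast
  qed
qed

section \<open>Continuity of the pass level in z\<close>

lemma phi_change:
  assumes z: "cmod z \<le> Z" "cmod z' \<le> Z" and u: "u \<in> rectangle X Y"
  shows "cmod (\<Phi> z' u) \<le> cmod (\<Phi> z u) * exp (al / (2 * t) * (2 * X + 2 * Y + 4 * Z) * cmod (z' - z))"
proof -
  define P where "P = (\<Prod>j=1..d. cmod (u - lam j) ^ a j)"
  define \<beta> where "\<beta> = al / (2 * t)"
  have \<beta>: "\<beta> > 0" using al_pos t by (simp add: \<beta>_def)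
  have P: "P \<ge> 0" unfolding P_def by (intro prod_nonneg) auto
  have r: "\<bar>Re z\<bar> \<le> Z" "\<bar>Re z'\<bar> \<le> Z" "\<bar>Im z\<bar> \<le> Z" "\<bar>Im z'\<bar> \<le> Z" "\<bar>Re u\<bar> \<le> X" "\<bar>Im u\<bar> \<le> Y"
    using z u abs_Re_le_cmod[of z] abs_Re_le_cmod[of z'] abs_Im_le_cmod[of z] abs_Im_le_cmod[of z'] by (auto simp: rectangle_def)
  \<comment> \<open>Only the exponent depends on \<open>z\<close>. Its change is linear in the
    displacement with coefficients bounded on the rectangle, so \<Phi> changes at most by a factor,
    which makes sense at its zeros as well.\<close>
  have "((Re u - Re z')\<^sup>2 - (Im u - Im z')\<^sup>2) - ((Re u - Re z)\<^sup>2 - (Im u - Im z)\<^sup>2) =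
     - (Re (z' - z) * (2 * Re u - Re z - Re z')) + Im (z' - z) * (2 * Im u - Im z - Im z')"
    by (simp add: power2_eq_square algebra_simps)
  also have "\<dots> \<le> \<bar>Re (z' - z) * (2 * Re u - Re z - Re z')\<bar> + \<bar>Im (z' - z) * (2 * Im u - Im z - Im z')\<bar>" by linarith
  also have "\<dots> \<le> cmod (z' - z) * (2 * X + 2 * Z) + cmod (z' - z) * (2 * Y + 2 * Z)"
    unfolding abs_mult using r by (intro add_mono mult_mono abs_Re_le_cmod abs_Im_le_cmod) auto
  finally have "\<beta> * (((Re u - Re z')\<^sup>2 - (Im u - Im z')\<^sup>2) - ((Re u - Re z)\<^sup>2 - (Im u - Im z)\<^sup>2)) \<le> \<beta> * ((2 * X + 2 * Y + 4 * Z) * cmod (z' - z))"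
    using \<beta> by (intro mult_left_mono) (auto simp: algebra_simps)
  then have "\<beta> * ((Re u - Re z')\<^sup>2 - (Im u - Im z')\<^sup>2) \<le> \<beta> * ((Re u - Re z)\<^sup>2 - (Im u - Im z)\<^sup>2) + \<beta> * (2 * X + 2 * Y + 4 * Z) * cmod (z' - z)"
    by (simp add: algebra_simps)
  then have "P * exp (\<beta> * ((Re u - Re z')\<^sup>2 - (Im u - Im z')\<^sup>2)) \<le> P * exp (\<beta> * ((Re u - Re z)\<^sup>2 - (Im u - Im z)\<^sup>2) + \<beta> * (2 * X + 2 * Y + 4 * Z) * cmod (z' - z))"
    using P by (intro mult_left_mono) auto
  then show ?thesis unfolding cmod_phi P_def[symmetric] \<beta>_def[symmetric] by (simp add: exp_add mult_ac)
qed

text \<open>A continuum at level \<open>\<eta>\<close> for \<open>z\<close> is one at level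
  \<open>\<eta> * e\<close> for \<open>z'\<close> in the same rectangle. The return from
  \<open>boxconn\<close> to \<open>conn\<close> costs an arbitrarily small amount, which
  \<open>dense_ge\<close> removes.\<close>

lemma pass_level_lipschitz:
  obtains K where "\<And>z z'. cmod z \<le> Z \<Longrightarrow> cmod z' \<le> Z \<Longrightarrow> pass_level z' \<le> pass_level z * exp (K * cmod (z' - z))"
proof -
  obtain \<eta>0 where \<eta>0: "\<eta>0 > 0" "\<And>z. cmod z \<le> Z \<Longrightarrow> conn z \<eta>0" using conn_exists by blast
  obtain Y where Y: "Y > 0" "\<And>z. cmod z \<le> Z \<Longrightarrow> decays_vertically z Y" using decays_vertically_exists by blast
  obtain X where X: "X > 0" "\<And>z u. cmod z \<le> Z \<Longrightarrow> \<bar>Im u\<bar> \<le> Y \<Longrightarrow> \<bar>Re u\<bar> \<ge> X \<Longrightarrow> cmod (\<Phi> z u) > \<eta>0 + 1"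
    using phi_sides[of Z Y "\<eta>0 + 1"] by blast
  define K where "K = al / (2 * t) * (2 * X + 2 * Y + 4 * Z)"
  show ?thesis
  proof (rule that[of K])
    fix z z' assume z: "cmod z \<le> Z" "cmod z' \<le> Z"
    define e where "e = exp (K * cmod (z' - z))"
    have e: "e > 0" by (simp add: e_def)
    have le: "pass_level z \<le> \<eta>0" using pass_level_lower \<eta>0 z by blast
    \<comment> \<open>The cap \<open>\<eta>0 + 1\<close> is the level for which the sides of the
      rectangle were chosen.\<close>
    have 1: "pass_level z' \<le> \<eta> * e" if \<eta>: "pass_level z < \<eta>" "\<eta> < \<eta>0 + 1" for \<eta>
    proof -
      have \<eta>p: "\<eta> > 0" using \<eta> pass_level_pos[of z] by simp
      have "boxconn z \<eta> X Y"
        by (rule conn_imp_boxconn[OF pass_level_conn[OF \<eta>(1)] X(1) _ Y(1)]) (use X(2)[OF z(1)] \<eta> in fastforce)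
      moreover have "Sub z \<eta> \<inter> rectangle X Y \<subseteq> Sub z' (\<eta> * e) \<inter> rectangle X Y"
      proof
        fix u assume u: "u \<in> Sub z \<eta> \<inter> rectangle X Y"
        then have "cmod (\<Phi> z' u) \<le> cmod (\<Phi> z u) * e" using phi_change[OF z, of u X Y] by (simp add: e_def K_def)
        also have "\<dots> \<le> \<eta> * e" using u e by (intro mult_right_mono) auto
        finally show "u \<in> Sub z' (\<eta> * e) \<inter> rectangle X Y" using u by simp
      qed
      ultimately have bc: "boxconn z' (\<eta> * e) X Y" unfolding boxconn_def by blast
      show ?thesis
      proof (rule dense_ge)
        fix x assume x: "\<eta> * e < x"
        then have "0 < x" using \<eta>p e by (meson mult_pos_pos order.strict_trans)
        from boxconn_imp_conn[OF bc Y(2)[OF z(2)] x this] show "pass_level z' \<le> x"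
          using pass_level_lower by (metis less_imp_le order.trans)
      qed
    qed
    have "pass_level z' / e \<le> pass_level z"
      by (rule dense_ge_bounded[of _ "\<eta>0 + 1"]) (use 1 e le in \<open>auto simp: field_simps\<close>)
    then show "pass_level z' \<le> pass_level z * exp (K * cmod (z' - z))" using e by (simp add: e_def field_simps)
  qed
qed

lemma continuous_on_pass_level: "continuous_on S pass_level"
proof (rule continuous_at_imp_continuous_on, rule ballI)
  fix z0
  obtain K where K: "\<And>z z'. cmod z \<le> cmod z0 + 1 \<Longrightarrow> cmod z' \<le> cmod z0 + 1 \<Longrightarrow> pass_level z' \<le> pass_level z * exp (K * cmod (z' - z))"
    using pass_level_lipschitz by blast
  have ev: "eventually (\<lambda>z. cmod z \<le> cmod z0 + 1) (at z0)"
    unfolding eventually_at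
  proof (intro exI[of _ 1] conjI ballI impI)
    fix z assume "z \<noteq> z0 \<and> dist z z0 < 1"
    then show "cmod z \<le> cmod z0 + 1" using norm_triangle_ineq2[of z z0] by (simp add: dist_norm)
  qed auto
  show "isCont pass_level z0" unfolding isCont_def
  proof (rule tendsto_sandwich)
    show "\<forall>\<^sub>F z in at z0. pass_level z0 * exp (- (K * cmod (z0 - z))) \<le> pass_level z"
      using ev
    proof eventually_elim
      case (elim z)
      then show ?case using K[of z z0] by (simp add: exp_minus field_simps)
    qed
    show "\<forall>\<^sub>F z in at z0. pass_level z \<le> pass_level z0 * exp (K * cmod (z - z0))"
      using ev by eventually_elim (use K[of z0] in simp)
    have "((\<lambda>z. pass_level z0 * exp (- (K * cmod (z0 - z)))) \<longlongrightarrow> pass_level z0 * exp (- (K * cmod (z0 - z0)))) (at z0)"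
      by (intro tendsto_intros)
    then show "((\<lambda>z. pass_level z0 * exp (- (K * cmod (z0 - z)))) \<longlongrightarrow> pass_level z0) (at z0)" by simp
    have "((\<lambda>z. pass_level z0 * exp (K * cmod (z - z0))) \<longlongrightarrow> pass_level z0 * exp (K * cmod (z0 - z0))) (at z0)"
      by (intro tendsto_intros)
    then show "((\<lambda>z. pass_level z0 * exp (K * cmod (z - z0))) \<longlongrightarrow> pass_level z0) (at z0)" by simp
  qed
qed

end

section \<open>Laplace's method at the saddle\<close>

text \<open>The logarithm of f/f(p) vanishes to exactly second order at \<open>p\<close>, so near
  \<open>p\<close> it is the square of a locally invertible function \<open>Q\<close>. The
  coordinate \<open>w\<close> is the value of \<open>Q\<close>, and \<open>g\<close> is the inverse
  of \<open>Q\<close>.\<close>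

lemma morse_lemma_holomorphic:
  assumes f: "f holomorphic_on UNIV" and fp: "f p \<noteq> 0" and d1: "deriv f p = 0" and d2: "deriv (deriv f) p \<noteq> 0"
  obtains e g where "e > 0" "g holomorphic_on ball 0 e" "g 0 = p" "open (g ` ball 0 e)" "deriv g 0 \<noteq> 0"
    "\<And>w. w \<in> ball 0 e \<Longrightarrow> f (g w) = f p * exp (w\<^sup>2)"
proof -
  have "isCont f p" using holomorphic_on_imp_continuous_on[OF f] by (simp add: continuous_on_eq_continuous_at)
  then have "((\<lambda>u. f u / f p) \<longlongrightarrow> f p / f p) (at p)" by (intro tendsto_intros fp) (simp add: isCont_def)
  then have "((\<lambda>u. f u / f p) \<longlongrightarrow> 1) (at p)" using fp by simp
  then obtain r0 where r0: "r0 > 0" "\<And>u. u \<noteq> p \<Longrightarrow> dist u p < r0 \<Longrightarrow> dist (f u / f p) 1 < 1"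
    unfolding tendsto_iff eventually_at by (metis UNIV_I zero_less_one)
  have ne: "f u / f p \<notin> \<real>\<^sub>\<le>\<^sub>0" "f u \<noteq> 0" if "u \<in> ball p r0" for u
  proof -
    have "dist (f u / f p) 1 < 1" using that r0 fp by (cases "u = p") (auto simp: dist_commute)
    then have "Re (f u / f p) > 0" using abs_Re_le_cmod[of "f u / f p - 1"] by (simp add: dist_norm)
    then show "f u / f p \<notin> \<real>\<^sub>\<le>\<^sub>0" "f u \<noteq> 0" by (auto simp: complex_nonpos_Reals_iff)
  qed
  define h where "h u = Ln (f u / f p)" for u
  have fd: "(f has_field_derivative deriv f u) (at u)" for u
    using f holomorphic_derivI[OF f, of u] by simp
  have df: "deriv f holomorphic_on UNIV" using f by (intro holomorphic_deriv) auto
  have dfd: "(deriv f has_field_derivative deriv (deriv f) u) (at u)" for u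
    using holomorphic_derivI[OF df, of u] by simp
  have hd: "(h has_field_derivative deriv f u / f u) (at u)" if "u \<in> ball p r0" for u
    unfolding h_def using ne[OF that] fp
    by (auto intro!: derivative_eq_intros fd simp: field_simps)
  have hh: "h holomorphic_on ball p r0"
    unfolding holomorphic_on_open[OF open_ball] using hd by blast
  have dh: "deriv h u = deriv f u / f u" if "u \<in> ball p r0" for u using hd[OF that] by (rule DERIV_imp_deriv)
  have pin: "p \<in> ball p r0" using r0 by simp
  have "((\<lambda>u. deriv f u / f u) has_field_derivative deriv (deriv f) p / f p) (at p)"
    by (auto intro!: derivative_eq_intros fd dfd fp simp: d1 fp)
  then have "(deriv h has_field_derivative deriv (deriv f) p / f p) (at p)"
    by (rule has_field_derivative_transform_within_open[OF _ open_ball pin]) (simp add: dh)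
  then have "deriv (deriv h) p = deriv (deriv f) p / f p" by (rule DERIV_imp_deriv)
  then have D2: "(deriv ^^ 2) h p \<noteq> 0" using d2 fp by (simp add: numeral_2_eq_2)
  have D1: "(deriv ^^ i) h p = 0" if "0 < i" "i < 2" for i
  proof -
    have "i = 1" using that by simp
    then show ?thesis using dh[OF pin] d1 by simp
  qed
  have pos2: "0 < (2::nat)" by simp
  obtain G r where G: "0 < r" "G holomorphic_on ball p r"
      "\<And>w. w \<in> ball p r \<Longrightarrow> h w - h p = ((w - p) * G w) ^ 2" "\<And>w. w \<in> ball p r \<Longrightarrow> G w \<noteq> 0"
  proof (rule holomorphic_factor_order_of_zero_strong[OF hh open_ball pin pos2 D2 D1])
    fix G r assume "0 < r" "G holomorphic_on ball p r" "\<And>w. w \<in> ball p r \<Longrightarrow> h w - h p = ((w - p) * G w) ^ 2"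
      "\<And>w. w \<in> ball p r \<Longrightarrow> G w \<noteq> 0"
    then show thesis by (rule that)
  qed
  define R where "R = min r r0"
  have R: "R > 0" "ball p R \<subseteq> ball p r" "ball p R \<subseteq> ball p r0" using G(1) r0(1) by (auto simp: R_def)
  define Q where "Q w = (w - p) * G w" for w
  have Qh: "Q holomorphic_on ball p R"
    unfolding Q_def using holomorphic_on_subset[OF G(2) R(2)] by (intro holomorphic_intros)
  have "(G has_field_derivative deriv G p) (at p)"
    using holomorphic_derivI[OF G(2) open_ball, of p] G(1) by simp
  then have "(Q has_field_derivative G p) (at p)"
    unfolding Q_def by (auto intro!: derivative_eq_intros)
  then have dQ: "deriv Q p = G p" by (rule DERIV_imp_deriv)
  have "deriv Q p \<noteq> 0" using G(1,4) dQ by auto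
  then obtain s where s: "s > 0" "ball p s \<subseteq> ball p R" "open (Q ` ball p s)" "inj_on Q (ball p s)"
    using has_complex_derivative_locally_invertible[OF Qh _ open_ball] R(1) by (metis centre_in_ball)
  obtain g where g: "g holomorphic_on (Q ` ball p s)"
      "\<And>z. z \<in> ball p s \<Longrightarrow> deriv Q z * deriv g (Q z) = 1 \<and> g (Q z) = z"
    using holomorphic_has_inverse[OF holomorphic_on_subset[OF Qh s(2)] open_ball s(4)] by metis
  have Qp: "Q p = 0" by (simp add: Q_def)
  have pins: "p \<in> ball p s" using s by simp
  have "0 \<in> Q ` ball p s" using Qp pins by (metis imageI)
  then obtain e where e: "e > 0" "ball 0 e \<subseteq> Q ` ball p s" using s(3) open_contains_ball by metis
  show ?thesis
  proof (rule that[OF e(1) holomorphic_on_subset[OF g(1) e(2)]])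
    show "g 0 = p" using g(2)[OF pins] Qp by simp
    show "deriv g 0 \<noteq> 0" using g(2)[OF pins] Qp by auto
    have eq: "g ` ball 0 e = {u \<in> ball p s. Q u \<in> ball 0 e}"
    proof (intro equalityI subsetI)
      fix u assume "u \<in> g ` ball 0 e"
      then obtain w :: complex where w: "w \<in> ball 0 e" "u = g w" by auto
      obtain v where v: "v \<in> ball p s" "w = Q v" using w(1) e(2) by auto
      show "u \<in> {u \<in> ball p s. Q u \<in> ball 0 e}" using w v g(2)[OF v(1)] by simp
    next
      fix u assume "u \<in> {u \<in> ball p s. Q u \<in> ball 0 e}"
      then show "u \<in> g ` ball 0 e" using g(2)[of u] by (intro image_eqI[of _ _ "Q u"]) auto
    qed
    have "continuous_on (ball p s) Q" using Qh s(2) holomorphic_on_imp_continuous_on holomorphic_on_subset by blast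
    then have "open (ball p s \<inter> Q -` ball 0 e)" by (intro continuous_open_preimage) auto
    moreover have "ball p s \<inter> Q -` ball 0 e = g ` ball 0 e" unfolding eq by auto
    ultimately show "open (g ` ball 0 e)" by simp
    fix w :: complex assume w: "w \<in> ball 0 e"
    then obtain v where v: "v \<in> ball p s" "w = Q v" using e(2) by auto
    have vin: "v \<in> ball p r" "v \<in> ball p r0" using v(1) s(2) R by blast+
    have "h p = 0" by (simp add: h_def fp)
    then have "h v = w\<^sup>2" using G(3)[OF vin(1)] v(2) by (simp add: Q_def)
    moreover have "exp (h v) = f v / f p" unfolding h_def using ne[OF vin(2)] fp by (intro exp_Ln) auto
    ultimately have "f v = f p * exp (w\<^sup>2)" using fp by (simp add: field_simps)
    moreover have "g w = v" using g(2)[OF v(1)] v(2) by simp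
    ultimately show "f (g w) = f p * exp (w\<^sup>2)" by simp
  qed
qed

text \<open>Polynomial factors disappear after taking logarithms and dividing by n, so bounds within
  a factor n either way suffice.\<close>

lemma ln_over_n_tendsto:
  fixes x :: "nat \<Rightarrow> real"
  assumes "\<eta> > 0" "A > 0" "B > 0"
    and ev: "eventually (\<lambda>n. A * \<eta> ^ n / real n \<le> x n \<and> x n \<le> B * \<eta> ^ n * real n) sequentially"
  shows "(\<lambda>n. ln (x n) / real n) \<longlonglongrightarrow> ln \<eta>"
proof (rule tendsto_sandwich)
  show "\<forall>\<^sub>F n in sequentially. (ln A + real n * ln \<eta> - ln (real n)) / real n \<le> ln (x n) / real n"
    using ev eventually_gt_at_top[of 0]
  proof eventually_elim
    case (elim n)
    have "A * \<eta> ^ n / real n > 0" using assms elim by simp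
    then have "ln (A * \<eta> ^ n / real n) \<le> ln (x n)" using elim by simp
    moreover have "ln (A * \<eta> ^ n / real n) = ln A + real n * ln \<eta> - ln (real n)"
      using assms elim by (simp add: ln_div ln_mult ln_realpow)
    ultimately show ?case by (simp add: divide_right_mono)
  qed
  show "\<forall>\<^sub>F n in sequentially. ln (x n) / real n \<le> (ln B + real n * ln \<eta> + ln (real n)) / real n"
    using ev eventually_gt_at_top[of 0]
  proof eventually_elim
    case (elim n)
    have "A * \<eta> ^ n / real n > 0" using assms elim by simp
    then have "ln (x n) \<le> ln (B * \<eta> ^ n * real n)" using elim by (subst ln_le_cancel_iff) auto
    moreover have "ln (B * \<eta> ^ n * real n) = ln B + real n * ln \<eta> + ln (real n)"
      using assms elim by (simp add: ln_mult ln_realpow)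
    ultimately show ?case by (simp add: divide_right_mono)
  qed
  show "(\<lambda>n. (ln A + real n * ln \<eta> - ln (real n)) / real n) \<longlonglongrightarrow> ln \<eta>"
    "(\<lambda>n. (ln B + real n * ln \<eta> + ln (real n)) / real n) \<longlonglongrightarrow> ln \<eta>"
    by real_asymp+
qed

text \<open>Since \<open>k\<close> stays within |k0|/2 of \<open>k0\<close>, the integral differs
  from \<open>k0\<close> times the real Gaussian integral by at most half the size of that product.
  Only bounds up to powers of n are sought, not an asymptotic constant.\<close>

lemma laplace_segment:
  fixes k :: "real \<Rightarrow> complex" and I :: "nat \<Rightarrow> complex"
  assumes \<delta>: "\<delta> > 0" and k: "continuous_on {-\<delta>..\<delta>} k" and k0: "k0 \<noteq> 0"
    and close: "\<And>x. x \<in> {-\<delta>..\<delta>} \<Longrightarrow> cmod (k x - k0) \<le> cmod k0 / 2"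
    and I: "\<And>n. ((\<lambda>x. c ^ n * of_real (exp (- (real n * x\<^sup>2))) * k x) has_integral I n) {-\<delta>..\<delta>}"
  obtains A B where "A > 0" "B > 0"
    "\<And>n. n > 0 \<Longrightarrow> A * cmod c ^ n / real n \<le> cmod (I n)" "\<And>n. cmod (I n) \<le> B * cmod c ^ n"
proof -
  define A where "A = cmod k0 / 2 * (2 * \<delta> * exp (- \<delta>\<^sup>2))"
  define B where "B = 2 * cmod k0 * (2 * \<delta>)"
  define E where "E n = integral {-\<delta>..\<delta>} (\<lambda>x. exp (- (real n * x\<^sup>2)))" for n
  have int: "(\<lambda>x. exp (- (real n * x\<^sup>2))) integrable_on {-\<delta>..\<delta>}" for n
    by (intro integrable_continuous_real continuous_intros)
  have intk: "(\<lambda>x. of_real (exp (- (real n * x\<^sup>2))) * k x) integrable_on {-\<delta>..\<delta>}" for n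
    by (intro integrable_continuous_real continuous_intros k)
  define J where "J n = integral {-\<delta>..\<delta>} (\<lambda>x. of_real (exp (- (real n * x\<^sup>2))) * k x)" for n
  have IJ: "I n = c ^ n * J n" for n
  proof -
    have "((\<lambda>x. c ^ n * (of_real (exp (- (real n * x\<^sup>2))) * k x)) has_integral c ^ n * J n) {-\<delta>..\<delta>}"
      unfolding J_def by (intro has_integral_mult_right integrable_integral intk)
    then have "((\<lambda>x. c ^ n * of_real (exp (- (real n * x\<^sup>2))) * k x) has_integral c ^ n * J n) {-\<delta>..\<delta>}"
      by (simp only: mult.assoc)
    then show ?thesis by (rule has_integral_unique[OF I[of n]])
  qed
  have EE: "((\<lambda>x. complex_of_real (exp (- (real n * x\<^sup>2)))) has_integral of_real (E n)) {-\<delta>..\<delta>}" for n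
    unfolding E_def by (intro has_integral_of_real integrable_integral int)
  have diff: "cmod (J n - of_real (E n) * k0) \<le> E n * (cmod k0 / 2)" for n
  proof -
    have h: "((\<lambda>x. of_real (exp (- (real n * x\<^sup>2))) * k x - of_real (exp (- (real n * x\<^sup>2))) * k0) has_integral J n - of_real (E n) * k0) {-\<delta>..\<delta>}"
      unfolding J_def by (intro has_integral_diff has_integral_mult_left EE integrable_integral intk)
    have h2: "((\<lambda>x. exp (- (real n * x\<^sup>2)) * (cmod k0 / 2)) has_integral E n * (cmod k0 / 2)) {-\<delta>..\<delta>}"
      unfolding E_def by (intro has_integral_mult_left integrable_integral int)
    have "cmod (integral {-\<delta>..\<delta>} (\<lambda>x. of_real (exp (- (real n * x\<^sup>2))) * k x - of_real (exp (- (real n * x\<^sup>2))) * k0)) \<le>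
        integral {-\<delta>..\<delta>} (\<lambda>x. exp (- (real n * x\<^sup>2)) * (cmod k0 / 2))"
    proof (rule integral_norm_bound_integral[OF has_integral_integrable[OF h] has_integral_integrable[OF h2]])
      fix x assume x: "x \<in> {-\<delta>..\<delta>}"
      have "cmod (of_real (exp (- (real n * x\<^sup>2))) * k x - of_real (exp (- (real n * x\<^sup>2))) * k0) = exp (- (real n * x\<^sup>2)) * cmod (k x - k0)"
        by (simp add: norm_mult flip: right_diff_distrib)
      also have "\<dots> \<le> exp (- (real n * x\<^sup>2)) * (cmod k0 / 2)" using close[OF x] by (intro mult_left_mono) auto
      finally show "cmod (of_real (exp (- (real n * x\<^sup>2))) * k x - of_real (exp (- (real n * x\<^sup>2))) * k0) \<le> exp (- (real n * x\<^sup>2)) * (cmod k0 / 2)" .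
    qed
    then show ?thesis unfolding integral_unique[OF h] integral_unique[OF h2] .
  qed
  have E0: "E n \<ge> 0" for n unfolding E_def by (intro integral_nonneg int) auto
  have Eup: "E n \<le> 2 * \<delta>" for n
  proof -
    have "E n \<le> integral {-\<delta>..\<delta>} (\<lambda>x. 1)" unfolding E_def by (intro integral_le int) auto
    also have "\<dots> = 2 * \<delta>" using \<delta> by simp
    finally show ?thesis .
  qed
  have Elow: "E n \<ge> 2 * \<delta> * exp (- \<delta>\<^sup>2) / real n" if n: "n > 0" for n
  proof -
    \<comment> \<open>On |x| \<le> \<delta>/n the exponent n x^2 is at most \<delta>^2. The true
      order of \<open>E n\<close> is n^(-1/2), but 1/n is enough here.\<close>
    let ?r = "\<delta> / real n"
    have r: "?r \<le> \<delta>" using n \<delta> mult_left_mono[of 1 "real n" \<delta>] by (simp add: field_simps)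
    have sub: "{-?r..?r} \<subseteq> {-\<delta>..\<delta>}" using r by auto
    have "2 * \<delta> * exp (- \<delta>\<^sup>2) / real n = integral {-?r..?r} (\<lambda>x. exp (- \<delta>\<^sup>2))"
      using n \<delta> by simp
    also have "\<dots> \<le> integral {-?r..?r} (\<lambda>x. exp (- (real n * x\<^sup>2)))"
    proof (intro integral_le)
      fix x assume x: "x \<in> {-?r..?r}"
      have "x\<^sup>2 \<le> ?r\<^sup>2" using x by (intro power2_le_iff_abs_le[THEN iffD2]) auto
      then have "real n * x\<^sup>2 \<le> real n * ?r\<^sup>2" by (intro mult_left_mono) auto
      also have "\<dots> = \<delta>\<^sup>2 / real n" using n by (simp add: power2_eq_square)
      also have "\<dots> \<le> \<delta>\<^sup>2" using n mult_right_mono[of 1 "real n" "\<delta>\<^sup>2"] by (simp add: field_simps)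
      finally show "exp (- \<delta>\<^sup>2) \<le> exp (- (real n * x\<^sup>2))" by simp
    qed (auto intro!: integrable_continuous_real continuous_intros)
    also have "\<dots> \<le> E n" unfolding E_def
      by (intro integral_subset_le sub int integrable_continuous_real continuous_intros) auto
    finally show ?thesis .
  qed
  show ?thesis
  proof (rule that[of A B])
    show "A > 0" "B > 0" using \<delta> k0 by (auto simp: A_def B_def)
    fix n :: nat
    have m: "cmod (of_real (E n) * k0) = E n * cmod k0" using E0 by (simp add: norm_mult)
    have "cmod (J n) \<le> E n * cmod k0 + E n * (cmod k0 / 2)"
      using diff[of n] norm_triangle_ineq2[of "J n" "of_real (E n) * k0"] m by linarith
    also have "\<dots> \<le> E n * (2 * cmod k0)" using E0[of n] by (simp add: algebra_simps)
    also have "\<dots> \<le> (2 * \<delta>) * (2 * cmod k0)" using Eup by (intro mult_right_mono) auto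
    also have "\<dots> = B" by (simp add: B_def)
    finally have "cmod (J n) * cmod c ^ n \<le> B * cmod c ^ n" by (intro mult_right_mono) auto
    then show "cmod (I n) \<le> B * cmod c ^ n" by (simp add: IJ norm_mult norm_power mult.commute)
    assume n: "n > 0"
    have "A / real n = (2 * \<delta> * exp (- \<delta>\<^sup>2) / real n) * (cmod k0 / 2)" by (simp add: A_def)
    also have "\<dots> \<le> E n * (cmod k0 / 2)" using Elow[OF n] by (intro mult_right_mono) auto
    also have "\<dots> \<le> cmod (J n)"
      using diff[of n] norm_triangle_ineq2[of "of_real (E n) * k0" "J n"] m
      by (simp add: norm_minus_commute)
    finally have "A / real n * cmod c ^ n \<le> cmod (J n) * cmod c ^ n" by (intro mult_right_mono) auto
    then show "A * cmod c ^ n / real n \<le> cmod (I n)" by (simp add: IJ norm_mult norm_power mult.commute)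
  qed
qed

lemma connected_in_component:
  fixes \<Omega> :: "complex set"
  assumes "B = connected_component_set \<Omega> b" "connected C" "C \<subseteq> \<Omega>" "C \<inter> B \<noteq> {}"
  shows "C \<subseteq> B"
proof -
  obtain c where c: "c \<in> C" "c \<in> B" using assms by blast
  then have "connected_component_set \<Omega> c = B" unfolding assms(1) using connected_component_eq by blast
  then show ?thesis using connected_component_maximal[OF c(1) assms(2,3)] by simp
qed

section \<open>Passing the contour through the saddle\<close>

context heat_data begin

lemma endcomp_subset: "endcomp z \<eta> \<sigma> \<subseteq> \<Omega> z \<eta>"
proof
  fix u assume "u \<in> endcomp z \<eta> \<sigma>"
  then obtain y0 where "\<forall>y\<ge>y0. connected_component (\<Omega> z \<eta>) u (\<i> * of_real (\<sigma> * y))"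
    unfolding endcomp_def by blast
  then have "connected_component (\<Omega> z \<eta>) u (\<i> * of_real (\<sigma> * y0))" by simp
  then show "u \<in> \<Omega> z \<eta>" using connected_component_in(1) by blast
qed

text \<open>In the Morse coordinate the modulus is
  \<open>pass_level z * exp ((Re w)\<^sup>2 - (Im w)\<^sup>2)\<close>, so the strict sublevel set
  near \<open>p\<close> is a pair of opposite sectors. Each end component has \<open>p\<close> in
  its closure and hence contains a sector; disjointness makes these two different sectors.\<close>

lemma saddle_sectors:
  assumes p: "cmod (\<Phi> z p) = pass_level z" "deriv (\<Phi> z) p = 0" "deriv (deriv (\<Phi> z)) p \<noteq> 0"
    and clos: "\<And>\<sigma>. \<sigma> \<in> {1, -1} \<Longrightarrow> p \<in> closure (endcomp z (pass_level z) \<sigma>)"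
  obtains e g where "e > 0" "g holomorphic_on ball 0 e" "deriv g 0 \<noteq> 0"
    "\<And>w. w \<in> ball 0 e \<Longrightarrow> \<Phi> z (g w) = \<Phi> z p * exp (w\<^sup>2)"
    "\<And>\<sigma> x. \<sigma> \<in> {1, -1} \<Longrightarrow> 0 < x \<Longrightarrow> x < e \<Longrightarrow> g (\<i> * of_real (\<sigma> * x)) \<in> endcomp z (pass_level z) \<sigma>"
proof -
  have p0: "\<Phi> z p \<noteq> 0" using p(1) pass_level_pos[of z] by auto
  obtain e g where e: "e > 0" and g: "g holomorphic_on ball 0 e" "g 0 = p" "open (g ` ball 0 e)" "deriv g 0 \<noteq> 0"
    "\<And>w. w \<in> ball 0 e \<Longrightarrow> \<Phi> z (g w) = \<Phi> z p * exp (w\<^sup>2)"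
    using morse_lemma_holomorphic[OF phi_holomorphic p0 p(2,3)] by blast
  let ?B = "endcomp z (pass_level z)"
  define S where "S \<sigma> = {w \<in> ball 0 e. \<bar>Re w\<bar> < \<sigma> * Im w}" for \<sigma> :: real
  have cm: "cmod (\<Phi> z (g w)) = pass_level z * exp ((Re w)\<^sup>2 - (Im w)\<^sup>2)" if "w \<in> ball 0 e" for w
    unfolding g(5)[OF that] norm_mult p(1) by (simp add: power2_eq_square)
  have Sneg: "cmod (\<Phi> z (g w)) < pass_level z" if "w \<in> S \<sigma>" "\<sigma> \<in> {1, -1}" for w \<sigma>
  proof -
    have w: "w \<in> ball 0 e" "\<bar>Re w\<bar> < \<bar>Im w\<bar>" using that by (auto simp: S_def)
    have "(Re w)\<^sup>2 < (Im w)\<^sup>2" using w(2) abs_square_less_1 by (metis abs_le_square_iff linorder_not_le)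
    then show ?thesis unfolding cm[OF w(1)] using pass_level_pos[of z] by simp
  qed
  have convS: "convex (S \<sigma>)" if "\<sigma> \<in> {1, -1}" for \<sigma>
  proof -
    have "S \<sigma> = ball 0 e \<inter> ({w. inner (Complex 1 (-\<sigma>)) w < 0} \<inter> {w. inner (Complex (-1) (-\<sigma>)) w < 0})"
      by (auto simp: S_def inner_complex_def)
    then show ?thesis by (auto intro!: convex_Int convex_halfspace_lt)
  qed
  have cg: "continuous_on (ball 0 e) g" using g(1) by (rule holomorphic_on_imp_continuous_on)
  have conS: "connected (g ` S \<sigma>)" if "\<sigma> \<in> {1, -1}" for \<sigma>
    by (intro connected_continuous_image continuous_on_subset[OF cg] convex_connected convS that) (auto simp: S_def)
  have sub: "g ` S \<sigma> \<subseteq> \<Omega> z (pass_level z)" if "\<sigma> \<in> {1, -1}" for \<sigma>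
    using Sneg that by blast
  have ex: "\<exists>\<tau>\<in>{1, -1}. g ` S \<tau> \<subseteq> ?B \<sigma>" if \<sigma>: "\<sigma> \<in> {1, -1}" for \<sigma>
  proof -
    obtain b where b: "?B \<sigma> = connected_component_set (\<Omega> z (pass_level z)) b"
      using endcomp_component[OF pass_level_pos \<sigma>] by blast
    have "p \<in> g ` ball 0 e" using g(2) e by (metis centre_in_ball imageI)
    then have "g ` ball 0 e \<inter> ?B \<sigma> \<noteq> {}"
      using clos[OF \<sigma>] g(3) open_Int_closure_eq_empty[of "g ` ball 0 e" "?B \<sigma>"] by blast
    then obtain w where w: "w \<in> ball 0 e" "g w \<in> ?B \<sigma>" by blast
    then have "cmod (\<Phi> z (g w)) < pass_level z" using endcomp_subset by blast
    then have "(Re w)\<^sup>2 < (Im w)\<^sup>2" unfolding cm[OF w(1)] using pass_level_pos[of z] by (simp add: mult_less_cancel_left2)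
    then have "\<bar>Re w\<bar> < \<bar>Im w\<bar>" by (metis abs_le_square_iff linorder_not_le)
    then have "w \<in> S (if Im w > 0 then 1 else -1)" using w(1) by (auto simp: S_def)
    then obtain \<tau> where \<tau>: "\<tau> \<in> {1, -1}" "w \<in> S \<tau>" by (metis insertCI)
    have "g ` S \<tau> \<subseteq> ?B \<sigma>" by (rule connected_in_component[OF b conS[OF \<tau>(1)] sub[OF \<tau>(1)]]) (use w \<tau> in blast)
    then show ?thesis using \<tau>(1) by blast
  qed
  have Sne: "S \<sigma> \<noteq> {}" if "\<sigma> \<in> {1, -1}" for \<sigma>
  proof -
    have "\<i> * of_real (\<sigma> * (e / 2)) \<in> S \<sigma>" using that e by (auto simp: S_def norm_mult)
    then show ?thesis by blast
  qed
  obtain \<tau> where \<tau>: "\<tau> \<in> {1, -1}" "g ` S \<tau> \<subseteq> ?B 1" using ex[of 1] by blast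
  obtain \<tau>' where \<tau>': "\<tau>' \<in> {1, -1}" "g ` S \<tau>' \<subseteq> ?B (-1)" using ex[of "-1"] by blast
  have "\<tau> \<noteq> \<tau>'" using endcomp_pass_level_disjoint[of z] \<tau> \<tau>' Sne[OF \<tau>(1)] by blast
  then have \<tau>\<tau>': "\<tau>' = - \<tau>" using \<tau>(1) \<tau>'(1) by auto
  have inB: "g ` S (\<tau> * \<sigma>) \<subseteq> ?B \<sigma>" if "\<sigma> \<in> {1, -1}" for \<sigma>
    using that \<tau>(2) \<tau>'(2) by (auto simp: \<tau>\<tau>')
  have n\<tau>: "\<tau> * \<tau> = 1" "cmod (of_real \<tau>) = 1" "\<bar>\<tau>\<bar> = 1" using \<tau>(1) by auto
  \<comment> \<open>Replacing w by -w when \<tau> = -1 puts the upper sector into the upper end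
    component; the normal form depends only on the square of w.\<close>
  define G where "G w = g (of_real \<tau> * w)" for w
  show ?thesis
  proof (rule that[OF e, of G])
    show "G holomorphic_on ball 0 e"
      unfolding G_def by (rule holomorphic_on_compose_gen[OF _ g(1), unfolded o_def])
        (auto intro!: holomorphic_intros simp: norm_mult n\<tau>)
    have "(g has_field_derivative deriv g 0) (at (of_real \<tau> * 0))"
      using holomorphic_derivI[OF g(1) open_ball, of 0] e by simp
    then have "((\<lambda>w. g (of_real \<tau> * w)) has_field_derivative deriv g 0 * of_real \<tau>) (at 0)"
      by (rule DERIV_chain2) (auto intro!: derivative_eq_intros)
    then have "deriv G 0 = deriv g 0 * of_real \<tau>" unfolding G_def by (rule DERIV_imp_deriv)
    then show "deriv G 0 \<noteq> 0" using g(4) n\<tau> by auto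
    fix w :: complex assume w: "w \<in> ball 0 e"
    have "of_real \<tau> * w \<in> ball 0 e" using w by (simp add: norm_mult n\<tau>)
    moreover have "(of_real \<tau> * w)\<^sup>2 = w\<^sup>2" using \<tau>(1) by auto
    ultimately show "\<Phi> z (G w) = \<Phi> z p * exp (w\<^sup>2)" unfolding G_def using g(5) by metis
  next
    fix \<sigma> x :: real assume \<sigma>: "\<sigma> \<in> {1, -1}" and x: "0 < x" "x < e"
    have "of_real \<tau> * (\<i> * of_real (\<sigma> * x)) \<in> S (\<tau> * \<sigma>)"
      using \<sigma> \<tau>(1) x by (auto simp: S_def norm_mult)
    then show "G (\<i> * of_real (\<sigma> * x)) \<in> endcomp z (pass_level z) \<sigma>" using inB[OF \<sigma>] unfolding G_def by blast
  qed
qed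

text \<open>A path inside the open end component has compact image, so |\<Phi>| stays below some m <
  \<eta> on it. Both L and m are independent of n, which makes this arc exponentially smaller than
  \<eta>^n.\<close>

lemma component_contour_bound:
  assumes \<sigma>: "\<sigma> \<in> {1, -1}" and x: "x \<in> endcomp z \<eta> \<sigma>" "y \<in> endcomp z \<eta> \<sigma>" and \<eta>: "\<eta> > 0"
    and F: "\<And>n u. (F n has_field_derivative \<Phi> z u ^ n) (at u)"
  obtains L m where "L > 0" "0 < m" "m < \<eta>" "\<And>n. cmod (F n y - F n x) \<le> L * m ^ n"
proof -
  obtain b where b: "endcomp z \<eta> \<sigma> = connected_component_set (\<Omega> z \<eta>) b"
    using endcomp_component[OF \<eta> \<sigma>] by blast
  have "open (endcomp z \<eta> \<sigma>)" unfolding b using open_sub by (rule open_connected_component)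
  moreover have "connected (endcomp z \<eta> \<sigma>)" unfolding b by (rule connected_connected_component)
  ultimately obtain g where g: "polynomial_function g" "path_image g \<subseteq> endcomp z \<eta> \<sigma>" "pathstart g = x" "pathfinish g = y"
    using connected_open_polynomial_connected x by metis
  have vg: "valid_path g" using g(1) by (rule valid_path_polynomial_function)
  have pg: "path g" using vg by (rule valid_path_imp_path)
  obtain w where w: "w \<in> path_image g" "\<And>v. v \<in> path_image g \<Longrightarrow> cmod (\<Phi> z v) \<le> cmod (\<Phi> z w)"
    using continuous_attains_sup[OF compact_path_image[OF pg] path_image_nonempty, of "\<lambda>v. cmod (\<Phi> z v)"]
    by (auto intro: continuous_intros phi_continuous_on)
  \<comment> \<open>The midpoint leaves room above the maximum, so that the path lies in the open
    set \<open>\<Omega> z m\<close> on which the contour bound is stated.\<close>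
  define m where "m = (cmod (\<Phi> z w) + \<eta>) / 2"
  have "cmod (\<Phi> z w) < \<eta>" using w(1) g(2) endcomp_subset[of z \<eta> \<sigma>] by blast
  then have m: "cmod (\<Phi> z w) < m" "m < \<eta>" "0 < m" using \<eta> by (auto simp: m_def add_nonneg_pos)
  have "path_image g \<subseteq> \<Omega> z m" using w(2) m(1) by (auto intro: le_less_trans)
  then obtain L where L: "L > 0" "\<And>f B. f holomorphic_on \<Omega> z m \<Longrightarrow> (\<And>u. u \<in> \<Omega> z m \<Longrightarrow> cmod (f u) \<le> B) \<Longrightarrow> cmod (contour_integral g f) \<le> L * B"
    using contour_integral_bound_exists[OF open_sub vg, of z m] by metis
  show ?thesis
  proof (rule that[OF L(1) m(3,2)])
    fix n
    have "((\<lambda>u. \<Phi> z u ^ n) has_contour_integral F n (pathfinish g) - F n (pathstart g)) g"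
      by (rule contour_integral_primitive[OF _ vg subset_UNIV]) (use F in simp)
    then have "contour_integral g (\<lambda>u. \<Phi> z u ^ n) = F n y - F n x"
      using g(3,4) by (simp add: contour_integral_unique)
    moreover have "cmod (contour_integral g (\<lambda>u. \<Phi> z u ^ n)) \<le> L * m ^ n"
      by (rule L(2)) (auto intro!: holomorphic_intros phi_holomorphic simp: norm_power intro: power_mono)
    ultimately show "cmod (F n y - F n x) \<le> L * m ^ n" by simp
  qed
qed

text \<open>Writing every contour integral as a difference of values of one entire primitive takes
  the place of a deformation of contours.\<close>

lemma phi_power_primitive:
  obtains F where "\<And>n u. (F n has_field_derivative \<Phi> z u ^ n) (at u)"
proof -
  have "\<exists>F. \<forall>u. (F has_field_derivative \<Phi> z u ^ n) (at u)" for n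
  proof -
    have hol: "(\<lambda>u. \<Phi> z u ^ n) holomorphic_on UNIV" by (intro holomorphic_intros phi_holomorphic)
    show ?thesis using holomorphic_convex_primitive'[OF _ _ hol] by auto
  qed
  then show ?thesis using that by metis
qed

definition heat_value :: "nat \<Rightarrow> complex \<Rightarrow> complex" where
  "heat_value n z = poly (heat_poly d lam a t n) z"

lemma al_pos_nat: "total_mult d a > 0" using al_pos by simp

text \<open>Outside [-Y, Y] the n-th power is at most (\<eta>/2)^(n-1) times |\<Phi>|, which is
  integrable by the case n = 1 of \<open>heat_poly_integral\<close>. The factor i comes from du = i
  dy.\<close>

lemma vertical_integral_tail:
  assumes \<eta>: "\<eta> > 0" and Y: "Y > 0" "\<And>y. \<bar>y\<bar> \<ge> Y \<Longrightarrow> cmod (\<Phi> z (z + \<i> * of_real y)) \<le> \<eta> / 2"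
    and F: "\<And>n u. (F n has_field_derivative \<Phi> z u ^ n) (at u)"
  obtains C where "C \<ge> 0" "\<And>n. n > 0 \<Longrightarrow>
    cmod (\<i> * (of_real (sqrt (2 * pi * t / (al * n))) * heat_value n z)
      - (F n (z + \<i> * of_real Y) - F n (z - \<i> * of_real Y))) \<le> C * (\<eta> / 2) ^ n"
proof -
  let ?f = "\<lambda>y. \<Phi> z (z + \<i> * of_real y)"
  have "integrable lborel (\<lambda>y. ?f y ^ 1)"
    using heat_poly_integral[OF t al_pos_nat, of 1 lam z] by (auto simp: has_bochner_integral_iff)
  then have "integrable lborel (\<lambda>y. cmod (?f y))" by simp
  then have If: "(\<lambda>y. cmod (?f y)) integrable_on UNIV" by (rule integrable_on_lborel)
  \<comment> \<open>Dividing by \<eta>/2 restores the exponent n from n - 1.\<close>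
  define C where "C = integral UNIV (\<lambda>y. cmod (?f y)) / (\<eta> / 2)"
  have vd: "((\<lambda>y. F n (z + \<i> * of_real y)) has_vector_derivative \<i> * ?f y ^ n) (at y)" for n y
  proof -
    have "((\<lambda>y. z + \<i> * of_real y) has_vector_derivative \<i>) (at y)"
      by (auto intro!: derivative_eq_intros)
    then have "(F n \<circ> (\<lambda>y. z + \<i> * of_real y) has_vector_derivative \<i> * ?f y ^ n) (at y)"
      by (rule field_vector_diff_chain_at) (rule F)
    then show ?thesis by (simp add: o_def)
  qed
  show ?thesis
  proof (rule that[of C])
    show "C \<ge> 0" unfolding C_def using \<eta> by (intro divide_nonneg_pos integral_nonneg If) auto
    fix n :: nat assume n: "n > 0"
    let ?I = "of_real (sqrt (2 * pi * t / (al * n))) * heat_value n z"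
    let ?J = "F n (z + \<i> * of_real Y) - F n (z - \<i> * of_real Y)"
    have I: "has_bochner_integral lborel (\<lambda>y. ?f y ^ n) ?I"
      unfolding heat_value_def using heat_poly_integral[OF t al_pos_nat n, of lam z] .
    then have "integrable lborel (\<lambda>y. ?f y ^ n)" by (simp add: has_bochner_integral_iff)
    then have "((\<lambda>y. ?f y ^ n) has_integral (integral\<^sup>L lborel (\<lambda>y. ?f y ^ n))) UNIV"
      by (rule has_integral_integral_lborel)
    then have hI: "((\<lambda>y. ?f y ^ n) has_integral ?I) UNIV"
      unfolding has_bochner_integral_integral_eq[OF I] .
    have "((\<lambda>y. \<i> * ?f y ^ n) has_integral (F n (z + \<i> * of_real Y) - F n (z + \<i> * of_real (-Y)))) {-Y..Y}"
      by (rule fundamental_theorem_of_calculus[OF _ has_vector_derivative_at_within[OF vd]]) (use Y in auto)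
    then have "((\<lambda>y. if y \<in> {-Y..Y} then \<i> * ?f y ^ n else 0) has_integral ?J) UNIV"
      by (subst has_integral_restrict_UNIV) simp
    from has_integral_diff[OF has_integral_mult_right[OF hI, of \<i>] this]
    have h: "((\<lambda>y. if y \<in> {-Y..Y} then 0 else \<i> * ?f y ^ n) has_integral \<i> * ?I - ?J) UNIV"
      by (rule has_integral_eq[rotated]) auto
    let ?g = "\<lambda>y. (\<eta> / 2) ^ (n - 1) * cmod (?f y)"
    have g: "?g integrable_on UNIV" using If by (rule integrable_on_mult_right)
    have "cmod (integral UNIV (\<lambda>y. if y \<in> {-Y..Y} then 0 else \<i> * ?f y ^ n)) \<le> integral UNIV ?g"
    proof (rule integral_norm_bound_integral[OF has_integral_integrable[OF h] g])
      fix y :: real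
      show "cmod (if y \<in> {-Y..Y} then 0 else \<i> * ?f y ^ n) \<le> ?g y"
      proof (cases "y \<in> {-Y..Y}")
        case False
        then have "cmod (?f y) \<le> \<eta> / 2" using Y(2)[of y] by auto
        then have "cmod (?f y) ^ (n - 1) * cmod (?f y) \<le> (\<eta> / 2) ^ (n - 1) * cmod (?f y)"
          by (intro mult_right_mono power_mono) auto
        moreover have "cmod (?f y) ^ (n - 1) * cmod (?f y) = cmod (?f y) ^ n"
          using n by (cases n) auto
        ultimately show ?thesis using False by (simp del: atLeastAtMost_iff add: norm_mult norm_power)
      qed (use \<eta> in auto)
    qed
    also have "integral UNIV ?g = C * (\<eta> / 2) ^ n"
      unfolding C_def using n \<eta> by (cases n) auto
    finally show "cmod (\<i> * ?I - ?J) \<le> C * (\<eta> / 2) ^ n" unfolding integral_unique[OF h] .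
  qed
qed

text \<open>The central part of the vertical line is exchanged for two arcs inside the end
  components and the segment through the saddle in the Morse coordinate. Only that segment
  contributes at the rate \<eta>^n; the tails and arcs are exponentially smaller.\<close>

theorem heat_poly_asymptotics:
  assumes uniq: "\<And>q. cmod (\<Phi> z q) = pass_level z \<Longrightarrow> deriv (\<Phi> z) q = 0 \<Longrightarrow> q = p"
    and nondeg: "deriv (deriv (\<Phi> z)) p \<noteq> 0"
  shows "(\<lambda>n. ln (cmod (heat_value n z)) / real n) \<longlonglongrightarrow> ln (pass_level z)"
    and "eventually (\<lambda>n. heat_value n z \<noteq> 0) sequentially"
    and "cmod (\<Phi> z p) = pass_level z" and "deriv (\<Phi> z) p = 0"
proof -
  \<comment> \<open>\<open>uniq\<close> identifies the critical points found for the two ends, so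
    the one point \<open>p\<close> touches both end components.\<close>
  have clos: "p \<in> closure (endcomp z (pass_level z) \<sigma>)" "cmod (\<Phi> z p) = pass_level z" "deriv (\<Phi> z) p = 0" if "\<sigma> \<in> {1, -1}" for \<sigma>
    using critical_point_endcomp[OF that, of z] uniq by metis+
  show p: "cmod (\<Phi> z p) = pass_level z" "deriv (\<Phi> z) p = 0" using clos[of 1] by auto
  define \<eta> where "\<eta> = pass_level z"
  have \<eta>: "\<eta> > 0" by (simp add: \<eta>_def pass_level_pos)
  obtain e g where e: "e > 0" and g: "g holomorphic_on ball 0 e" "deriv g 0 \<noteq> 0"
    "\<And>w. w \<in> ball 0 e \<Longrightarrow> \<Phi> z (g w) = \<Phi> z p * exp (w\<^sup>2)"
    "\<And>\<sigma> x. \<sigma> \<in> {1, -1} \<Longrightarrow> 0 < x \<Longrightarrow> x < e \<Longrightarrow> g (\<i> * of_real (\<sigma> * x)) \<in> endcomp z \<eta> \<sigma>"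
    unfolding \<eta>_def using saddle_sectors[OF p nondeg clos(1)] by blast
  obtain F where F: "\<And>n u. (F n has_field_derivative \<Phi> z u ^ n) (at u)" using phi_power_primitive by blast
  obtain Y1 where Y1: "Y1 > 0" "\<And>z' u. cmod z' \<le> cmod z \<Longrightarrow> \<bar>Re u\<bar> \<le> \<bar>Re z\<bar> \<Longrightarrow> \<bar>Im u\<bar> \<ge> Y1 \<Longrightarrow> cmod (\<Phi> z' u) \<le> \<eta> / 2 * exp (- \<bar>Im u\<bar>)"
    using phi_decay[of "\<eta> / 2" "cmod z" "\<bar>Re z\<bar>"] \<eta> by (metis half_gt_zero)
  obtain Y2 where Y2: "Y2 > 0" "\<And>z'. cmod z' \<le> cmod z \<Longrightarrow> decays_vertically z' Y2" using decays_vertically_exists[of "cmod z"] by blast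
  have V: "decays_vertically z Y2" using Y2(2) by simp
  \<comment> \<open>\<open>\<bar>Im z\<bar>\<close> is added because the integration line is
    parametrised from \<open>z\<close>, whereas \<open>Y1\<close> and \<open>Y2\<close> bound
    imaginary parts.\<close>
  define Y where "Y = Y1 + Y2 + \<bar>Im z\<bar>"
  have Y: "Y > 0" using Y1 Y2 by (simp add: Y_def)
  have small: "cmod (\<Phi> z (z + \<i> * of_real y)) \<le> \<eta> / 2" if "\<bar>y\<bar> \<ge> Y" for y
  proof -
    have "cmod (\<Phi> z (z + \<i> * of_real y)) \<le> \<eta> / 2 * exp (- \<bar>Im z + y\<bar>)"
      using Y1(2)[of z "z + \<i> * of_real y"] that Y2 by (simp add: Y_def)
    also have "\<dots> \<le> \<eta> / 2 * 1" using \<eta> by (intro mult_left_mono) auto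
    finally show ?thesis by simp
  qed
  have ends: "z + \<i> * of_real (\<sigma> * Y) \<in> endcomp z \<eta> \<sigma>" if \<sigma>: "\<sigma> \<in> {1, -1}" for \<sigma>
  proof (rule ray_endcomp[OF V \<sigma>])
    show "cmod (\<Phi> z (z + \<i> * of_real (\<sigma> * Y))) < \<eta>" using small[of "\<sigma> * Y"] \<sigma> Y \<eta> by auto
    show "\<sigma> * Im (z + \<i> * of_real (\<sigma> * Y)) \<ge> Y2" using \<sigma> Y1 by (auto simp: Y_def)
  qed
  obtain C where C: "C \<ge> 0" "\<And>n. n > 0 \<Longrightarrow>
    cmod (\<i> * (of_real (sqrt (2 * pi * t / (al * n))) * heat_value n z)
      - (F n (z + \<i> * of_real Y) - F n (z - \<i> * of_real Y))) \<le> C * (\<eta> / 2) ^ n"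
    using vertical_integral_tail[OF \<eta> Y small F] by blast
  define k0 where "k0 = deriv g 0 * \<i>"
  have k0: "k0 \<noteq> 0" using g(2) by (simp add: k0_def)
  define k where "k x = deriv g (\<i> * of_real x) * \<i>" for x :: real
  have dg: "deriv g holomorphic_on ball 0 e" using g(1) by (intro holomorphic_deriv) auto
  have kc: "continuous_on {-r..r} k" if "r < e" for r
    unfolding k_def using that
    by (intro continuous_intros continuous_on_compose2[OF holomorphic_on_imp_continuous_on[OF dg]]) (auto simp: norm_mult)
  have "isCont k 0"
  proof -
    have "continuous (at 0) k"
      using kc[of "e / 2"] e by (intro continuous_on_interior[of "{-(e/2)..e/2}"]) auto
    then show ?thesis by simp
  qed
  moreover have "k 0 = k0" by (simp add: k_def k0_def)
  ultimately have "(k \<longlongrightarrow> k0) (at 0)" by (metis isCont_def)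
  then have "eventually (\<lambda>x. dist (k x) k0 < cmod k0 / 2) (at 0)" using k0 by (intro tendstoD) auto
  then obtain r where r: "r > 0" "\<And>x. x \<noteq> 0 \<Longrightarrow> dist x 0 < r \<Longrightarrow> dist (k x) k0 < cmod k0 / 2"
    unfolding eventually_at by (metis UNIV_I)
  define \<delta> where "\<delta> = min (r / 2) (e / 2)"
  have \<delta>: "\<delta> > 0" "\<delta> < r" "\<delta> < e" using r(1) e by (auto simp: \<delta>_def)
  have close: "cmod (k x - k0) \<le> cmod k0 / 2" if "x \<in> {-\<delta>..\<delta>}" for x
  proof (cases "x = 0")
    case False
    then have "dist (k x) k0 < cmod k0 / 2" using r(2)[of x] that \<delta> by auto
    then show ?thesis by (simp add: dist_norm)
  qed (use \<open>k 0 = k0\<close> in auto)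
  define Mid where "Mid n = F n (g (\<i> * of_real \<delta>)) - F n (g (\<i> * of_real (- \<delta>)))" for n
  have hasI: "((\<lambda>x. \<Phi> z p ^ n * of_real (exp (- (real n * x\<^sup>2))) * k x) has_integral Mid n) {-\<delta>..\<delta>}" for n
  proof -
    have vd: "((\<lambda>x. F n (g (\<i> * of_real x))) has_vector_derivative \<Phi> z p ^ n * of_real (exp (- (real n * x\<^sup>2))) * k x) (at x)"
      if x: "x \<in> {-\<delta>..\<delta>}" for x
    proof -
      have xin: "\<i> * of_real x \<in> ball 0 e" using x \<delta> by (auto simp: norm_mult)
      have "((\<lambda>x. \<i> * complex_of_real x) has_vector_derivative \<i>) (at x)"
        by (auto intro!: derivative_eq_intros)
      moreover have "(g has_field_derivative deriv g (\<i> * of_real x)) (at (\<i> * of_real x))"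
        using holomorphic_derivI[OF g(1) open_ball xin] .
      ultimately have "(g \<circ> (\<lambda>x. \<i> * complex_of_real x) has_vector_derivative \<i> * deriv g (\<i> * of_real x)) (at x)"
        by (rule field_vector_diff_chain_at)
      then have "(F n \<circ> (g \<circ> (\<lambda>x. \<i> * complex_of_real x)) has_vector_derivative \<i> * deriv g (\<i> * of_real x) * \<Phi> z ((g \<circ> (\<lambda>x. \<i> * complex_of_real x)) x) ^ n) (at x)"
        by (rule field_vector_diff_chain_at) (rule F)
      moreover have "\<Phi> z (g (\<i> * of_real x)) ^ n = \<Phi> z p ^ n * of_real (exp (- (real n * x\<^sup>2)))"
      proof -
        have "\<Phi> z (g (\<i> * of_real x)) ^ n = \<Phi> z p ^ n * exp (of_nat n * (\<i> * of_real x)\<^sup>2)"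
          unfolding g(3)[OF xin] by (simp only: power_mult_distrib exp_of_nat_mult)
        also have "of_nat n * (\<i> * of_real x)\<^sup>2 = complex_of_real (- (real n * x\<^sup>2))"
          by (simp add: power_mult_distrib)
        finally show ?thesis by (simp only: exp_of_real)
      qed
      ultimately show ?thesis by (simp add: o_def k_def mult_ac)
    qed
    have le: "-\<delta> \<le> \<delta>" using \<delta> by simp
    show ?thesis unfolding Mid_def
      by (rule fundamental_theorem_of_calculus[OF le has_vector_derivative_at_within[OF vd]])
  qed
  obtain A B where AB: "A > 0" "B > 0" "\<And>n. n > 0 \<Longrightarrow> A * cmod (\<Phi> z p) ^ n / real n \<le> cmod (Mid n)"
      "\<And>n. cmod (Mid n) \<le> B * cmod (\<Phi> z p) ^ n"
    using laplace_segment[OF \<delta>(1) kc[OF \<delta>(3)] k0 close hasI] by blast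
  have AB': "\<And>n. n > 0 \<Longrightarrow> A * \<eta> ^ n / real n \<le> cmod (Mid n)" "\<And>n. cmod (Mid n) \<le> B * \<eta> ^ n"
    using AB(3,4) by (simp_all add: p(1) \<eta>_def)
  obtain L1 m1 where 1: "L1 > 0" "0 < m1" "m1 < \<eta>"
      "\<And>n. cmod (F n (z + \<i> * of_real (1 * Y)) - F n (g (\<i> * of_real (1 * \<delta>)))) \<le> L1 * m1 ^ n"
    using component_contour_bound[OF _ g(4)[OF _ \<delta>(1,3)] ends \<eta> F, of 1] by auto
  obtain L2 m2 where 2: "L2 > 0" "0 < m2" "m2 < \<eta>"
      "\<And>n. cmod (F n (z + \<i> * of_real (-1 * Y)) - F n (g (\<i> * of_real (-1 * \<delta>)))) \<le> L2 * m2 ^ n"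
    using component_contour_bound[OF _ g(4)[OF _ \<delta>(1,3)] ends \<eta> F, of "-1"] by auto
  define m where "m = max (max m1 m2) (\<eta> / 2)"
  have m: "m1 \<le> m" "m2 \<le> m" "\<eta> / 2 \<le> m" "m < \<eta>" "m > 0" using 1 2 \<eta> by (auto simp: m_def)
  define c where "c n = sqrt (2 * pi * t / (al * real n))" for n
  define K where "K = C + L1 + L2"
  have tri: "cmod (x + y - w) \<le> cmod x + cmod y + cmod w" for x y w
    using norm_triangle_ineq4[of "x + y" w] norm_triangle_ineq[of x y] by linarith
  have main: "cmod (\<i> * (of_real (c n) * heat_value n z) - Mid n) \<le> K * m ^ n" if n: "n > 0" for n
  proof -
    \<comment> \<open>Telescoping: the values of the primitive at the junctions cancel, which leaves
      the three errors.\<close>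
    have "\<i> * (of_real (c n) * heat_value n z) - Mid n =
       (\<i> * (of_real (c n) * heat_value n z) - (F n (z + \<i> * of_real Y) - F n (z - \<i> * of_real Y)))
       + (F n (z + \<i> * of_real (1 * Y)) - F n (g (\<i> * of_real (1 * \<delta>))))
       - (F n (z + \<i> * of_real (-1 * Y)) - F n (g (\<i> * of_real (-1 * \<delta>))))"
      by (simp add: Mid_def)
    also have "cmod \<dots> \<le> C * (\<eta> / 2) ^ n + L1 * m1 ^ n + L2 * m2 ^ n"
      by (rule order.trans[OF tri add_mono[OF add_mono[OF C(2)[OF n, folded c_def] 1(4)] 2(4)]])
    also have "\<dots> \<le> C * m ^ n + L1 * m ^ n + L2 * m ^ n"
      using m 1 2 C \<eta> by (intro add_mono mult_left_mono power_mono) auto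
    finally show ?thesis by (simp add: K_def algebra_simps)
  qed
  have cm: "cmod (\<i> * (of_real (c n) * heat_value n z)) = c n * cmod (heat_value n z)" for n
    by (simp add: norm_mult c_def t less_imp_le)
  have K: "K > 0" using C 1 2 by (simp add: K_def)
  have q: "0 < m / \<eta>" "m / \<eta> < 1" using m \<eta> by auto
  \<comment> \<open>The lower bound for the main part carries a factor 1/n, so the error has to stay
    small even after multiplication by n.\<close>
  have "(\<lambda>n. K * (real n * (m / \<eta>) ^ n)) \<longlonglongrightarrow> K * 0"
    by (intro tendsto_mult_left powser_times_n_limit_0) (use q in auto)
  then have ev1: "eventually (\<lambda>n. K * (real n * (m / \<eta>) ^ n) < A / 2) sequentially"
    using AB(1) by (auto dest: order_tendstoD(2)[where a = "A / 2"])
  define c1 where "c1 = sqrt (2 * pi * t / al)"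
  have c1: "c1 > 0" using t al_pos by (simp add: c1_def)
  have cn: "c n = c1 / sqrt (real n)" for n by (simp add: c_def c1_def real_sqrt_divide real_sqrt_mult)
  have ev: "eventually (\<lambda>n. (A / 2 / c1) * \<eta> ^ n / real n \<le> cmod (heat_value n z) \<and> cmod (heat_value n z) \<le> ((B + K) / c1) * \<eta> ^ n * real n) sequentially"
    using ev1 eventually_ge_at_top[of 1]
  proof eventually_elim
    case (elim n)
    have s: "1 \<le> sqrt (real n)" "sqrt (real n) \<le> real n"
      using elim real_sqrt_le_mono[of 1 "real n"] by (auto simp: real_sqrt_le_iff' intro: real_le_lsqrt self_le_power)
    have "K * m ^ n * real n = K * (real n * (m / \<eta>) ^ n) * \<eta> ^ n" using \<eta> by (simp add: power_divide)
    also have "\<dots> \<le> A / 2 * \<eta> ^ n" using elim \<eta> by (intro mult_right_mono) auto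
    finally have "K * m ^ n \<le> A / 2 * \<eta> ^ n / real n" using elim by (simp add: field_simps)
    moreover have "A * \<eta> ^ n / real n \<le> c n * cmod (heat_value n z) + K * m ^ n"
      using AB'(1)[of n] main[of n] norm_triangle_ineq2[of "Mid n" "\<i> * (of_real (c n) * heat_value n z)"] elim
      unfolding cm[symmetric] by (simp add: norm_minus_commute)
    ultimately have l: "A / 2 * \<eta> ^ n / real n \<le> c n * cmod (heat_value n z)" by (simp add: field_simps)
    also have "\<dots> \<le> c1 * cmod (heat_value n z)"
      unfolding cn using s c1 by (intro mult_right_mono) (auto simp: field_simps)
    finally have "(A / 2 * \<eta> ^ n / real n) / c1 \<le> (c1 * cmod (heat_value n z)) / c1"
      by (rule divide_right_mono) (use c1 in auto)
    moreover have "(c1 * cmod (heat_value n z)) / c1 = cmod (heat_value n z)" using c1 by simp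
    ultimately have "(A / 2 / c1) * \<eta> ^ n / real n \<le> cmod (heat_value n z)" by (simp add: field_simps)
    moreover have "cmod (heat_value n z) \<le> ((B + K) / c1) * \<eta> ^ n * real n"
    proof -
      have "c n * cmod (heat_value n z) \<le> B * \<eta> ^ n + K * m ^ n"
        using AB'(2)[of n] main[of n] norm_triangle_ineq2[of "\<i> * (of_real (c n) * heat_value n z)" "Mid n"] elim
        unfolding cm[symmetric] by simp
      also have "\<dots> \<le> B * \<eta> ^ n + K * \<eta> ^ n" using K m by (intro add_left_mono mult_left_mono power_mono) auto
      finally have "c n * cmod (heat_value n z) \<le> (B + K) * \<eta> ^ n" by (simp add: algebra_simps)
      then have "cmod (heat_value n z) \<le> (B + K) * \<eta> ^ n * (sqrt (real n) / c1)"
        unfolding cn using s c1 by (simp add: field_simps)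
      also have "\<dots> \<le> (B + K) * \<eta> ^ n * (real n / c1)"
        using s c1 AB(2) K \<eta> by (intro mult_left_mono divide_right_mono) auto
      finally show ?thesis by simp
    qed
    ultimately show ?case by blast
  qed
  show "(\<lambda>n. ln (cmod (heat_value n z)) / real n) \<longlonglongrightarrow> ln (pass_level z)"
    using ln_over_n_tendsto[OF \<eta> _ _ ev] AB K c1 by (simp add: \<eta>_def)
  show "eventually (\<lambda>n. heat_value n z \<noteq> 0) sequentially"
    using ev eventually_gt_at_top[of 0]
  proof eventually_elim
    case (elim n)
    have "(A / 2 / c1) * \<eta> ^ n / real n > 0" using AB(1) c1 \<eta> elim by simp
    then show ?case using elim by auto
  qed
qed

end

section \<open>Jensen's formula in a conformal chart\<close>

lemma circle_mean_holomorphic: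
  assumes f: "f holomorphic_on ball c R" and r: "0 < r" "r < R"
  shows "((\<lambda>t. f (c + of_real r * cis t)) has_integral of_real (2 * pi) * f c) {0..2 * pi}"
proof -
  have sub: "cball c r \<subseteq> ball c R" using r by auto
  have "((\<lambda>u. f u / (u - c)) has_contour_integral (2 * of_real pi * \<i> * f c)) (circlepath c r)"
  proof (rule Cauchy_integral_circlepath)
    show "continuous_on (cball c r) f"
      using holomorphic_on_subset[OF f sub] by (rule holomorphic_on_imp_continuous_on)
    show "f holomorphic_on ball c r" by (rule holomorphic_on_subset[OF f]) (use r in auto)
  qed (use r in auto)
  then have "((\<lambda>t. f (c + r * cis t) / (c + r * cis t - c) * r * \<i> * cis t) has_integral 2 * of_real pi * \<i> * f c) {0..2 * pi}"
    unfolding circlepath_def by (subst (asm) has_contour_integral_part_circlepath_iff) auto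
  moreover have "f (c + r * cis t) / (c + r * cis t - c) * r * \<i> * cis t = \<i> * f (c + r * cis t)" for t
    using r cis_neq_zero[of t] by (simp add: field_simps)
  ultimately have "((\<lambda>t. \<i> * f (c + r * cis t)) has_integral 2 * of_real pi * \<i> * f c) {0..2 * pi}" by (simp only:)
  then have "((\<lambda>t. - \<i> * (\<i> * f (c + r * cis t))) has_integral - \<i> * (2 * of_real pi * \<i> * f c)) {0..2 * pi}"
    by (rule has_integral_mult_right)
  moreover have "- \<i> * (\<i> * x) = x" "- \<i> * (2 * of_real pi * \<i> * x) = of_real (2 * pi) * x" for x
    by (simp_all add: complex_eq_iff)
  ultimately show ?thesis by (simp only:)
qed

lemma circle_mean_Re:
  assumes f: "f holomorphic_on ball c R" and r: "0 < r" "r < R"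
  shows "((\<lambda>t. Re (f (c + of_real r * cis t))) has_integral 2 * pi * Re (f c)) {0..2 * pi}"
  using has_integral_linear[OF circle_mean_holomorphic[OF assms] bounded_linear_Re] by (simp add: o_def)

lemma circle_mean_ln_cmod:
  assumes H: "H holomorphic_on ball c R" and nz: "\<And>u. u \<in> ball c R \<Longrightarrow> H u \<noteq> 0" and r: "0 < r" "r < R"
  shows "((\<lambda>t. ln (cmod (H (c + of_real r * cis t)))) has_integral 2 * pi * ln (cmod (H c))) {0..2 * pi}"
proof -
  obtain L where L: "L holomorphic_on ball c R" "\<And>u. u \<in> ball c R \<Longrightarrow> H u = exp (L u)"
    using contractible_imp_holomorphic_log[OF H convex_imp_contractible[OF convex_ball] nz] by metis
  have ln: "ln (cmod (H u)) = Re (L u)" if "u \<in> ball c R" for u using L(2)[OF that] by simp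
  have "((\<lambda>t. Re (L (c + of_real r * cis t))) has_integral 2 * pi * ln (cmod (H c))) {0..2 * pi}"
    using circle_mean_Re[OF L(1) r] ln[of c] r by simp
  then show ?thesis
    by (rule has_integral_eq[rotated]) (use r in \<open>simp add: ln dist_norm norm_mult\<close>)
qed

text \<open>For w outside the circle the function is harmonic in the disc. For w inside, reflection
  in the circle replaces c + r e^(it) - w by r - conj(b) e^(it), which has the same modulus and no
  zero in a disc of radius larger than 1.\<close>

lemma circle_mean_ln_dist:
  assumes r: "0 < r" and w: "cmod (w - c) \<noteq> r"
  shows "((\<lambda>t. ln (cmod (c + of_real r * cis t - w))) has_integral 2 * pi * ln (max r (cmod (w - c)))) {0..2 * pi}"
proof (cases "r < cmod (w - c)")
  case True
  have "((\<lambda>t. ln (cmod (c + of_real r * cis t - w))) has_integral 2 * pi * ln (cmod (c - w))) {0..2 * pi}"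
    by (rule circle_mean_ln_cmod[of "\<lambda>u. u - w" c "cmod (w - c)"])
       (use True r in \<open>auto intro!: holomorphic_intros simp: dist_norm norm_minus_commute\<close>)
  then show ?thesis using True by (simp add: max_def norm_minus_commute)
next
  case False
  then have lt: "cmod (w - c) < r" using w by simp
  define b where "b = w - c"
  \<comment> \<open>The zero of r - conj(b) v has modulus r/|b|; for b = 0 there is none, and 2 is
    an arbitrary radius above 1.\<close>
  define R where "R = (if b = 0 then 2 else r / cmod b)"
  have R: "1 < R" using lt by (auto simp: R_def b_def)
  have "((\<lambda>t. ln (cmod (of_real r - cnj b * (0 + of_real 1 * cis t)))) has_integral 2 * pi * ln (cmod (of_real r - cnj b * 0))) {0..2 * pi}"
  proof (rule circle_mean_ln_cmod[of _ 0 R])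
    fix v :: complex assume v: "v \<in> ball 0 R"
    have "cmod (cnj b * v) < r"
    proof (cases "b = 0")
      case False
      then have "cmod v < r / cmod b" using v by (simp add: R_def)
      then show ?thesis using False by (simp add: norm_mult field_simps)
    qed (use r in auto)
    then have "cnj b * v \<noteq> of_real r" using r by (metis norm_of_real abs_of_pos order_less_irrefl)
    then show "of_real r - cnj b * v \<noteq> 0" by simp
  qed (use R in \<open>auto intro!: holomorphic_intros\<close>)
  moreover have "cmod (of_real r - cnj b * (0 + of_real 1 * cis t)) = cmod (c + of_real r * cis t - w)" for t
  proof -
    have "of_real r * cis t - b = cis t * cnj (of_real r - cnj b * cis t)"
      by (simp add: algebra_simps cis_mult cis_cnj)
    then have "cmod (of_real r * cis t - b) = cmod (of_real r - cnj b * cis t)"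
      by (simp only: norm_mult norm_cis complex_mod_cnj mult_1)
    then show ?thesis by (simp add: b_def algebra_simps)
  qed
  ultimately show ?thesis using lt r by (simp add: max_def)
qed

text \<open>Injectivity keeps the difference quotient \<open>H\<close> free of zeros, so the
  logarithm splits into a harmonic part and the logarithm of a distance, whose mean is
  known.\<close>

lemma circle_mean_ln_compose:
  assumes \<kappa>: "\<kappa> holomorphic_on ball c R" "inj_on \<kappa> (ball c R)" and r: "0 < r" "r < R"
    and w': "w' \<in> ball c R" "cmod (w' - c) \<noteq> r"
    and H: "H = (\<lambda>u. if u = w' then deriv \<kappa> w' else (\<kappa> u - \<kappa> w') / (u - w'))"
  shows "((\<lambda>t. ln (cmod (\<kappa> (c + of_real r * cis t) - \<kappa> w'))) has_integral
     2 * pi * (ln (cmod (H c)) + ln (max r (cmod (w' - c))))) {0..2 * pi}"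
proof -
  have Hh: "H holomorphic_on ball c R" unfolding H using \<kappa>(1) w'(1) by (intro pole_lemma) (auto simp: interior_open)
  have Hn: "H u \<noteq> 0" if "u \<in> ball c R" for u
    using holomorphic_injective_imp_regular[OF \<kappa>(1) open_ball \<kappa>(2) w'(1)] inj_onD[OF \<kappa>(2) _ that w'(1)]
    by (auto simp: H)
  have "((\<lambda>t. ln (cmod (H (c + of_real r * cis t))) + ln (cmod (c + of_real r * cis t - w'))) has_integral
     2 * pi * ln (cmod (H c)) + 2 * pi * ln (max r (cmod (w' - c)))) {0..2 * pi}"
    by (intro has_integral_add circle_mean_ln_cmod[OF Hh Hn r] circle_mean_ln_dist r w')
  moreover have "ln (cmod (H (c + of_real r * cis t))) + ln (cmod (c + of_real r * cis t - w')) = ln (cmod (\<kappa> (c + of_real r * cis t) - \<kappa> w'))" for t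
  proof -
    let ?u = "c + of_real r * cis t"
    have "cmod (?u - c) = r" using r by (simp add: norm_mult)
    then have ne: "?u \<noteq> w'" using w'(2) by auto
    have u: "?u \<in> ball c R" using r by (simp add: dist_norm norm_mult)
    have "\<kappa> ?u - \<kappa> w' = H ?u * (?u - w')" using ne by (simp add: H)
    then have "ln (cmod (\<kappa> ?u - \<kappa> w')) = ln (cmod (H ?u) * cmod (?u - w'))" by (simp only: norm_mult)
    also have "\<dots> = ln (cmod (H ?u)) + ln (cmod (?u - w'))" using Hn[OF u] ne by (simp add: ln_mult)
    finally show ?thesis by simp
  qed
  ultimately show ?thesis by (simp add: distrib_left)
qed

text \<open>As a function of \<open>w\<close> this is the difference of the means of ln|\<kappa> -
  w| over two concentric circles. It is a plateau of height ln(r2/r1) that decays continuously to 0,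
  hence admissible for weak convergence, which a single mean of logarithms is not.\<close>

definition jensen_kernel :: "(complex \<Rightarrow> complex) \<Rightarrow> complex \<Rightarrow> real \<Rightarrow> real \<Rightarrow> real \<Rightarrow> complex \<Rightarrow> real" where
  "jensen_kernel \<kappa> c R r1 r2 w =
     (if w \<in> \<kappa> ` ball c R then ln (max r2 (cmod (inv_into (ball c R) \<kappa> w - c))) - ln (max r1 (cmod (inv_into (ball c R) \<kappa> w - c)))
      else 0)"

text \<open>The harmonic part contributes \<open>ln (cmod (H c))\<close> for either radius and
  cancels in the difference.\<close>

lemma jensen_formula:
  assumes \<kappa>: "\<kappa> holomorphic_on ball c R" "inj_on \<kappa> (ball c R)" and r: "0 < r1" "r1 < r2" "r2 < R"
    and w: "\<And>w'. w' \<in> ball c R \<Longrightarrow> \<kappa> w' = w \<Longrightarrow> cmod (w' - c) \<noteq> r1 \<and> cmod (w' - c) \<noteq> r2"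
  shows "((\<lambda>t. ln (cmod (\<kappa> (c + of_real r2 * cis t) - w)) - ln (cmod (\<kappa> (c + of_real r1 * cis t) - w)))
     has_integral 2 * pi * jensen_kernel \<kappa> c R r1 r2 w) {0..2 * pi}"
proof (cases "w \<in> \<kappa> ` ball c R")
  case True
  then obtain w' where w': "w' \<in> ball c R" "w = \<kappa> w'" by auto
  have inv: "inv_into (ball c R) \<kappa> w = w'" using w' \<kappa>(2) by simp
  show ?thesis unfolding jensen_kernel_def inv using True
    has_integral_diff[OF circle_mean_ln_compose[OF \<kappa> _ _ w'(1) _ refl, of r2] circle_mean_ln_compose[OF \<kappa> _ _ w'(1) _ refl, of r1]]
      w[OF w'(1)] w' r by (simp add: right_diff_distrib distrib_left)
next
  case False
  have h: "(\<lambda>u. \<kappa> u - w) holomorphic_on ball c R" by (intro holomorphic_intros \<kappa>)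
  have n: "\<kappa> u - w \<noteq> 0" if "u \<in> ball c R" for u using False that by auto
  show ?thesis unfolding jensen_kernel_def
    using False has_integral_diff[OF circle_mean_ln_cmod[OF h n, of r2] circle_mean_ln_cmod[OF h n, of r1]] r by simp
qed

text \<open>Together these bracket the kernel between ln(r2/r1) times the indicators of the images
  of the two discs, which is how it measures mass.\<close>

lemma jensen_kernel_properties:
  assumes \<kappa>: "\<kappa> holomorphic_on ball c R" "inj_on \<kappa> (ball c R)" and r: "0 < r1" "r1 < r2" "r2 < R"
  defines "\<psi> \<equiv> jensen_kernel \<kappa> c R r1 r2"
  shows "continuous_on UNIV \<psi>" "\<And>w. 0 \<le> \<psi> w" "\<And>w. \<psi> w \<le> ln (r2 / r1)"
    "\<And>w. w \<in> \<kappa> ` ball c r1 \<Longrightarrow> \<psi> w = ln (r2 / r1)" "\<And>w. w \<notin> \<kappa> ` ball c r2 \<Longrightarrow> \<psi> w = 0"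
proof -
  let ?i = "inv_into (ball c R) \<kappa>"
  have cont: "continuous_on (ball c R) \<kappa>" using \<kappa>(1) by (rule holomorphic_on_imp_continuous_on)
  have opn: "open (\<kappa> ` ball c R)" using cont \<kappa>(2) by (intro invariance_of_domain) auto
  have ci: "continuous_on (\<kappa> ` ball c R) ?i"
  proof -
    obtain g where g: "homeomorphism (ball c R) (\<kappa> ` ball c R) \<kappa> g"
      using invariance_of_domain_homeomorphism[OF open_ball cont _ \<kappa>(2)] by auto
    show ?thesis by (rule continuous_on_eq[of _ g]) (use g \<kappa>(2) in \<open>auto simp: homeomorphism_def\<close>)
  qed
  have inv: "?i (\<kappa> u) = u" if "u \<in> ball c R" for u using that \<kappa>(2) by simp
  have zero: "\<psi> w = 0" if "w \<notin> \<kappa> ` ball c r2" for w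
  proof (cases "w \<in> \<kappa> ` ball c R")
    case True
    then obtain u where u: "u \<in> ball c R" "w = \<kappa> u" by auto
    then have "u \<notin> ball c r2" using that by auto
    then have "cmod (u - c) \<ge> r2" by (simp add: dist_norm norm_minus_commute)
    then show ?thesis using u inv r by (simp add: \<psi>_def jensen_kernel_def)
  qed (simp add: \<psi>_def jensen_kernel_def)
  show "\<And>w. w \<notin> \<kappa> ` ball c r2 \<Longrightarrow> \<psi> w = 0" by (rule zero)
  show "\<psi> w \<ge> 0" for w unfolding \<psi>_def jensen_kernel_def using r by auto
  show "\<psi> w \<le> ln (r2 / r1)" for w
  proof -
    have "ln (max r2 x) - ln (max r1 x) \<le> ln (r2 / r1)" for x :: real
    proof -
      have "ln (max r2 x / max r1 x) \<le> ln (r2 / r1)"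
        using r by (subst ln_le_cancel_iff) (auto simp: max_def field_simps)
      then show ?thesis using r by (simp add: ln_div max_def split: if_splits)
    qed
    moreover have "ln (r2 / r1) \<ge> 0" using r by (intro ln_ge_zero) (simp add: field_simps)
    ultimately show ?thesis unfolding \<psi>_def jensen_kernel_def by auto
  qed
  show "\<psi> w = ln (r2 / r1)" if w: "w \<in> \<kappa> ` ball c r1" for w
  proof -
    obtain u where u: "u \<in> ball c r1" "w = \<kappa> u" using w by blast
    then have uR: "u \<in> ball c R" using r by auto
    have "cmod (u - c) < r1" using u by (simp add: dist_norm norm_minus_commute)
    then show ?thesis using u(2) uR inv[OF uR] r by (simp add: \<psi>_def jensen_kernel_def ln_div)
  qed
  have "continuous_on (\<kappa> ` ball c R) (\<lambda>w. ln (max r2 (cmod (?i w - c))) - ln (max r1 (cmod (?i w - c))))"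
    using r by (intro continuous_intros ci) (auto simp: max_def)
  then have c1: "continuous_on (\<kappa> ` ball c R) \<psi>"
    by (rule continuous_on_eq) (simp add: \<psi>_def jensen_kernel_def)
  have "compact (\<kappa> ` cball c r2)"
    by (intro compact_continuous_image continuous_on_subset[OF cont]) (use r in auto)
  then have op2: "open (- \<kappa> ` cball c r2)" using compact_imp_closed open_Compl by blast
  have c2: "continuous_on (- \<kappa> ` cball c r2) \<psi>"
    by (rule continuous_on_eq[of _ "\<lambda>_. 0"]) (auto simp: zero image_iff)
  have "continuous_on (\<kappa> ` ball c R \<union> - \<kappa> ` cball c r2) \<psi>"
    using opn op2 c1 c2 by (rule continuous_on_open_Un)
  moreover have "\<kappa> ` ball c R \<union> - \<kappa> ` cball c r2 = UNIV" using r by force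
  ultimately show "continuous_on UNIV \<psi>" by simp
qed

section \<open>Uniform integrability of logarithms on circles\<close>

lemma vitali_L2_convergence:
  fixes f :: "nat \<Rightarrow> real \<Rightarrow> real"
  assumes ab: "a \<le> b" and cf: "\<And>n. continuous_on {a..b} (f n)" and cg: "continuous_on {a..b} g" and N: "finite N"
    and lim: "\<And>x. x \<in> {a..b} - N \<Longrightarrow> (\<lambda>n. f n x) \<longlonglongrightarrow> g x"
    and bound: "\<And>n. integral {a..b} (\<lambda>x. (f n x)\<^sup>2) \<le> C"
  shows "(\<lambda>n. integral {a..b} (f n)) \<longlonglongrightarrow> integral {a..b} g"
proof (rule LIMSEQ_I)
  fix e :: real assume e: "e > 0"
  have "bounded (g ` {a..b})" using compact_continuous_image[OF cg] compact_imp_bounded by blast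
  then obtain K0 where K0: "\<And>x. x \<in> {a..b} \<Longrightarrow> \<bar>g x\<bar> \<le> K0" by (force simp: bounded_iff)
  \<comment> \<open>\<open>K0\<close> leaves \<open>g\<close> unchanged by the truncation, and the
    last entry makes the truncation error |C|/K smaller than e/2, uniformly in n.\<close>
  define K where "K = max 1 (max K0 (2 * \<bar>C\<bar> / e + 1))"
  have K: "K > 0" "K \<ge> K0" "\<bar>C\<bar> / K < e / 2"
  proof -
    show "K > 0" "K \<ge> K0" by (auto simp: K_def)
    have "2 * \<bar>C\<bar> / e < K" by (auto simp: K_def)
    then show "\<bar>C\<bar> / K < e / 2" using e \<open>K > 0\<close> by (simp add: field_simps)
  qed
  define T where "T x = max (-K) (min K x)" for x
  have Tb: "\<bar>T x\<bar> \<le> K" for x using K by (auto simp: T_def)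
  \<comment> \<open>Truncation changes x only where |x| > K, and there |x| \<le> x^2/K, so a bound
    on the integral of the squares controls the loss.\<close>
  have Td: "\<bar>x - T x\<bar> \<le> x\<^sup>2 / K" for x
  proof (cases "\<bar>x\<bar> \<le> K")
    case True then show ?thesis using K by (auto simp: T_def)
  next
    case False
    then have le: "\<bar>x - T x\<bar> \<le> \<bar>x\<bar>" using K by (auto simp: T_def)
    have "\<bar>x\<bar> * K \<le> \<bar>x\<bar> * \<bar>x\<bar>" by (intro mult_left_mono) (use False in auto)
    then have "\<bar>x\<bar> \<le> x\<^sup>2 / K" using K by (simp add: pos_le_divide_eq power2_eq_square)
    then show ?thesis using le by linarith
  qed
  have cT: "continuous_on S T" for S unfolding T_def by (intro continuous_intros)
  have cTf: "continuous_on {a..b} (\<lambda>x. T (f n x))" for n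
    by (rule continuous_on_compose2[OF cT[of UNIV] cf]) auto
  have neg: "negligible N" using N by (rule negligible_finite)
  have Tg: "T (g x) = g x" if "x \<in> {a..b}" for x using K0[OF that] K by (auto simp: T_def)
  have "(\<lambda>n. integral {a..b} (\<lambda>x. if x \<in> N then 0 else T (f n x))) \<longlonglongrightarrow> integral {a..b} (\<lambda>x. if x \<in> N then 0 else g x)"
  proof (rule dominated_convergence(2)[where h = "\<lambda>_. K"])
    fix n
    show "(\<lambda>x. if x \<in> N then 0 else T (f n x)) integrable_on {a..b}"
      by (rule integrable_spike[OF integrable_continuous_real[OF cTf] neg]) auto
  next
    fix x assume x: "x \<in> {a..b}"
    show "(\<lambda>n. if x \<in> N then 0 else T (f n x)) \<longlonglongrightarrow> (if x \<in> N then 0 else g x)"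
    proof (cases "x \<in> N")
      case False
      then have "(\<lambda>n. T (f n x)) \<longlonglongrightarrow> T (g x)"
        using lim x cT[of UNIV] by (intro isCont_tendsto_compose[of _ T]) (auto simp: continuous_on_eq_continuous_at)
      then show ?thesis using False Tg[OF x] by simp
    qed simp
  qed (use Tb K in auto)
  moreover have "integral {a..b} (\<lambda>x. if x \<in> N then 0 else T (f n x)) = integral {a..b} (\<lambda>x. T (f n x))" for n
    by (rule integral_spike[OF neg]) auto
  moreover have "integral {a..b} (\<lambda>x. if x \<in> N then 0 else g x) = integral {a..b} g"
    by (rule integral_spike[OF neg]) auto
  ultimately have "(\<lambda>n. integral {a..b} (\<lambda>x. T (f n x))) \<longlonglongrightarrow> integral {a..b} g" by simp
  then obtain n0 where n0: "\<And>n. n \<ge> n0 \<Longrightarrow> norm (integral {a..b} (\<lambda>x. T (f n x)) - integral {a..b} g) < e / 2"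
    using LIMSEQ_D e half_gt_zero by metis
  have trunc: "norm (integral {a..b} (f n) - integral {a..b} (\<lambda>x. T (f n x))) \<le> \<bar>C\<bar> / K" for n
  proof -
    have i: "f n integrable_on {a..b}" "(\<lambda>x. T (f n x)) integrable_on {a..b}"
      by (intro integrable_continuous_real cf cTf)+
    have "integral {a..b} (f n) - integral {a..b} (\<lambda>x. T (f n x)) = integral {a..b} (\<lambda>x. f n x - T (f n x))"
      using i by (simp add: integral_diff)
    also have "norm \<dots> \<le> integral {a..b} (\<lambda>x. (f n x)\<^sup>2 / K)"
      by (rule integral_norm_bound_integral)
         (use Td in \<open>auto intro!: integrable_continuous_real continuous_intros cf cTf K simp: K less_imp_neq[OF K(1), symmetric]\<close>)
    also have "\<dots> = integral {a..b} (\<lambda>x. (f n x)\<^sup>2) / K" by simp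
    also have "\<dots> \<le> \<bar>C\<bar> / K" using bound[of n] K by (intro divide_right_mono) auto
    finally show ?thesis .
  qed
  show "\<exists>n0. \<forall>n\<ge>n0. norm (integral {a..b} (f n) - integral {a..b} g) < e"
  proof (intro exI[of _ n0] allI impI)
    fix n assume "n \<ge> n0"
    then show "norm (integral {a..b} (f n) - integral {a..b} g) < e"
      using n0[of n] trunc[of n] K(3) by (smt (verit) field_sum_of_halves real_norm_def)
  qed
qed

text \<open>The fourth root is chosen so that its square, with x inversely proportional to a
  distance, has a singularity that is integrable along a curve. The factor 4 comes from ln((1 +
  y)^4) \<le> 4y.\<close>

lemma ln_one_plus_le: "ln (1 + x) \<le> 4 * sqrt (sqrt x)" if "x \<ge> 0" for x :: real
proof -
  define y where "y = sqrt (sqrt x)"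
  have y0: "y \<ge> 0" using that by (simp add: y_def)
  have "y ^ 4 = (y\<^sup>2)\<^sup>2" by (simp flip: power_mult)
  then have y: "y \<ge> 0" "y ^ 4 = x" using that y0 by (simp_all add: y_def)
  have "1 + y ^ 4 \<le> (1 + y) ^ 4"
    using y(1) by (simp add: power4_eq_xxxx algebra_simps)
  then have "1 + x \<le> (1 + y) ^ 4" by (simp only: y(2))
  then have "ln (1 + x) \<le> ln ((1 + y) ^ 4)" using that by (intro ln_mono) auto
  also have "\<dots> = 4 * ln (1 + y)" using y by (simp add: ln_realpow)
  also have "\<dots> \<le> 4 * y" using ln_add_one_self_le_self[OF y(1)] by simp
  finally show ?thesis by (simp add: y_def)
qed

text \<open>Each modulus exceeds the other by at most L, so the logarithm of the ratio is at most
  ln(1 + L/|z1|) in one direction and ln(1 + L/|z2|) in the other. Squaring leaves inverse square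
  roots of the moduli.\<close>

lemma ln_quotient_square_bound:
  fixes z1 z2 :: complex
  assumes z: "z1 \<noteq> 0" "z2 \<noteq> 0" and L: "cmod (z1 - z2) \<le> L"
  shows "(ln (cmod z2) - ln (cmod z1))\<^sup>2 \<le> 16 * sqrt L * (1 / sqrt (cmod z1) + 1 / sqrt (cmod z2))"
proof -
  have *: "ln (cmod y) - ln (cmod x) \<le> 4 * sqrt (sqrt (L / cmod x))" if "x \<noteq> 0" "y \<noteq> 0" "cmod (x - y) \<le> L" for x y :: complex
  proof -
    have L0: "L \<ge> 0" using that(3) norm_ge_zero order.trans by blast
    have "cmod y \<le> cmod x + L" using that norm_triangle_ineq2[of y x] by (simp add: norm_minus_commute)
    then have "cmod y / cmod x \<le> 1 + L / cmod x" using that by (simp add: field_simps)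
    then have "ln (cmod y / cmod x) \<le> ln (1 + L / cmod x)" using that L0 by (subst ln_le_cancel_iff) (auto simp: add_pos_nonneg)
    also have "\<dots> \<le> 4 * sqrt (sqrt (L / cmod x))" using L0 by (intro ln_one_plus_le) auto
    finally show ?thesis using that by (simp add: ln_div)
  qed
  have L0: "L \<ge> 0" using L norm_ge_zero order.trans by blast
  define A where "A = 4 * sqrt (sqrt (L / cmod z1))"
  define B where "B = 4 * sqrt (sqrt (L / cmod z2))"
  have AB: "A \<ge> 0" "B \<ge> 0" using L0 by (auto simp: A_def B_def)
  have "\<bar>ln (cmod z2) - ln (cmod z1)\<bar> \<le> max A B"
    using *[OF z L] *[OF z(2,1)] L by (auto simp: A_def B_def norm_minus_commute)
  then have "(ln (cmod z2) - ln (cmod z1))\<^sup>2 \<le> (max A B)\<^sup>2" using AB by (intro power2_le_iff_abs_le[THEN iffD2]) auto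
  also have "\<dots> \<le> A\<^sup>2 + B\<^sup>2" using AB by (auto simp: max_def)
  also have "A\<^sup>2 = 16 * sqrt L * (1 / sqrt (cmod z1))" using L0 by (simp add: A_def power_mult_distrib real_sqrt_divide power_divide)
  also have "B\<^sup>2 = 16 * sqrt L * (1 / sqrt (cmod z2))" using L0 by (simp add: B_def power_mult_distrib real_sqrt_divide power_divide)
  finally show ?thesis by (simp add: algebra_simps)
qed

text \<open>A weak form of Jordan's inequality sin x \<ge> 2x/\<pi>.\<close>

lemma sin_ge_half: "x / 2 \<le> sin x" if "0 \<le> x" "x \<le> pi / 2" for x :: real
\<comment> \<open>Up to \<pi>/3 the cosine is at least 1/2. Beyond it, sin x \<ge> sqrt(3)/2 \<ge>
  17/20, which exceeds \<pi>/4.\<close>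
proof (cases "x \<le> pi / 3")
  case True
  have "\<exists>z. 0 \<le> z \<and> z \<le> x \<and> sin x - sin 0 = (x - 0) * cos z"
  proof (cases "x = 0")
    case False
    then have "\<exists>z. 0 < z \<and> z < x \<and> sin x - sin 0 = (x - 0) * cos z"
      using that by (intro MVT2) (auto intro!: derivative_eq_intros)
    then show ?thesis by (metis less_imp_le)
  qed auto
  then obtain z where z: "0 \<le> z" "z \<le> x" "sin x = x * cos z" by auto
  have "cos (pi / 3) \<le> cos z" using z True by (intro cos_monotone_0_pi_le) auto
  then have "1 / 2 \<le> cos z" by (simp add: cos_60)
  then have "x * (1 / 2) \<le> x * cos z" using that by (intro mult_left_mono) auto
  then show ?thesis using z by simp
next
  case False
  have "sin (pi / 3) \<le> sin x" using False that by (intro sin_monotone_2pi_le) auto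
  moreover have "sqrt 3 / 2 \<ge> 17 / 20" using real_le_rsqrt[of "17/10" 3] by (simp add: power2_eq_square)
  moreover have "x / 2 \<le> 17 / 20" using that pi_less_4 pi_approx by simp
  ultimately show ?thesis by (simp add: sin_60)
qed

text \<open>The chord has length 2 sin(|s - t|/2); the minimum accounts for differences near 2\<pi>,
  where the two points are close again.\<close>

lemma cmod_cis_diff_ge:
  assumes "\<bar>s - t\<bar> \<le> 2 * pi"
  shows "min \<bar>s - t\<bar> (2 * pi - \<bar>s - t\<bar>) / 2 \<le> cmod (cis s - cis t)"
proof -
  define x where "x = \<bar>s - t\<bar> / 2"
  have x: "0 \<le> x" "x \<le> pi" using assms by (auto simp: x_def)
  have "(cmod (cis s - cis t))\<^sup>2 = 2 - 2 * cos (s - t)"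
  proof -
    have "(cmod (cis s - cis t))\<^sup>2 = (cos s - cos t)\<^sup>2 + (sin s - sin t)\<^sup>2" by (simp add: cmod_power2)
    also have "\<dots> = ((cos s)\<^sup>2 + (sin s)\<^sup>2) + ((cos t)\<^sup>2 + (sin t)\<^sup>2) - 2 * (cos s * cos t + sin s * sin t)"
      by (simp add: power2_eq_square algebra_simps)
    finally show ?thesis by (simp add: cos_diff)
  qed
  also have "cos (s - t) = cos (2 * x)" by (simp add: x_def abs_if) (metis cos_minus minus_diff_eq)
  also have "2 - 2 * cos (2 * x) = (2 * sin x)\<^sup>2" by (simp add: cos_double_sin power_mult_distrib)
  finally have "cmod (cis s - cis t) = 2 * sin x"
    using x by (intro power2_eq_imp_eq[of "cmod (cis s - cis t)"]) (auto intro: sin_ge_zero)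
  moreover have "min x (pi - x) / 2 \<le> sin x"
  proof (cases "x \<le> pi / 2")
    case True then show ?thesis using sin_ge_half[of x] x by (auto simp: min_def)
  next
    case False
    then show ?thesis using sin_ge_half[of "pi - x"] x by (auto simp: min_def)
  qed
  ultimately show ?thesis by (auto simp: x_def min_def)
qed

text \<open>The factor \<open>sgn x\<close> joins the antiderivatives on the two half-lines
  continuously, so that the fundamental theorem applies across the singularity.\<close>

lemma has_vector_derivative_sgn_sqrt:
  fixes x :: real
  assumes "x \<noteq> 0"
  shows "((\<lambda>x. 2 * sgn x * sqrt \<bar>x\<bar>) has_vector_derivative 1 / sqrt \<bar>x\<bar>) (at x)"
proof (cases "x > 0")
  case True
  have "((\<lambda>x. 2 * sqrt x) has_vector_derivative 1 / sqrt \<bar>x\<bar>) (at x)"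
    unfolding has_real_derivative_iff_has_vector_derivative[symmetric]
    using True by (auto intro!: derivative_eq_intros simp: field_simps)
  then show ?thesis
    by (rule has_vector_derivative_transform_within_open[of _ _ _ "{0<..}"]) (use True in auto)
next
  case False
  have "((\<lambda>x. - 2 * sqrt (- x)) has_vector_derivative 1 / sqrt \<bar>x\<bar>) (at x)"
    unfolding has_real_derivative_iff_has_vector_derivative[symmetric]
    using False assms by (auto intro!: derivative_eq_intros simp: field_simps)
  then show ?thesis
    by (rule has_vector_derivative_transform_within_open[of _ _ _ "{..<0}"]) (use False assms in auto)
qed

lemma continuous_on_sgn_sqrt: "continuous_on S (\<lambda>x::real. 2 * sgn x * sqrt \<bar>x\<bar>)"
proof -
  have "(\<lambda>x::real. 2 * sgn x * sqrt \<bar>x\<bar>) = (\<lambda>x. 2 * sqrt (max x 0) - 2 * sqrt (max (-x) 0))"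
    by (auto simp: sgn_if max_def)
  then show ?thesis by (simp only:) (intro continuous_intros)
qed

text \<open>Near t0 the majorant is an inverse square root. Its shifts by \<plusminus>2\<pi> cover
  the return of the circle to t0 at either end of the interval. The constant is not meant to be
  sharp.\<close>

lemma circle_inverse_sqrt_integral:
  fixes g :: "real \<Rightarrow> real"
  assumes t0: "t0 \<in> {0..2 * pi}" and g: "continuous_on {0..2 * pi} g" and k: "k \<ge> 0"
    and le: "\<And>t. t \<in> {0..2 * pi} \<Longrightarrow> cis t \<noteq> cis t0 \<Longrightarrow> g t \<le> k / sqrt (cmod (cis t - cis t0))"
  shows "integral {0..2 * pi} g \<le> 24 * k * sqrt (8 * pi)"
proof -
  define E where "E x = 2 * sgn x * sqrt \<bar>x\<bar>" for x :: real
  define D where "D x = 1 / sqrt \<bar>x\<bar>" for x :: real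
  define F where "F t = 2 * k * (E (t - t0) + E (t - t0 - 2 * pi) + E (t - t0 + 2 * pi))" for t
  define N where "N = {t0, t0 + 2 * pi, t0 - 2 * pi}"
  \<comment> \<open>At a singular point one of the terms \<open>D\<close> has the default value 1/0
    = 0, so \<open>h\<close> is set equal to \<open>g\<close> there to keep it a majorant.\<close>
  define h where "h t = (if t \<in> N then g t else 2 * k * (D (t - t0) + D (t - t0 - 2 * pi) + D (t - t0 + 2 * pi)))" for t
  have Eb: "\<bar>E x\<bar> \<le> 2 * sqrt (4 * pi)" if "\<bar>x\<bar> \<le> 4 * pi" for x
  proof -
    have "\<bar>E x\<bar> \<le> 2 * sqrt \<bar>x\<bar>" by (auto simp: E_def abs_mult sgn_if)
    also have "\<dots> \<le> 2 * sqrt (4 * pi)" using that by simp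
    finally show ?thesis .
  qed
  have dE: "((\<lambda>t. E (t + b)) has_vector_derivative D (t + b)) (at t)" if "t + b \<noteq> 0" for t b
  proof -
    have "(E has_real_derivative D (t + b)) (at (t + b))"
      using has_vector_derivative_sgn_sqrt[OF that] unfolding has_real_derivative_iff_has_vector_derivative E_def[abs_def] D_def .
    then have "((\<lambda>t. E (t + b)) has_real_derivative D (t + b) * 1) (at t)"
      by (rule DERIV_chain2) (auto intro!: derivative_eq_intros)
    then show ?thesis by (simp add: has_real_derivative_iff_has_vector_derivative)
  qed
  have "(h has_integral F (2 * pi) - F 0) {0..2 * pi}"
  proof (rule fundamental_theorem_of_calculus_interior_strong[of N])
    fix t assume t: "t \<in> {0<..<2 * pi} - N"
    have "((\<lambda>t. 2 * k * (E (t + (- t0)) + E (t + (- t0 - 2 * pi)) + E (t + (- t0 + 2 * pi)))) has_vector_derivative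
        2 * k * (D (t + (- t0)) + D (t + (- t0 - 2 * pi)) + D (t + (- t0 + 2 * pi)))) (at t)"
      by (intro has_vector_derivative_mult_right has_vector_derivative_add dE) (use t in \<open>auto simp: N_def\<close>)
    then show "(F has_vector_derivative h t) (at t)" using t unfolding F_def[abs_def] h_def by (simp add: algebra_simps)
  next
    have cE: "continuous_on {0..2 * pi} (\<lambda>t. E (t + b))" for b
    proof -
      have "continuous_on {0..2 * pi} (\<lambda>t. t + b)" by (intro continuous_intros)
      from continuous_on_compose[OF this, of E] show ?thesis
        using continuous_on_sgn_sqrt unfolding E_def[abs_def] o_def by blast
    qed
    have "continuous_on {0..2 * pi} (\<lambda>t. 2 * k * (E (t + (- t0)) + E (t + (- t0 - 2 * pi)) + E (t + (- t0 + 2 * pi))))"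
      by (intro continuous_on_mult_left continuous_on_add cE)
    then show "continuous_on {0..2 * pi} F" unfolding F_def by (simp add: algebra_simps)
  qed (auto simp: N_def)
  moreover have "g t \<le> h t" if t: "t \<in> {0..2 * pi}" for t
  proof (cases "t \<in> N")
    case False
    define s where "s = \<bar>t - t0\<bar>"
    have s: "0 < s" "s < 2 * pi" using t t0 False by (auto simp: s_def N_def abs_if)
    have m: "min s (2 * pi - s) / 2 \<le> cmod (cis t - cis t0)"
      using cmod_cis_diff_ge[of t t0] s by (simp add: s_def)
    have mp: "min s (2 * pi - s) > 0" using s by auto
    then have "cis t \<noteq> cis t0" using m by auto
    then have "g t \<le> k / sqrt (cmod (cis t - cis t0))" using le[OF t] by simp
    also have "\<dots> \<le> k / sqrt (min s (2 * pi - s) / 2)"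
      using m mp k by (intro divide_left_mono mult_pos_pos) auto
    also have "\<dots> = k * sqrt 2 * (1 / sqrt (min s (2 * pi - s)))" by (simp add: real_sqrt_divide)
    also have "\<dots> \<le> k * 2 * (1 / sqrt (min s (2 * pi - s)))"
      using k mp real_sqrt_le_mono[of 2 4] by (intro mult_right_mono mult_left_mono) auto
    also have "\<dots> \<le> k * 2 * (1 / sqrt s + 1 / sqrt (2 * pi - s))"
      using s k by (intro mult_left_mono) (auto simp: min_def)
    also have "\<dots> \<le> 2 * k * (D (t - t0) + D (t - t0 - 2 * pi) + D (t - t0 + 2 * pi))"
    proof -
      have "1 / sqrt s = D (t - t0)" by (simp add: D_def s_def)
      moreover have "1 / sqrt (2 * pi - s) \<le> D (t - t0 - 2 * pi) + D (t - t0 + 2 * pi)"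
      proof (cases "t > t0")
        case True
        then have "D (t - t0 - 2 * pi) = 1 / sqrt (2 * pi - s)" using s by (simp add: D_def s_def)
        moreover have "D (t - t0 + 2 * pi) \<ge> 0" by (simp add: D_def)
        ultimately show ?thesis by simp
      next
        case False
        then have "2 * pi - s = t - t0 + 2 * pi" by (simp add: s_def)
        then have "D (t - t0 + 2 * pi) = 1 / sqrt (2 * pi - s)" using s by (simp add: D_def)
        moreover have "D (t - t0 - 2 * pi) \<ge> 0" by (simp add: D_def)
        ultimately show ?thesis by simp
      qed
      ultimately have "1 / sqrt s + 1 / sqrt (2 * pi - s) \<le> D (t - t0) + D (t - t0 - 2 * pi) + D (t - t0 + 2 * pi)" by simp
      then have "2 * k * (1 / sqrt s + 1 / sqrt (2 * pi - s)) \<le> 2 * k * (D (t - t0) + D (t - t0 - 2 * pi) + D (t - t0 + 2 * pi))"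
        using k by (intro mult_left_mono) auto
      then show ?thesis by (simp add: mult.commute)
    qed
    finally show ?thesis using False by (simp add: h_def)
  qed (simp add: h_def)
  ultimately have "integral {0..2 * pi} g \<le> F (2 * pi) - F 0"
    using integrable_continuous_real[OF g] by (intro has_integral_le[OF integrable_integral]) auto
  also have "\<dots> = 2 * k * ((E (2 * pi - t0) - E (- t0)) + (E (- t0) - E (- t0 - 2 * pi)) + (E (4 * pi - t0) - E (2 * pi - t0)))"
    by (simp add: F_def algebra_simps)
  also have "\<dots> = 2 * k * (E (4 * pi - t0) - E (- t0 - 2 * pi))" by simp
  also have "\<dots> \<le> 2 * k * (2 * sqrt (4 * pi) + 2 * sqrt (4 * pi))"
    using Eb[of "4 * pi - t0"] Eb[of "- t0 - 2 * pi"] t0 k by (intro mult_left_mono) auto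
  also have "\<dots> \<le> 24 * k * sqrt (8 * pi)"
  proof -
    have "sqrt (4 * pi) \<le> sqrt (8 * pi)" by simp
    then have "k * sqrt (4 * pi) \<le> k * sqrt (8 * pi)" using k by (intro mult_left_mono)
    moreover have "k * sqrt (8 * pi) \<ge> 0" using k by simp
    ultimately show ?thesis by simp
  qed
  finally show ?thesis .
qed

text \<open>For the point of the curve nearest to \<open>w\<close>, the triangle inequality gives
  |\<kappa>(t) - \<kappa>(t0)| \<le> 2 |\<kappa>(t) - w|, writing \<kappa>(t) for the point at angle
  t. Distances to \<open>w\<close> thus dominate chords, and the bound does not depend on
  \<open>w\<close>.\<close>

lemma curve_inverse_sqrt_integral:
  fixes \<kappa> :: "complex \<Rightarrow> complex"
  assumes \<kappa>: "continuous_on (ball c R) \<kappa>" and m: "m > 0" "\<And>x y. x \<in> ball c R \<Longrightarrow> y \<in> ball c R \<Longrightarrow> m * cmod (x - y) \<le> cmod (\<kappa> x - \<kappa> y)"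
    and r: "0 < r" "r < R" and w: "\<And>t. \<kappa> (c + of_real r * cis t) \<noteq> w"
  shows "integral {0..2 * pi} (\<lambda>t. 1 / sqrt (cmod (\<kappa> (c + of_real r * cis t) - w))) \<le> 24 * sqrt (2 / (m * r)) * sqrt (8 * pi)"
proof -
  let ?z = "\<lambda>t. \<kappa> (c + of_real r * cis t)"
  have inb: "c + of_real r * cis t \<in> ball c R" for t using r by (simp add: dist_norm norm_mult)
  have cz: "continuous_on {0..2 * pi} ?z"
    by (intro continuous_on_compose2[OF \<kappa>] continuous_intros) (use inb in auto)
  have cd: "continuous_on {0..2 * pi} (\<lambda>t. cmod (?z t - w))" by (intro continuous_intros cz)
  obtain t0 where t0: "t0 \<in> {0..2 * pi}" "\<And>t. t \<in> {0..2 * pi} \<Longrightarrow> cmod (?z t0 - w) \<le> cmod (?z t - w)"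
    using continuous_attains_inf[OF _ _ cd] by auto
  show ?thesis
  proof (rule circle_inverse_sqrt_integral[OF t0(1)])
    show "continuous_on {0..2 * pi} (\<lambda>t. 1 / sqrt (cmod (?z t - w)))"
      using w by (intro continuous_intros cz) auto
    fix t assume t: "t \<in> {0..2 * pi}" "cis t \<noteq> cis t0"
    have "m * (r * cmod (cis t - cis t0)) = m * cmod ((c + of_real r * cis t) - (c + of_real r * cis t0))"
      using r by (simp add: norm_mult flip: right_diff_distrib)
    also have "\<dots> \<le> cmod (?z t - ?z t0)" by (rule m(2)[OF inb inb])
    also have "\<dots> \<le> cmod (?z t - w) + cmod (?z t0 - w)" using norm_triangle_ineq4[of "?z t - w" "?z t0 - w"] by simp
    also have "\<dots> \<le> 2 * cmod (?z t - w)" using t0(2)[OF t(1)] by simp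
    finally have "m * r / 2 * cmod (cis t - cis t0) \<le> cmod (?z t - w)" by simp
    moreover have pos: "m * r / 2 * cmod (cis t - cis t0) > 0" using m r t by simp
    ultimately have "1 / sqrt (cmod (?z t - w)) \<le> 1 / sqrt (m * r / 2 * cmod (cis t - cis t0))"
      by (intro divide_left_mono mult_pos_pos) auto
    also have "\<dots> = sqrt (2 / (m * r)) / sqrt (cmod (cis t - cis t0))"
      by (simp add: real_sqrt_mult real_sqrt_divide)
    finally show "1 / sqrt (cmod (?z t - w)) \<le> sqrt (2 / (m * r)) / sqrt (cmod (cis t - cis t0))" .
  qed (use m r in auto)
qed

lemma cos_zero_0_2pi: "t = pi / 2 \<or> t = 3 * pi / 2" if t: "cos t = 0" "t \<in> {0..2 * pi}" for t :: real
proof -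
  obtain i :: int where i: "odd i" "t = of_int i * (pi / 2)" using t(1) unfolding cos_zero_iff_int by blast
  have "0 \<le> of_int i * (pi / 2)" "of_int i * (pi / 2) \<le> 4 * (pi / 2)" using t(2) i(2) by auto
  then have "0 \<le> (of_int i :: real)" "(of_int i :: real) \<le> 4"
    using mult_right_le_imp_le[of 0 "pi / 2" "of_int i"] mult_right_le_imp_le[of "of_int i" "pi / 2" 4] pi_gt_zero by auto
  then have "0 \<le> i" "i \<le> 4" by linarith+
  then have "i \<in> {0, 1, 2, 3, 4}" by auto
  then show ?thesis using i by auto
qed

lemma integral_positive_cos:
  assumes "r \<ge> 0"
  shows "((\<lambda>t. max (r * cos t) 0) has_integral 2 * r) {0..2 * pi}"
proof -
  have sc: "((\<lambda>t. r * cos t) has_integral r * sin b - r * sin a) {a..b}" if "a \<le> b" for a b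
    by (rule fundamental_theorem_of_calculus[OF that])
       (auto intro!: derivative_eq_intros simp flip: has_real_derivative_iff_has_vector_derivative)
  have 1: "((\<lambda>t. max (r * cos t) 0) has_integral r) {0..pi / 2}"
  proof (rule has_integral_eq[where f = "\<lambda>t. r * cos t"])
    show "((\<lambda>t. r * cos t) has_integral r) {0..pi / 2}" using sc[of 0 "pi / 2"] by simp
    fix t assume "t \<in> {0..pi / 2}"
    then have "r * cos t \<ge> 0" by (intro mult_nonneg_nonneg assms cos_ge_zero) auto
    then show "r * cos t = max (r * cos t) 0" by simp
  qed
  have 2: "((\<lambda>t. max (r * cos t) 0) has_integral 0) {pi / 2..3 * pi / 2}"
  proof (rule has_integral_eq[where f = "\<lambda>t. 0"])
    fix t assume t: "t \<in> {pi / 2..3 * pi / 2}"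
    have "cos (t - pi) \<ge> 0" using t by (intro cos_ge_zero) auto
    then have "r * cos t \<le> 0" using assms by (simp add: mult_le_0_iff)
    then show "0 = max (r * cos t) 0" by simp
  qed simp
  have 3: "((\<lambda>t. max (r * cos t) 0) has_integral r) {3 * pi / 2..2 * pi}"
  proof (rule has_integral_eq[where f = "\<lambda>t. r * cos t"])
    have "sin (3 * pi / 2) = -1" using sin_3over2_pi by simp
    then show "((\<lambda>t. r * cos t) has_integral r) {3 * pi / 2..2 * pi}" using sc[of "3 * pi / 2" "2 * pi"] by simp
    fix t assume t: "t \<in> {3 * pi / 2..2 * pi}"
    have "cos (t - 2 * pi) \<ge> 0" using t by (intro cos_ge_zero) auto
    then have "cos t \<ge> 0" by (simp add: cos_diff)
    then have "r * cos t \<ge> 0" by (intro mult_nonneg_nonneg assms)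
    then show "r * cos t = max (r * cos t) 0" by simp
  qed
  have "((\<lambda>t. max (r * cos t) 0) has_integral (r + 0)) {0..3 * pi / 2}"
    by (rule has_integral_combine[OF _ _ 1 2]) auto
  then have "((\<lambda>t. max (r * cos t) 0) has_integral (r + 0 + r)) {0..2 * pi}"
    by (rule has_integral_combine[rotated 2, OF _ 3]) auto
  then show ?thesis by simp
qed

text \<open>The weights \<open>p n\<close> on the finite sets \<open>Z n\<close> describe zero counting measures converging weakly
  to \<open>\<mu>\<close>; \<open>lim\<close> says that their potentials converge to \<open>U\<close> in the chart \<open>\<kappa>\<close>.\<close>

locale potential_limit =
  fixes Z :: "nat \<Rightarrow> complex set" and p :: "nat \<Rightarrow> complex \<Rightarrow> real" and \<mu> :: "complex measure"
    and \<kappa> :: "complex \<Rightarrow> complex" and c :: complex and R m :: real and U :: "complex \<Rightarrow> real"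
  assumes Z: "\<And>n. finite (Z n)" and p: "\<And>n w. p n w \<ge> 0" "\<And>n. (\<Sum>w\<in>Z n. p n w) \<le> 1"
    and prob: "prob_space \<mu>" and sets: "sets \<mu> = sets borel"
    and weak: "\<And>\<psi>. continuous_on UNIV \<psi> \<Longrightarrow> bounded (range \<psi>) \<Longrightarrow>
        (\<lambda>n. \<Sum>w\<in>Z n. p n w * \<psi> w) \<longlonglongrightarrow> (\<integral>w. \<psi> w \<partial>\<mu>)"
    and \<kappa>: "\<kappa> holomorphic_on ball c R"
    and m: "m > 0" "\<And>x y. x \<in> ball c R \<Longrightarrow> y \<in> ball c R \<Longrightarrow> m * cmod (x - y) \<le> cmod (\<kappa> x - \<kappa> y)"
    and U: "continuous_on (ball c R) U"
    and lim: "\<And>v. v \<in> ball c R \<Longrightarrow> Re v \<noteq> Re c \<Longrightarrow>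
        (\<lambda>n. \<Sum>w\<in>Z n. p n w * ln (cmod (\<kappa> v - w))) \<longlonglongrightarrow> U v"
begin

text \<open>Circles through zeros are avoided, so that all integrands below are continuous.\<close>

definition bad_radii :: "real set" where
  "bad_radii = (\<lambda>v. cmod (v - c)) ` (ball c R \<inter> \<kappa> -` (\<Union>n. Z n))"

lemma inj: "inj_on \<kappa> (ball c R)"
proof (rule inj_onI)
  fix x y assume "x \<in> ball c R" "y \<in> ball c R" "\<kappa> x = \<kappa> y"
  then have "m * cmod (x - y) \<le> 0" using m(2)[of x y] by simp
  then show "x = y" using m(1) by (simp add: mult_le_0_iff)
qed

lemma countable_bad_radii: "countable bad_radii"
proof -
  have "countable (\<Union>n. Z n)" using Z by (intro countable_UN) (auto intro: countable_finite)
  then have "countable (\<kappa> ` (ball c R \<inter> \<kappa> -` (\<Union>n. Z n)))" by (rule countable_subset[rotated]) auto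
  then have "countable (ball c R \<inter> \<kappa> -` (\<Union>n. Z n))"
    by (rule countable_image_inj_on) (use inj in \<open>auto intro: inj_on_subset\<close>)
  then show ?thesis unfolding bad_radii_def by (rule countable_image)
qed

lemma good_radius:
  assumes "x < y" obtains r where "x < r" "r < y" "r \<notin> bad_radii"
proof -
  have "uncountable {x<..<y}" using assms by (simp add: uncountable_open_interval)
  then obtain r where "r \<in> {x<..<y} - bad_radii"
    using countable_bad_radii by (metis all_not_in_conv countable_empty uncountable_minus_countable)
  then show ?thesis using that by auto
qed

definition circle_mean :: "real \<Rightarrow> real" where
  "circle_mean r = integral {0..2 * pi} (\<lambda>t. U (c + of_real r * cis t)) / (2 * pi)"

text \<open>Jensen's formula holds for each zero measure. The kernel side converges weakly; the
  circle means converge by \<open>vitali_L2_convergence\<close>, whose bound on squares is the same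
  for all zeros and survives averaging with weights of total at most 1.\<close>

lemma jensen_limit:
  assumes r: "0 < r1" "r1 < r2" "r2 < R" "r1 \<notin> bad_radii" "r2 \<notin> bad_radii"
  shows "(\<integral>w. jensen_kernel \<kappa> c R r1 r2 w \<partial>\<mu>) = circle_mean r2 - circle_mean r1"
proof -
  let ?\<psi> = "jensen_kernel \<kappa> c R r1 r2"
  let ?z = "\<lambda>r t. \<kappa> (c + of_real r * cis t)"
  have inb: "c + of_real r * cis t \<in> ball c R" if "r \<in> {r1, r2}" for r t
    using r that by (auto simp: dist_norm norm_mult)
  have c\<kappa>: "continuous_on (ball c R) \<kappa>" using \<kappa> by (rule holomorphic_on_imp_continuous_on)
  have cz: "continuous_on {0..2 * pi} (?z r)" if "r \<in> {r1, r2}" for r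
    by (intro continuous_on_compose2[OF c\<kappa>] continuous_intros) (use inb[OF that] in auto)
  have good: "cmod (v - c) \<noteq> r1 \<and> cmod (v - c) \<noteq> r2" if "v \<in> ball c R" "\<kappa> v = w" "w \<in> Z n" for v w n
  proof -
    have "v \<in> ball c R \<inter> \<kappa> -` (\<Union>n. Z n)" using that by blast
    then have "cmod (v - c) \<in> bad_radii" unfolding bad_radii_def by (rule imageI)
    then show ?thesis using r(4,5) by auto
  qed
  have ne: "?z r t \<noteq> w" if "r \<in> {r1, r2}" "w \<in> Z n" for r t w n
    using good[OF inb[OF that(1)] _ that(2), of t] that(1) r by (auto simp: norm_mult)
  define q where "q w t = ln (cmod (?z r2 t - w)) - ln (cmod (?z r1 t - w))" for w t
  define f where "f n t = (\<Sum>w\<in>Z n. p n w * q w t)" for n t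
  define g where "g t = U (c + of_real r2 * cis t) - U (c + of_real r1 * cis t)" for t
  have cq: "continuous_on {0..2 * pi} (q w)" if "w \<in> Z n" for w n
    unfolding q_def using ne[OF _ that] by (intro continuous_intros cz) auto
  have cf: "continuous_on {0..2 * pi} (f n)" for n
    unfolding f_def by (intro continuous_intros cq)
  have cU: "continuous_on {0..2 * pi} (\<lambda>t. U (c + of_real r * cis t))" if "r \<in> {r1, r2}" for r
    by (intro continuous_on_compose2[OF U] continuous_intros) (use inb[OF that] in auto)
  have cg: "continuous_on {0..2 * pi} g"
    unfolding g_def by (intro continuous_intros cU) auto
  have "compact (\<kappa> ` cball c r2)"
    by (intro compact_continuous_image continuous_on_subset[OF c\<kappa>]) (use r in auto)
  then obtain B where B: "\<And>v. v \<in> cball c r2 \<Longrightarrow> cmod (\<kappa> v) \<le> B"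
    using compact_imp_bounded bounded_iff by (metis imageI)
  have L: "cmod ((?z r1 t - w) - (?z r2 t - w)) \<le> 2 * B" for t w
  proof -
    have "cmod (?z r1 t) \<le> B" "cmod (?z r2 t) \<le> B" by (rule B; use r in \<open>simp add: dist_norm norm_mult\<close>)+
    then show ?thesis using norm_triangle_ineq4[of "?z r1 t" "?z r2 t"] by simp
  qed
  define K where "K r = 24 * sqrt (2 / (m * r)) * sqrt (8 * pi)" for r
  define C where "C = 16 * sqrt (2 * B) * (K r1 + K r2)"
  have K0: "K r \<ge> 0" if "r \<in> {r1, r2}" for r using that r m by (auto simp: K_def)
  have Bpos: "B \<ge> 0" using B[of c] r norm_ge_zero[of "\<kappa> c"] by (simp, linarith)
  have C0: "C \<ge> 0" unfolding C_def using K0 Bpos by (intro mult_nonneg_nonneg add_nonneg_nonneg) auto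
  have qint: "integral {0..2 * pi} (\<lambda>t. (q w t)\<^sup>2) \<le> C" if w: "w \<in> Z n" for w n
  proof -
    have ci: "continuous_on {0..2 * pi} (\<lambda>t. 1 / sqrt (cmod (?z r t - w)))" if "r \<in> {r1, r2}" for r
      using ne[OF that w] by (intro continuous_intros cz that) auto
    note i1 = integrable_continuous_real[OF ci[of r1]] and i2 = integrable_continuous_real[OF ci[of r2]]
    have "integral {0..2 * pi} (\<lambda>t. (q w t)\<^sup>2) \<le> integral {0..2 * pi} (\<lambda>t. 16 * sqrt (2 * B) * (1 / sqrt (cmod (?z r1 t - w)) + 1 / sqrt (cmod (?z r2 t - w))))"
    proof (rule integral_le)
      show "(\<lambda>t. (q w t)\<^sup>2) integrable_on {0..2 * pi}"
        by (intro integrable_continuous_real continuous_intros cq[OF w])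
      show "(\<lambda>t. 16 * sqrt (2 * B) * (1 / sqrt (cmod (?z r1 t - w)) + 1 / sqrt (cmod (?z r2 t - w)))) integrable_on {0..2 * pi}"
        by (intro integrable_on_mult_right integrable_add i1 i2) auto
      fix t
      show "(q w t)\<^sup>2 \<le> 16 * sqrt (2 * B) * (1 / sqrt (cmod (?z r1 t - w)) + 1 / sqrt (cmod (?z r2 t - w)))"
        unfolding q_def by (rule ln_quotient_square_bound[OF _ _ L]) (use ne[OF _ w] in auto)
    qed
    also have "\<dots> = 16 * sqrt (2 * B) * (integral {0..2 * pi} (\<lambda>t. 1 / sqrt (cmod (?z r1 t - w))) + integral {0..2 * pi} (\<lambda>t. 1 / sqrt (cmod (?z r2 t - w))))"
      unfolding integral_mult_right using i1 i2 by (subst integral_add) auto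
    also have "\<dots> \<le> C" unfolding C_def K_def
      using Bpos r ne[OF _ w]
      by (intro mult_left_mono add_mono curve_inverse_sqrt_integral[OF c\<kappa> m]) auto
    finally show ?thesis .
  qed
  have fint: "integral {0..2 * pi} (\<lambda>t. (f n t)\<^sup>2) \<le> C" for n
  proof -
    have iq: "(\<lambda>t. p n w * (q w t)\<^sup>2) integrable_on {0..2 * pi}" if "w \<in> Z n" for w
      by (intro integrable_continuous_real continuous_intros cq[OF that])
    have "(f n t)\<^sup>2 \<le> (\<Sum>w\<in>Z n. p n w * (q w t)\<^sup>2)" for t
    proof -
      \<comment> \<open>Splitting each weight into two square roots prepares the Cauchy-Schwarz
        inequality, which bounds the square of the mean by the mean of the squares.\<close>
      have "(f n t)\<^sup>2 = (\<Sum>w\<in>Z n. sqrt (p n w) * (sqrt (p n w) * q w t))\<^sup>2"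
        unfolding f_def by (simp add: p(1) flip: mult.assoc)
      also have "\<dots> \<le> (\<Sum>w\<in>Z n. (sqrt (p n w))\<^sup>2) * (\<Sum>w\<in>Z n. (sqrt (p n w) * q w t)\<^sup>2)"
        by (rule Cauchy_Schwarz_ineq_sum)
      also have "\<dots> \<le> 1 * (\<Sum>w\<in>Z n. (sqrt (p n w) * q w t)\<^sup>2)"
        using p by (intro mult_right_mono sum_nonneg) auto
      finally show ?thesis by (simp add: power_mult_distrib p(1))
    qed
    then have "integral {0..2 * pi} (\<lambda>t. (f n t)\<^sup>2) \<le> integral {0..2 * pi} (\<lambda>t. \<Sum>w\<in>Z n. p n w * (q w t)\<^sup>2)"
      by (intro integral_le integrable_sum iq Z integrable_continuous_real continuous_intros cf) auto
    also have "\<dots> = (\<Sum>w\<in>Z n. integral {0..2 * pi} (\<lambda>t. p n w * (q w t)\<^sup>2))"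
      by (rule integral_sum[OF Z iq])
    also have "\<dots> \<le> (\<Sum>w\<in>Z n. p n w * C)"
      using qint p(1) by (intro sum_mono) (simp add: mult_left_mono)
    also have "\<dots> \<le> 1 * C" unfolding sum_distrib_right[symmetric] using p(2) C0 by (intro mult_right_mono) auto
    finally show ?thesis by simp
  qed
  \<comment> \<open>The two excluded angles are those at which the circle crosses the line Re v = Re
    c, where convergence of the potentials is not assumed.\<close>
  have flim: "(\<lambda>n. f n t) \<longlonglongrightarrow> g t" if t: "t \<in> {0..2 * pi} - {pi / 2, 3 * pi / 2}" for t
  proof -
    have ct: "cos t \<noteq> 0" using cos_zero_0_2pi[of t] t by auto
    have "(\<lambda>n. \<Sum>w\<in>Z n. p n w * ln (cmod (?z r t - w))) \<longlonglongrightarrow> U (c + of_real r * cis t)" if "r \<in> {r1, r2}" for r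
      by (rule lim[OF inb[OF that]]) (use that r ct in auto)
    from tendsto_diff[OF this[of r2] this[of r1]] show ?thesis
      unfolding f_def g_def q_def by (simp add: right_diff_distrib sum_subtractf)
  qed
  have l1: "(\<lambda>n. integral {0..2 * pi} (f n)) \<longlonglongrightarrow> integral {0..2 * pi} g"
    by (rule vitali_L2_convergence[where N = "{pi / 2, 3 * pi / 2}", OF _ cf cg _ flim fint]) auto
  have l2: "integral {0..2 * pi} (f n) = 2 * pi * (\<Sum>w\<in>Z n. p n w * ?\<psi> w)" for n
  proof -
    have "((\<lambda>t. \<Sum>w\<in>Z n. p n w * q w t) has_integral (\<Sum>w\<in>Z n. p n w * (2 * pi * ?\<psi> w))) {0..2 * pi}"
      unfolding q_def
      by (intro has_integral_sum Z has_integral_mult_right jensen_formula[OF \<kappa> inj r(1-3)]) (use good in blast)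
    then show ?thesis unfolding f_def by (simp add: integral_unique sum_distrib_left mult_ac)
  qed
  have l3: "(\<lambda>n. 2 * pi * (\<Sum>w\<in>Z n. p n w * ?\<psi> w)) \<longlonglongrightarrow> 2 * pi * (\<integral>w. ?\<psi> w \<partial>\<mu>)"
  proof (intro tendsto_mult_left weak)
    show "continuous_on UNIV ?\<psi>" by (rule jensen_kernel_properties(1)[OF \<kappa> inj r(1-3)])
    show "bounded (range ?\<psi>)" unfolding bounded_iff
      using jensen_kernel_properties(2,3)[OF \<kappa> inj r(1-3)] by (intro exI[of _ "ln (r2 / r1)"]) auto
  qed
  have "2 * pi * (\<integral>w. ?\<psi> w \<partial>\<mu>) = integral {0..2 * pi} g"
    by (rule LIMSEQ_unique[OF l3 l1[unfolded l2]])
  also have "\<dots> = integral {0..2 * pi} (\<lambda>t. U (c + of_real r2 * cis t)) - integral {0..2 * pi} (\<lambda>t. U (c + of_real r1 * cis t))"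
    unfolding g_def by (intro integral_diff integrable_continuous_real cU) auto
  finally show ?thesis by (simp add: circle_mean_def field_simps)
qed

lemma image_ball_borel: "r \<le> R \<Longrightarrow> \<kappa> ` ball c r \<in> sets borel"
proof -
  assume r: "r \<le> R"
  have "continuous_on (ball c r) \<kappa>" using holomorphic_on_imp_continuous_on[OF \<kappa>] by (rule continuous_on_subset) (use r in auto)
  then have "open (\<kappa> ` ball c r)" by (rule invariance_of_domain[OF _ open_ball inj_on_subset[OF inj subset_ball[OF r]]])
  then show ?thesis by simp
qed

lemma measure_bounds:
  assumes r: "0 < r1" "r1 < r2" "r2 < R" "r1 \<notin> bad_radii" "r2 \<notin> bad_radii"
  shows "measure \<mu> (\<kappa> ` ball c r1) * ln (r2 / r1) \<le> circle_mean r2 - circle_mean r1"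
    and "circle_mean r2 - circle_mean r1 \<le> measure \<mu> (\<kappa> ` ball c r2) * ln (r2 / r1)"
proof -
  interpret prob_space \<mu> by (rule prob)
  let ?\<psi> = "jensen_kernel \<kappa> c R r1 r2"
  note P = jensen_kernel_properties[OF \<kappa> inj r(1-3)]
  have b: "\<kappa> ` ball c r1 \<in> sets \<mu>" "\<kappa> ` ball c r2 \<in> sets \<mu>" using image_ball_borel r sets by auto
  have "?\<psi> \<in> borel_measurable borel" using P(1) by (rule borel_measurable_continuous_onI)
  then have meas: "?\<psi> \<in> borel_measurable \<mu>" using sets by (simp cong: measurable_cong_sets)
  have int: "integrable \<mu> ?\<psi>"
    by (rule integrable_const_bound[of _ "ln (r2 / r1)"]) (use P(2,3) meas in auto)
  have i: "integrable \<mu> (\<lambda>w. indicat_real A w * ln (r2 / r1))" "(\<integral>w. indicat_real A w * ln (r2 / r1) \<partial>\<mu>) = measure \<mu> A * ln (r2 / r1)"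
    if "A \<in> sets \<mu>" for A
    using that by (auto simp: sets.Int_space_eq2 intro!: integrable_mult_left integrable_real_indicator simp: emeasure_eq_measure)
  have "(\<integral>w. indicat_real (\<kappa> ` ball c r1) w * ln (r2 / r1) \<partial>\<mu>) \<le> (\<integral>w. ?\<psi> w \<partial>\<mu>)"
    by (rule integral_mono[OF i(1)[OF b(1)] int]) (use P in \<open>auto simp: indicator_def\<close>)
  then show "measure \<mu> (\<kappa> ` ball c r1) * ln (r2 / r1) \<le> circle_mean r2 - circle_mean r1"
    unfolding i(2)[OF b(1)] jensen_limit[OF r] .
  have "(\<integral>w. ?\<psi> w \<partial>\<mu>) \<le> (\<integral>w. indicat_real (\<kappa> ` ball c r2) w * ln (r2 / r1) \<partial>\<mu>)"
    by (rule integral_mono[OF int i(1)[OF b(2)]]) (use P in \<open>auto simp: indicator_def\<close>)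
  then show "circle_mean r2 - circle_mean r1 \<le> measure \<mu> (\<kappa> ` ball c r2) * ln (r2 / r1)"
    unfolding i(2)[OF b(2)] jensen_limit[OF r] .
qed

lemma measure_mono_ball: "r \<le> r' \<Longrightarrow> r' \<le> R \<Longrightarrow> measure \<mu> (\<kappa> ` ball c r) \<le> measure \<mu> (\<kappa> ` ball c r')"
proof -
  assume r: "r \<le> r'" "r' \<le> R"
  interpret prob_space \<mu> by (rule prob)
  show ?thesis using image_ball_borel[OF r(2)] sets r by (intro finite_measure_mono image_mono) auto
qed

text \<open>The mean of max(r cos, 0) over the circle is r/\<pi>, the origin of the mass in
  \<open>measure_ball_kink\<close>.\<close>

lemma circle_mean_eq:
  assumes W: "W holomorphic_on ball c R" and h: "\<And>v. v \<in> ball c R \<Longrightarrow> U v = Re (W v) + s * max (Re (v - c)) 0" and r: "0 < r" "r < R"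
  shows "circle_mean r = Re (W c) + s * (r / pi)"
proof -
  have "((\<lambda>t. Re (W (c + of_real r * cis t)) + s * max (r * cos t) 0) has_integral 2 * pi * Re (W c) + s * (2 * r)) {0..2 * pi}"
    by (intro has_integral_add has_integral_mult_right circle_mean_Re[OF W r] integral_positive_cos) (use r in auto)
  then have "((\<lambda>t. U (c + of_real r * cis t)) has_integral 2 * pi * Re (W c) + s * (2 * r)) {0..2 * pi}"
    by (rule has_integral_eq[rotated]) (use r in \<open>subst h; simp add: dist_norm norm_mult\<close>)
  then show ?thesis unfolding circle_mean_def by (simp add: integral_unique field_simps)
qed

lemma measure_ball_harmonic:
  assumes W: "W holomorphic_on ball c R" and h: "\<And>v. v \<in> ball c R \<Longrightarrow> U v = Re (W v)" and r: "r < R"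
  shows "measure \<mu> (\<kappa> ` ball c r) = 0"
proof (cases "R > 0")
  case True
  obtain r1 where r1: "max r 0 < r1" "r1 < R" "r1 \<notin> bad_radii" using good_radius[of "max r 0" R] r True by auto
  obtain r2 where r2: "r1 < r2" "r2 < R" "r2 \<notin> bad_radii" using good_radius[of r1 R] r1 by auto
  have "measure \<mu> (\<kappa> ` ball c r1) * ln (r2 / r1) \<le> circle_mean r2 - circle_mean r1"
    by (rule measure_bounds(1)) (use r1 r2 in auto)
  also have "\<dots> = 0" using circle_mean_eq[OF W, of 0] h r1 r2 by simp
  finally have "measure \<mu> (\<kappa> ` ball c r1) \<le> 0"
    using ln_gt_zero[of "r2 / r1"] r1 r2 by (simp add: mult_le_0_iff)
  moreover have "measure \<mu> (\<kappa> ` ball c r) \<le> measure \<mu> (\<kappa> ` ball c r1)" by (rule measure_mono_ball) (use r1 in auto)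
  ultimately show ?thesis using measure_nonneg[of \<mu> "\<kappa> ` ball c r"] by linarith
next
  case False
  then show ?thesis using r by (simp add: ball_empty)
qed

text \<open>The circle means would decrease in the radius, against the nonnegative lower bound that
  Jensen's formula gives for their increments.\<close>

lemma no_negative_kink:
  assumes W: "W holomorphic_on ball c R" and h: "\<And>v. v \<in> ball c R \<Longrightarrow> U v = Re (W v) + (- 1) * max (Re (v - c)) 0" and R: "R > 0"
  shows False
proof -
  obtain r1 where r1: "0 < r1" "r1 < R" "r1 \<notin> bad_radii" using good_radius[of 0 R] R by auto
  obtain r2 where r2: "r1 < r2" "r2 < R" "r2 \<notin> bad_radii" using good_radius[of r1 R] r1 by auto
  have "measure \<mu> (\<kappa> ` ball c r1) * ln (r2 / r1) \<le> circle_mean r2 - circle_mean r1"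
    by (rule measure_bounds(1)) (use r1 r2 in auto)
  also have "\<dots> = (r1 - r2) / pi" using circle_mean_eq[OF W h] r1 r2 by (simp add: diff_divide_distrib)
  also have "\<dots> < 0" using r2 by (simp add: divide_neg_pos)
  finally show False using ln_gt_zero[of "r2 / r1"] r1 r2 by (simp add: mult_less_0_iff not_less[symmetric])
qed

text \<open>The circle means grow at rate 1/\<pi>, and ln(r2/r1) lies between (r2 - r1)/r2 and (r2 -
  r1)/r1. Two radii just above r give one inequality, two just below it the other. Arguing by
  contradiction leaves an open interval in which to pick them off \<open>bad_radii\<close>.\<close>

lemma measure_ball_kink:
  assumes W: "W holomorphic_on ball c R" and h: "\<And>v. v \<in> ball c R \<Longrightarrow> U v = Re (W v) + 1 * max (Re (v - c)) 0" and r: "0 < r" "r < R"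
  shows "measure \<mu> (\<kappa> ` ball c r) = r / pi"
proof (rule antisym)
  have diff: "circle_mean r2 - circle_mean r1 = (r2 - r1) / pi" if "0 < r1" "r1 < r2" "r2 < R" for r1 r2
    using circle_mean_eq[OF W h] that by (simp add: diff_divide_distrib)
  show "measure \<mu> (\<kappa> ` ball c r) \<le> r / pi"
  proof (rule ccontr)
    assume "\<not> ?thesis"
    then have lt: "r < min R (pi * measure \<mu> (\<kappa> ` ball c r))" using r by (simp add: field_simps)
    obtain r2 where r2: "r < r2" "r2 < min R (pi * measure \<mu> (\<kappa> ` ball c r))" "r2 \<notin> bad_radii" using good_radius[OF lt] .
    obtain r1 where r1: "r < r1" "r1 < r2" "r1 \<notin> bad_radii" using good_radius[OF r2(1)] .
    have "ln (r1 / r2) \<le> r1 / r2 - 1" using r1 r2 r by (intro ln_le_minus_one) auto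
    then have l: "(r2 - r1) / r2 \<le> ln (r2 / r1)" using r1 r2 r by (simp add: ln_div diff_divide_distrib)
    have "measure \<mu> (\<kappa> ` ball c r) * ((r2 - r1) / r2) \<le> measure \<mu> (\<kappa> ` ball c r1) * ln (r2 / r1)"
      using r1 r2 r by (intro mult_mono l measure_mono_ball) auto
    also have "\<dots> \<le> (r2 - r1) / pi" using measure_bounds(1)[of r1 r2] diff[of r1 r2] r1 r2 r by simp
    finally have "(r2 - r1) * (measure \<mu> (\<kappa> ` ball c r) * pi) \<le> (r2 - r1) * r2" using r1 r2 r by (simp add: field_simps)
    then have "measure \<mu> (\<kappa> ` ball c r) * pi \<le> r2" using r1 by simp
    then show False using r2 by (simp add: mult.commute)
  qed
  show "r / pi \<le> measure \<mu> (\<kappa> ` ball c r)"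
  proof (rule ccontr)
    assume "\<not> ?thesis"
    then have lt: "pi * measure \<mu> (\<kappa> ` ball c r) < r" by (simp add: field_simps)
    obtain r1 where r1: "pi * measure \<mu> (\<kappa> ` ball c r) < r1" "r1 < r" "r1 \<notin> bad_radii" using good_radius[OF lt] .
    obtain r2 where r2: "r1 < r2" "r2 < r" "r2 \<notin> bad_radii" using good_radius[OF r1(2)] .
    have r10: "r1 > 0" using r1(1) by (meson measure_nonneg mult_nonneg_nonneg order.strict_trans1 pi_ge_zero)
    have "ln (r2 / r1) \<le> r2 / r1 - 1" using r10 r2 by (intro ln_le_minus_one) auto
    then have l: "ln (r2 / r1) \<le> (r2 - r1) / r1" using r10 by (simp add: diff_divide_distrib)
    have "(r2 - r1) / pi \<le> measure \<mu> (\<kappa> ` ball c r2) * ln (r2 / r1)"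
      using measure_bounds(2)[of r1 r2] diff[of r1 r2] r10 r1 r2 r by simp
    also have "\<dots> \<le> measure \<mu> (\<kappa> ` ball c r) * ((r2 - r1) / r1)"
      using r10 r2 r by (intro mult_mono l measure_mono_ball) auto
    finally have "(r2 - r1) * r1 \<le> (r2 - r1) * (measure \<mu> (\<kappa> ` ball c r) * pi)" using r10 by (simp add: field_simps)
    then have "r1 \<le> measure \<mu> (\<kappa> ` ball c r) * pi" using r2 by simp
    then show False using r1 by (simp add: mult.commute)
  qed
qed

end

section \<open>Branches of saddle points\<close>

lemma prod_power_log_derivative:
  fixes lam :: "nat \<Rightarrow> complex"
  assumes "finite A" "\<And>j. j \<in> A \<Longrightarrow> w \<noteq> lam j"
  shows "((\<lambda>u. \<Prod>j\<in>A. (u - lam j) ^ a j) has_field_derivative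
     (\<Prod>j\<in>A. (w - lam j) ^ a j) * (\<Sum>j\<in>A. of_nat (a j) / (w - lam j))) (at w)"
  using assms
proof (induction A rule: finite_induct)
  case (insert x A)
  have nz: "w - lam x \<noteq> 0" using insert by simp
  have "((\<lambda>u. (u - lam x) ^ a x) has_field_derivative of_nat (a x) * (w - lam x) ^ (a x - 1)) (at w)"
    by (auto intro!: derivative_eq_intros)
  moreover have "of_nat (a x) * (w - lam x) ^ (a x - 1) = (w - lam x) ^ a x * (of_nat (a x) / (w - lam x))"
    using nz by (cases "a x") auto
  ultimately have "((\<lambda>u. (u - lam x) ^ a x) has_field_derivative (w - lam x) ^ a x * (of_nat (a x) / (w - lam x))) (at w)" by simp
  from DERIV_mult[OF this insert.IH] show ?case
    using insert by (simp add: algebra_simps)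
qed simp

context heat_data begin

text \<open>The saddle points for z form the fibre of this map over z, so every branch is a right
  inverse of it.\<close>

definition saddle_map :: "complex \<Rightarrow> complex" where
  "saddle_map u = u + of_real t / of_nat (total_mult d a) * (\<Sum>j=1..d. of_nat (a j) / (u - lam j))"

definition saddle_map' :: "complex \<Rightarrow> complex" where
  "saddle_map' u = 1 - of_real t / of_nat (total_mult d a) * (\<Sum>j=1..d. of_nat (a j) / (u - lam j)\<^sup>2)"

lemma saddle_map_derivative:
  assumes "w \<notin> lam ` {1..d}"
  shows "(saddle_map has_field_derivative saddle_map' w) (at w)"
proof -
  have "((\<lambda>u. of_nat (a j) / (u - lam j)) has_field_derivative - (of_nat (a j) / (w - lam j)\<^sup>2)) (at w)" if "j \<in> {1..d}" for j
    using assms that by (auto intro!: derivative_eq_intros simp: power2_eq_square)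
  then have "((\<lambda>u. \<Sum>j=1..d. of_nat (a j) / (u - lam j)) has_field_derivative (\<Sum>j=1..d. - (of_nat (a j) / (w - lam j)\<^sup>2))) (at w)"
    by (rule DERIV_sum)
  from DERIV_add[OF DERIV_ident DERIV_cmult[OF this, of "of_real t / of_nat (total_mult d a)"]] show ?thesis
    unfolding saddle_map_def[abs_def] saddle_map'_def by (simp add: sum_negf)
qed

lemma phi_derivative:
  assumes "w \<notin> lam ` {1..d}"
  shows "(\<Phi> z has_field_derivative \<Phi> z w * (of_real (al / t) * (saddle_map w - z))) (at w)"
proof -
  define \<beta> where "\<beta> = complex_of_real (al / (2 * t))"
  let ?S = "\<Sum>j=1..d. of_nat (a j) / (w - lam j)"
  have "(poly (base_poly d lam a) has_field_derivative poly (base_poly d lam a) w * ?S) (at w)"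
    unfolding poly_base_poly[abs_def] by (rule prod_power_log_derivative) (use assms in auto)
  moreover have "((\<lambda>u. exp (\<beta> * (u - z)\<^sup>2)) has_field_derivative exp (\<beta> * (w - z)\<^sup>2) * (\<beta> * (2 * (w - z)))) (at w)"
    by (auto intro!: derivative_eq_intros)
  ultimately have "((\<lambda>u. poly (base_poly d lam a) u * exp (\<beta> * (u - z)\<^sup>2)) has_field_derivative
     poly (base_poly d lam a) w * ?S * exp (\<beta> * (w - z)\<^sup>2) + exp (\<beta> * (w - z)\<^sup>2) * (\<beta> * (2 * (w - z))) * poly (base_poly d lam a) w) (at w)"
    by (rule DERIV_mult)
  moreover have e: "of_real (al / t) * (saddle_map w - z) = ?S + 2 * \<beta> * (w - z)"
    unfolding saddle_map_def \<beta>_def using t al_pos by (simp add: field_simps)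
  ultimately show ?thesis unfolding phi_def[abs_def] \<beta>_def[symmetric] e by (simp add: algebra_simps)
qed

lemma deriv_phi_eq_0_iff:
  assumes "w \<notin> lam ` {1..d}"
  shows "deriv (\<Phi> z) w = 0 \<longleftrightarrow> saddle_map w = z"
  using DERIV_imp_deriv[OF phi_derivative[OF assms, of z]] phi_eq_0_iff[of z w] assms t al_pos by simp

text \<open>The first derivative is \<Phi> times a factor that vanishes at the saddle, so only the
  derivative of that factor survives.\<close>

lemma deriv2_phi:
  assumes w: "w \<notin> lam ` {1..d}" "saddle_map w = z"
  shows "deriv (deriv (\<Phi> z)) w = \<Phi> z w * (of_real (al / t) * saddle_map' w)"
proof -
  have op: "open (- lam ` {1..d})" by (intro open_Compl finite_imp_closed) auto
  have "((\<lambda>u. \<Phi> z u * (of_real (al / t) * (saddle_map u - z))) has_field_derivative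
      (\<Phi> z w * (of_real (al / t) * (saddle_map w - z))) * (of_real (al / t) * (saddle_map w - z))
      + (of_real (al / t) * (saddle_map' w - 0)) * \<Phi> z w) (at w)"
    by (intro DERIV_mult phi_derivative DERIV_cmult DERIV_diff saddle_map_derivative w(1) DERIV_const)
  then have "((\<lambda>u. \<Phi> z u * (of_real (al / t) * (saddle_map u - z))) has_field_derivative
      \<Phi> z w * (of_real (al / t) * saddle_map' w)) (at w)" using w(2) by (simp add: mult_ac)
  then have "(deriv (\<Phi> z) has_field_derivative \<Phi> z w * (of_real (al / t) * saddle_map' w)) (at w)"
  proof (rule has_field_derivative_transform_within_open[OF _ op])
    show "w \<in> - lam ` {1..d}" using w(1) by simp
    fix x assume "x \<in> - lam ` {1..d}"
    then show "\<Phi> z x * (of_real (al / t) * (saddle_map x - z)) = deriv (\<Phi> z) x"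
      by (intro DERIV_imp_deriv[OF phi_derivative, symmetric]) simp
  qed
  then show ?thesis by (rule DERIV_imp_deriv)
qed

lemma height_eq: "height d lam a t z w = (if w \<in> lam ` {1..d} then - \<infinity> else ereal (ln (cmod (\<Phi> z w)) / al))"
proof (cases "w \<in> lam ` {1..d}")
  case False
  then have nz: "cmod (w - lam j) \<noteq> 0" if "j \<in> {1..d}" for j using that by auto
  have "ln (cmod (\<Phi> z w)) = ln (\<Prod>j=1..d. cmod (w - lam j) ^ a j) + al / (2 * t) * ((Re w - Re z)\<^sup>2 - (Im w - Im z)\<^sup>2)"
    unfolding cmod_phi using nz by (subst ln_mult) auto
  also have "ln (\<Prod>j=1..d. cmod (w - lam j) ^ a j) = (\<Sum>j=1..d. real (a j) * ln (cmod (w - lam j)))"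
    using nz by (subst ln_prod) (auto simp: ln_realpow)
  also have "al / (2 * t) * ((Re w - Re z)\<^sup>2 - (Im w - Im z)\<^sup>2) = al * Re ((z - w)\<^sup>2 / (2 * of_real t))"
    using t by (simp add: power2_eq_square field_simps)
  finally show ?thesis using False al_pos unfolding height_def by (simp add: add_divide_distrib)
qed (simp add: height_def)

lemma sublevel_eq: "sublevel d lam a t z (ereal h) = Sub z (exp (al * h))"
proof -
  have "height d lam a t z w \<le> ereal h \<longleftrightarrow> cmod (\<Phi> z w) \<le> exp (al * h)" for w
  proof (cases "w \<in> lam ` {1..d}")
    case True
    then show ?thesis using phi_eq_0_iff[of z w] by (simp add: height_eq)
  next
    case False
    then have "cmod (\<Phi> z w) > 0" using phi_eq_0_iff[of z w] by simp
    then have "cmod (\<Phi> z w) \<le> exp (al * h) \<longleftrightarrow> ln (cmod (\<Phi> z w)) \<le> al * h" using ln_le_cancel_iff[of "cmod (\<Phi> z w)" "exp (al * h)"] by simp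
    then show ?thesis using False al_pos by (simp add: height_eq field_simps)
  qed
  then show ?thesis by (simp add: sublevel_def)
qed

lemma saddle_points_eq: "saddle_points d lam a t z = {w. w \<notin> lam ` {1..d} \<and> saddle_map w = z}"
  by (simp add: saddle_points_def saddle_map_def)

lemma critical_saddle:
  assumes "cmod (\<Phi> z p) = pass_level z" "deriv (\<Phi> z) p = 0"
  shows "p \<in> saddle_points d lam a t z"
proof -
  have "p \<notin> lam ` {1..d}" using phi_eq_0_iff[of z p] assms(1) pass_level_pos[of z] by auto
  then show ?thesis using deriv_phi_eq_0_iff[of p z] assms(2) by (simp add: saddle_points_eq)
qed

text \<open>A shift of the height by \<epsilon> multiplies the level of |\<Phi>| by exp(\<alpha>
  \<epsilon>). The defining condition therefore says that |\<Phi>| at the saddle equals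
  \<open>pass_level z\<close>, and uniqueness at this level resolves the description
  operator.\<close>

lemma max_relevant_saddle_eq:
  assumes w: "w \<in> saddle_points d lam a t z" "cmod (\<Phi> z w) = pass_level z"
    and uniq: "\<And>v. v \<in> saddle_points d lam a t z \<Longrightarrow> cmod (\<Phi> z v) = pass_level z \<Longrightarrow> v = w"
  shows "max_relevant_saddle d lam a t z = w"
proof -
  have crit: "(\<forall>\<epsilon>>0. \<not> connects_imaginary_infinities (sublevel d lam a t z (height d lam a t z v - ereal \<epsilon>)) \<and>
       connects_imaginary_infinities (sublevel d lam a t z (height d lam a t z v + ereal \<epsilon>))) \<longleftrightarrow> cmod (\<Phi> z v) = pass_level z"
    if v: "v \<in> saddle_points d lam a t z" for v
  proof -
    define y where "y = cmod (\<Phi> z v)"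
    have vn: "v \<notin> lam ` {1..d}" using v by (simp add: saddle_points_eq)
    have y: "y > 0" using phi_eq_0_iff[of z v] vn by (simp add: y_def)
    have "sublevel d lam a t z (height d lam a t z v - ereal \<epsilon>) = Sub z (y * exp (- al * \<epsilon>))"
      "sublevel d lam a t z (height d lam a t z v + ereal \<epsilon>) = Sub z (y * exp (al * \<epsilon>))" for \<epsilon>
    proof -
      have "al * (ln y / al - \<epsilon>) = ln y + - al * \<epsilon>" "al * (ln y / al + \<epsilon>) = ln y + al * \<epsilon>"
        using al_pos by (simp_all add: right_diff_distrib distrib_left)
      then have "exp (al * (ln y / al - \<epsilon>)) = y * exp (- al * \<epsilon>)" "exp (al * (ln y / al + \<epsilon>)) = y * exp (al * \<epsilon>)"
        using y by (simp_all only: exp_add exp_ln)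
      moreover have "height d lam a t z v = ereal (ln y / al)" using vn by (simp add: height_eq y_def)
      ultimately show "sublevel d lam a t z (height d lam a t z v - ereal \<epsilon>) = Sub z (y * exp (- al * \<epsilon>))"
        "sublevel d lam a t z (height d lam a t z v + ereal \<epsilon>) = Sub z (y * exp (al * \<epsilon>))"
        by (simp_all only: ereal_minus(1) plus_ereal.simps(1) sublevel_eq)
    qed
    then have iff: "?thesis \<longleftrightarrow> ((\<forall>\<epsilon>>0. \<not> conn z (y * exp (- al * \<epsilon>)) \<and> conn z (y * exp (al * \<epsilon>))) \<longleftrightarrow> y = pass_level z)"
      by (simp add: y_def)
    show ?thesis unfolding iff
    proof
      assume *: "\<forall>\<epsilon>>0. \<not> conn z (y * exp (- al * \<epsilon>)) \<and> conn z (y * exp (al * \<epsilon>))"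
      show "y = pass_level z"
      proof (rule antisym)
        show "y \<le> pass_level z"
        proof (rule ccontr)
          assume "\<not> ?thesis"
          then have lt: "pass_level z < y" by simp
          \<comment> \<open>Half the logarithmic gap, so that the shifted level stays strictly on
            its side of the pass level.\<close>
          define \<epsilon> where "\<epsilon> = ln (y / pass_level z) / (2 * al)"
          have \<epsilon>: "\<epsilon> > 0" using lt pass_level_pos[of z] al_pos by (simp add: \<epsilon>_def)
          have "al * \<epsilon> < ln (y / pass_level z)" using lt pass_level_pos[of z] al_pos by (simp add: \<epsilon>_def)
          then have "exp (al * \<epsilon>) < y / pass_level z" using lt pass_level_pos[of z] y by (metis exp_less_mono exp_ln divide_pos_pos)
          then have "pass_level z < y * exp (- al * \<epsilon>)" using pass_level_pos[of z] by (simp add: exp_minus field_simps)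
          then show False using pass_level_conn * \<epsilon> by blast
        qed
        show "pass_level z \<le> y"
        proof (rule ccontr)
          assume "\<not> ?thesis"
          then have lt: "y < pass_level z" by simp
          define \<epsilon> where "\<epsilon> = ln (pass_level z / y) / (2 * al)"
          have \<epsilon>: "\<epsilon> > 0" using lt y al_pos by (simp add: \<epsilon>_def)
          have "al * \<epsilon> < ln (pass_level z / y)" using lt y al_pos by (simp add: \<epsilon>_def)
          then have "exp (al * \<epsilon>) < pass_level z / y" using pass_level_pos[of z] y by (metis exp_less_mono exp_ln divide_pos_pos)
          then have "y * exp (al * \<epsilon>) < pass_level z" using y by (simp add: field_simps)
          then show False using pass_level_not_conn * \<epsilon> by blast
        qed
      qed
    next
      assume eq: "y = pass_level z"
      show "\<forall>\<epsilon>>0. \<not> conn z (y * exp (- al * \<epsilon>)) \<and> conn z (y * exp (al * \<epsilon>))"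
      proof (intro allI impI conjI)
        fix \<epsilon> :: real assume \<epsilon>: "\<epsilon> > 0"
        have "y * exp (- al * \<epsilon>) < y * 1" "y * 1 < y * exp (al * \<epsilon>)"
          using y al_pos \<epsilon> by (intro mult_strict_left_mono; simp)+
        then show "\<not> conn z (y * exp (- al * \<epsilon>))" "conn z (y * exp (al * \<epsilon>))"
          using pass_level_not_conn pass_level_conn by (auto simp: eq)
      qed
    qed
  qed
  show ?thesis unfolding max_relevant_saddle_def
    by (rule the_equality) (use w crit uniq in blast)+
qed

end

section \<open>Holomorphic branches, their potentials and relevance\<close>

locale saddle_curve = heat_data +
  fixes \<mu> :: "complex measure" and D D1 D2 \<Gamma> :: "complex set" and u :: "nat \<Rightarrow> complex \<Rightarrow> complex" and i j :: nat
  assumes \<mu>: "weak_limit (zero_measure d lam a t) \<mu>"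
    and D: "simply_connected_domain D"
    and u: "saddle_branches d lam a t D u"
    and ij: "1 \<le> i" "i < j" "j \<le> d + 1"
    and \<Gamma>_def: "\<Gamma> = equal_height_set d lam a t D u i j"
    and \<Gamma>_nonempty: "\<Gamma> \<noteq> {}"
    and only_pair: "\<And>k l. 1 \<le> k \<Longrightarrow> k < l \<Longrightarrow> l \<le> d + 1 \<Longrightarrow>
                      equal_height_set d lam a t D u k l \<noteq> {} \<Longrightarrow> k = i \<and> l = j"
    and separation: "D = D1 \<union> D2 \<union> \<Gamma>" "D1 \<inter> D2 = {}" "D1 \<inter> \<Gamma> = {}" "D2 \<inter> \<Gamma> = {}"
      "simply_connected_domain D1" "simply_connected_domain D2"
begin

abbreviation "Ks \<equiv> {1..d + 1}"

lemma D': "open D" "connected D" "simply_connected D"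
  and D1': "open D1" "connected D1" "D1 \<noteq> {}" and D2': "open D2" "connected D2" "D2 \<noteq> {}"
  using D separation by (auto simp: simply_connected_domain_def)

lemma ijK: "i \<in> Ks" "j \<in> Ks" "i \<noteq> j" using ij by auto

lemma prob: "prob_space \<mu>" and sets: "sets \<mu> = sets borel"
  using \<mu> by (auto simp: weak_limit_def)

lemma u_holomorphic: "k \<in> Ks \<Longrightarrow> u k holomorphic_on D"
  using u unfolding saddle_branches_def by (blast intro: analytic_imp_holomorphic)

lemma u_bij: "z \<in> D \<Longrightarrow> bij_betw (\<lambda>k. u k z) Ks (saddle_points d lam a t z)"
  using u unfolding saddle_branches_def by blast

lemma u_saddle: "k \<in> Ks \<Longrightarrow> z \<in> D \<Longrightarrow> u k z \<in> saddle_points d lam a t z"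
  using bij_betwE[OF u_bij] by blast

lemma u_not_lam: "k \<in> Ks \<Longrightarrow> z \<in> D \<Longrightarrow> u k z \<notin> lam ` {1..d}"
  and saddle_map_u: "k \<in> Ks \<Longrightarrow> z \<in> D \<Longrightarrow> saddle_map (u k z) = z"
  using u_saddle unfolding saddle_points_eq by blast+

lemma u_distinct: "k \<in> Ks \<Longrightarrow> l \<in> Ks \<Longrightarrow> z \<in> D \<Longrightarrow> k \<noteq> l \<Longrightarrow> u k z \<noteq> u l z"
  using inj_onD[OF bij_betw_imp_inj_on[OF u_bij], of z k l] by blast

lemma u_surj: "z \<in> D \<Longrightarrow> v \<in> saddle_points d lam a t z \<Longrightarrow> \<exists>k\<in>Ks. v = u k z"
  using bij_betw_imp_surj_on[OF u_bij, of z] by blast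

lemma u_derivative: "k \<in> Ks \<Longrightarrow> z \<in> D \<Longrightarrow> (u k has_field_derivative deriv (u k) z) (at z)"
  using holomorphic_derivI[OF u_holomorphic D'(1)] .

text \<open>Differentiating \<open>saddle_map (u k z) = z\<close> gives a product of two derivatives
  equal to 1, so neither factor vanishes.\<close>

lemma saddle_nondegenerate:
  assumes k: "k \<in> Ks" and z: "z \<in> D"
  shows "saddle_map' (u k z) \<noteq> 0"
proof -
  have "((\<lambda>z. saddle_map (u k z)) has_field_derivative saddle_map' (u k z) * deriv (u k) z) (at z)"
    by (rule DERIV_chain2[OF saddle_map_derivative[OF u_not_lam[OF k z]] u_derivative[OF k z]])
  then have "((\<lambda>z. z) has_field_derivative saddle_map' (u k z) * deriv (u k) z) (at z)"
    by (rule has_field_derivative_transform_within_open[OF _ D'(1) z]) (use saddle_map_u[OF k] in auto)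
  then have "saddle_map' (u k z) * deriv (u k) z = 1" by (rule DERIV_unique) (rule DERIV_ident)
  then show ?thesis by auto
qed

text \<open>The contribution through \<open>u k\<close> cancels because \<open>u k z\<close> is a
  critical point of \<open>\<Phi> z\<close>; only the explicit dependence on \<open>z\<close>
  remains.\<close>

lemma branch_value_derivative:
  assumes k: "k \<in> Ks" and z: "z \<in> D"
  shows "((\<lambda>z. \<Phi> z (u k z)) has_field_derivative \<Phi> z (u k z) * (of_real (al / t) * (z - u k z))) (at z)"
proof -
  define \<beta> where "\<beta> = complex_of_real (al / (2 * t))"
  define w where "w = u k z"
  define P where "P = poly (base_poly d lam a)"
  let ?S = "\<Sum>j=1..d. of_nat (a j) / (w - lam j)"
  have w: "w \<notin> lam ` {1..d}" "saddle_map w = z" using u_not_lam[OF k z] saddle_map_u[OF k z] by (auto simp: w_def)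
  have "(P has_field_derivative P w * ?S) (at w)"
    unfolding P_def poly_base_poly[abs_def] by (rule prod_power_log_derivative) (use w in auto)
  then have 1: "((\<lambda>z. P (u k z)) has_field_derivative P w * ?S * deriv (u k) z) (at z)"
    unfolding w_def using DERIV_chain2 u_derivative[OF k z] by blast
  have "((\<lambda>z. \<beta> * (u k z - z)\<^sup>2) has_field_derivative \<beta> * (2 * (w - z) * (deriv (u k) z - 1))) (at z)"
    unfolding w_def by (auto intro!: derivative_eq_intros u_derivative[OF k z])
  then have 2: "((\<lambda>z. exp (\<beta> * (u k z - z)\<^sup>2)) has_field_derivative exp (\<beta> * (w - z)\<^sup>2) * (\<beta> * (2 * (w - z) * (deriv (u k) z - 1)))) (at z)"
    unfolding w_def by (rule DERIV_fun_exp)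
  have e: "P w * ?S * deriv (u k) z * exp (\<beta> * (w - z)\<^sup>2) + exp (\<beta> * (w - z)\<^sup>2) * (\<beta> * (2 * (w - z) * (deriv (u k) z - 1))) * P w
      = P w * exp (\<beta> * (w - z)\<^sup>2) * (of_real (al / t) * (z - w))"
  proof -
    have S: "?S = 2 * \<beta> * (z - w)"
      using w(2) t al_pos unfolding saddle_map_def \<beta>_def by (simp add: field_simps)
    have b: "of_real (al / t) = 2 * \<beta>" by (simp add: \<beta>_def)
    show ?thesis unfolding S b by (simp add: algebra_simps)
  qed
  show ?thesis
    using DERIV_mult[OF 1 2] unfolding w_def[symmetric] e unfolding phi_def \<beta>_def P_def by simp
qed

text \<open>On the simply connected \<open>D\<close> a holomorphic function without zeros has a
  logarithm; divided by \<alpha> it is a complex potential whose real part is the height.\<close>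

lemma branch_potential:
  assumes k: "k \<in> Ks"
  shows "\<exists>W. W holomorphic_on D \<and> (\<forall>z\<in>D. (W has_field_derivative (z - u k z) / of_real t) (at z)) \<and>
    (\<forall>z\<in>D. cmod (\<Phi> z (u k z)) = exp (al * Re (W z)))"
proof -
  let ?E = "\<lambda>z. \<Phi> z (u k z)"
  have E: "?E holomorphic_on D"
    unfolding holomorphic_on_open[OF D'(1)] using branch_value_derivative[OF k] by blast
  have nz: "?E z \<noteq> 0" if "z \<in> D" for z using u_not_lam[OF k that] phi_eq_0_iff by auto
  obtain L where L: "L holomorphic_on D" "\<And>z. z \<in> D \<Longrightarrow> ?E z = exp (L z)"
    using simply_connected_imp_holomorphic_log[OF E D'(3) open_imp_locally_path_connected[OF D'(1)] nz] by metis
  have dL: "(L has_field_derivative of_real (al / t) * (z - u k z)) (at z)" if z: "z \<in> D" for z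
  proof -
    have Ld: "(L has_field_derivative deriv L z) (at z)" by (rule holomorphic_derivI[OF L(1) D'(1) z])
    then have "((\<lambda>z. exp (L z)) has_field_derivative exp (L z) * deriv L z) (at z)" by (rule DERIV_fun_exp)
    then have "(?E has_field_derivative exp (L z) * deriv L z) (at z)"
      by (rule has_field_derivative_transform_within_open[OF _ D'(1) z]) (use L(2) in auto)
    then have "exp (L z) * deriv L z = ?E z * (of_real (al / t) * (z - u k z))"
      using branch_value_derivative[OF k z] by (rule DERIV_unique)
    then have "deriv L z = of_real (al / t) * (z - u k z)"
      unfolding L(2)[OF z] by (rule mult_left_cancel[OF exp_not_eq_zero, THEN iffD1])
    then show ?thesis using Ld by simp
  qed
  define W where "W z = L z / of_real al" for z
  have "(W has_field_derivative (z - u k z) / of_real t) (at z)" if z: "z \<in> D" for z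
  proof -
    have "of_real (al / t) * (z - u k z) / of_real al = (z - u k z) / of_real t"
      using al_pos t by (simp add: field_simps)
    then show ?thesis using DERIV_cdivide[OF dL[OF z], of "of_real al"] unfolding W_def[abs_def] by (simp only:)
  qed
  moreover from this have "W holomorphic_on D" unfolding holomorphic_on_open[OF D'(1)] by blast
  moreover have "cmod (\<Phi> z (u k z)) = exp (al * Re (W z))" if "z \<in> D" for z
    using L(2)[OF that] al_pos by (simp add: W_def)
  ultimately show ?thesis by blast
qed

text \<open>The choice is unique up to an imaginary constant, which only translates the chart
  \<open>f\<close> along the imaginary axis.\<close>

definition W :: "nat \<Rightarrow> complex \<Rightarrow> complex" where
  "W k = (SOME W. W holomorphic_on D \<and> (\<forall>z\<in>D. (W has_field_derivative (z - u k z) / of_real t) (at z)) \<and>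
    (\<forall>z\<in>D. cmod (\<Phi> z (u k z)) = exp (al * Re (W z))))"

lemma W_holomorphic: "k \<in> Ks \<Longrightarrow> W k holomorphic_on D"
  and W_derivative: "k \<in> Ks \<Longrightarrow> z \<in> D \<Longrightarrow> (W k has_field_derivative (z - u k z) / of_real t) (at z)"
  and W_height: "k \<in> Ks \<Longrightarrow> z \<in> D \<Longrightarrow> cmod (\<Phi> z (u k z)) = exp (al * Re (W k z))"
  using someI_ex[OF branch_potential] unfolding W_def[symmetric] by blast+

lemma height_u: "k \<in> Ks \<Longrightarrow> z \<in> D \<Longrightarrow> height d lam a t z (u k z) = ereal (Re (W k z))"
  using u_not_lam W_height al_pos by (simp add: height_eq)

lemma W_cont: "k \<in> Ks \<Longrightarrow> S \<subseteq> D \<Longrightarrow> continuous_on S (W k)"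
  using holomorphic_on_imp_continuous_on[OF W_holomorphic] continuous_on_subset by blast

text \<open>Unlike \<open>max_relevant_saddle\<close>, this condition makes sense on \<Gamma>, where
  two heights agree, and it is closed in \<open>z\<close>.\<close>

definition relevant :: "nat \<Rightarrow> complex \<Rightarrow> bool" where
  "relevant k z \<longleftrightarrow> al * Re (W k z) = ln (pass_level z)"

lemma relevant_iff: "k \<in> Ks \<Longrightarrow> z \<in> D \<Longrightarrow> relevant k z \<longleftrightarrow> cmod (\<Phi> z (u k z)) = pass_level z"
  using W_height[of k z] pass_level_pos[of z] unfolding relevant_def by (metis exp_ln ln_exp)

lemma relevant_exists:
  assumes z: "z \<in> D" shows "\<exists>k\<in>Ks. relevant k z"
proof -
  obtain p where p: "cmod (\<Phi> z p) = pass_level z" "deriv (\<Phi> z) p = 0" using critical_point_endcomp[of 1 z] by blast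
  then obtain k where "k \<in> Ks" "p = u k z" using u_surj[OF z critical_saddle] by blast
  then show ?thesis using p relevant_iff z by auto
qed

lemma \<Gamma>_eq: "\<Gamma> = {z \<in> D. Re (W i z) = Re (W j z)}"
  unfolding \<Gamma>_def equal_height_set_def using height_u ijK by auto

lemma heights_distinct:
  assumes kl: "k \<in> Ks" "l \<in> Ks" "k \<noteq> l" and z: "z \<in> D" "z \<notin> \<Gamma>"
  shows "Re (W k z) \<noteq> Re (W l z)"
proof -
  have *: "Re (W k z) \<noteq> Re (W l z)" if "k \<in> Ks" "l \<in> Ks" "k < l" for k l
  proof
    assume eq: "Re (W k z) = Re (W l z)"
    then have "z \<in> equal_height_set d lam a t D u k l"
      unfolding equal_height_set_def using height_u that z by auto
    then have "k = i \<and> l = j" using only_pair[of k l] that by auto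
    then show False using eq z by (auto simp: \<Gamma>_eq)
  qed
  show ?thesis using *[OF kl(1,2)] *[OF kl(2,1)] kl(3) by (cases "k < l") auto
qed

lemma relevant_unique: "k \<in> Ks \<Longrightarrow> l \<in> Ks \<Longrightarrow> z \<in> D \<Longrightarrow> z \<notin> \<Gamma> \<Longrightarrow> relevant k z \<Longrightarrow> relevant l z \<Longrightarrow> k = l"
  using heights_distinct[of k l z] al_pos unfolding relevant_def by (metis mult_cancel_left less_irrefl)

lemma relevant_critical:
  assumes k: "k \<in> Ks" and z: "z \<in> D" "z \<notin> \<Gamma>" and r: "relevant k z"
    and v: "v \<in> saddle_points d lam a t z" "cmod (\<Phi> z v) = pass_level z"
  shows "v = u k z"
proof -
  obtain l where l: "l \<in> Ks" "v = u l z" using u_surj[OF z(1) v(1)] by blast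
  then have "relevant l z" using relevant_iff z v(2) by auto
  then show ?thesis using relevant_unique[OF k l(1) z r] l by simp
qed

lemma max_relevant_eq:
  assumes k: "k \<in> Ks" and z: "z \<in> D" "z \<notin> \<Gamma>" and r: "relevant k z"
  shows "max_relevant_saddle d lam a t z = u k z"
  using max_relevant_saddle_eq[OF u_saddle[OF k z(1)]] relevant_critical[OF k z r] relevant_iff[OF k z(1)] r by blast

definition Z :: "nat \<Rightarrow> complex set" where
  "Z n = {w. poly (heat_poly d lam a t n) w = 0}"

definition wt :: "nat \<Rightarrow> complex \<Rightarrow> real" where
  "wt n w = real (order w (heat_poly d lam a t n)) / (al * real n)"

lemma finite_Z: "finite (Z n)" unfolding Z_def by (rule poly_roots_finite[OF heat_poly_nonzero])

lemma wt_nonneg: "wt n w \<ge> 0" by (simp add: wt_def)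

lemma wt_sum: "(\<Sum>w\<in>Z n. wt n w) \<le> 1"
proof -
  have "(\<Sum>w\<in>Z n. wt n w) = real (\<Sum>w\<in>Z n. order w (heat_poly d lam a t n)) / (al * real n)"
    by (simp add: wt_def sum_divide_distrib)
  also have "(\<Sum>w\<in>Z n. order w (heat_poly d lam a t n)) = total_mult d a * n"
    unfolding Z_def using sum_order_eq_degree[OF heat_poly_nonzero] degree_heat_poly by simp
  finally show ?thesis by simp
qed

lemma wt_weak:
  assumes "continuous_on UNIV \<psi>" "bounded (range \<psi>)"
  shows "(\<lambda>n. \<Sum>w\<in>Z n. wt n w * \<psi> w) \<longlonglongrightarrow> (\<integral>w. \<psi> w \<partial>\<mu>)"
proof -
  have "(\<integral>x. \<psi> x \<partial>zero_measure d lam a t n) = (\<Sum>w\<in>Z n. wt n w * \<psi> w)" for n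
    unfolding Z_def wt_def by (rule integral_zero_measure[OF borel_measurable_continuous_onI[OF assms(1)]])
  moreover have "(\<lambda>n. \<integral>x. \<psi> x \<partial>zero_measure d lam a t n) \<longlonglongrightarrow> (\<integral>w. \<psi> w \<partial>\<mu>)"
    using \<mu> assms unfolding weak_limit_def by blast
  ultimately show ?thesis by simp
qed

text \<open>Off \<Gamma> exactly one saddle lies at the critical level, and it is nondegenerate, so
  \<open>heat_poly_asymptotics\<close> applies. The logarithm of a monic polynomial is the potential
  of its zeros.\<close>

lemma potential_limit:
  assumes k: "k \<in> Ks" and z: "z \<in> D" "z \<notin> \<Gamma>" and r: "relevant k z"
  shows "(\<lambda>n. \<Sum>w\<in>Z n. wt n w * ln (cmod (z - w))) \<longlonglongrightarrow> Re (W k z)"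
proof -
  have uniq: "q = u k z" if "cmod (\<Phi> z q) = pass_level z" "deriv (\<Phi> z) q = 0" for q
    using relevant_critical[OF k z r critical_saddle[OF that] that(1)] .
  have nondeg: "deriv (deriv (\<Phi> z)) (u k z) \<noteq> 0"
    using deriv2_phi[OF u_not_lam[OF k z(1)] saddle_map_u[OF k z(1)]] saddle_nondegenerate[OF k z(1)]
      phi_eq_0_iff[of z "u k z"] u_not_lam[OF k z(1)] al_pos t by simp
  have asy: "(\<lambda>n. ln (cmod (heat_value n z)) / real n) \<longlonglongrightarrow> ln (pass_level z)" "eventually (\<lambda>n. heat_value n z \<noteq> 0) sequentially"
    by (rule heat_poly_asymptotics[OF _ nondeg]; rule uniq; assumption)+
  have "(\<lambda>n. ln (cmod (heat_value n z)) / real n / al) \<longlonglongrightarrow> ln (pass_level z) / al"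
    by (intro tendsto_divide asy(1) tendsto_const) (use al_pos in auto)
  moreover have "ln (pass_level z) / al = Re (W k z)" using r al_pos unfolding relevant_def by (simp add: field_simps)
  moreover have "eventually (\<lambda>n. ln (cmod (heat_value n z)) / real n / al = (\<Sum>w\<in>Z n. wt n w * ln (cmod (z - w)))) sequentially"
    using asy(2)
  proof eventually_elim
    case (elim n)
    then have "ln (cmod (heat_value n z)) = (\<Sum>w\<in>Z n. real (order w (heat_poly d lam a t n)) * ln (cmod (z - w)))"
      unfolding heat_value_def Z_def by (intro ln_cmod_monic_poly monic_heat_poly)
    then show ?case unfolding wt_def by (simp add: sum_divide_distrib mult.commute)
  qed
  ultimately show ?thesis by (simp add: filterlim_cong)
qed

lemma relevant_closed: "k \<in> Ks \<Longrightarrow> S \<subseteq> D \<Longrightarrow> closedin (top_of_set S) {z \<in> S. relevant k z}"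
proof -
  assume kS: "k \<in> Ks" "S \<subseteq> D"
  have "continuous_on S (\<lambda>z. al * Re (W k z) - ln (pass_level z))"
    using pass_level_pos by (intro continuous_intros W_cont kS continuous_on_pass_level) (auto simp: less_imp_neq[symmetric])
  from continuous_closedin_preimage_constant[OF this, of 0] show ?thesis
    by (simp add: relevant_def)
qed

text \<open>Off \<Gamma> the sets on which the various branches are relevant are finitely many,
  disjoint, relatively closed, and cover \<open>S\<close>. Each is therefore open as well as
  closed.\<close>

lemma relevant_constant:
  assumes S: "connected S" "S \<subseteq> D" "S \<inter> \<Gamma> = {}" "S \<noteq> {}"
  obtains k where "k \<in> Ks" "\<And>z. z \<in> S \<Longrightarrow> relevant k z"
proof -
  obtain z0 where z0: "z0 \<in> S" using S(4) by blast
  obtain k where k: "k \<in> Ks" "relevant k z0" using relevant_exists z0 S(2) by blast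
  let ?T = "{z \<in> S. relevant k z}"
  have "S - ?T = (\<Union>l\<in>Ks - {k}. {z \<in> S. relevant l z})"
  proof (intro equalityI subsetI)
    fix z assume z: "z \<in> S - ?T"
    then obtain l where "l \<in> Ks" "relevant l z" using relevant_exists S(2) by blast
    then show "z \<in> (\<Union>l\<in>Ks - {k}. {z \<in> S. relevant l z})" using z by blast
  next
    fix z assume "z \<in> (\<Union>l\<in>Ks - {k}. {z \<in> S. relevant l z})"
    then obtain l where l: "l \<in> Ks" "l \<noteq> k" "z \<in> S" "relevant l z" by blast
    then have "z \<in> D" "z \<notin> \<Gamma>" using S by blast+
    then show "z \<in> S - ?T" using relevant_unique[OF k(1) l(1)] l by blast
  qed
  moreover have "closedin (top_of_set S) (\<Union>l\<in>Ks - {k}. {z \<in> S. relevant l z})"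
    using S(2) by (intro closedin_Union) (auto intro: relevant_closed)
  ultimately have "openin (top_of_set S) ?T"
    unfolding openin_closedin_eq by auto
  then have "?T = S" using S(1) relevant_closed[OF k(1) S(2)] k z0 unfolding connected_clopen by blast
  then show ?thesis using that k(1) by blast
qed

end

lemma locally_null_imp_null:
  fixes \<mu> :: "complex measure"
  assumes sets: "sets \<mu> = sets borel" and prob: "prob_space \<mu>"
    and loc: "\<And>z. z \<in> S \<Longrightarrow> \<exists>V. open V \<and> z \<in> V \<and> measure \<mu> V = 0"
    and A: "A \<in> sets borel" "A \<subseteq> S"
  shows "measure \<mu> A = 0"
proof -
  interpret prob_space \<mu> by (rule prob)
  obtain V where V: "\<And>z. z \<in> S \<Longrightarrow> open (V z) \<and> z \<in> V z \<and> measure \<mu> (V z) = 0" using loc by metis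
  obtain F where F: "F \<subseteq> V ` S" "countable F" "\<Union>F = \<Union>(V ` S)"
    using Lindelof[of "V ` S"] V by blast
  have "X \<in> null_sets \<mu>" if "X \<in> F" for X
  proof -
    have "open X" "measure \<mu> X = 0" using that F(1) V by blast+
    then show ?thesis using sets by (intro null_setsI) (auto simp: emeasure_eq_measure)
  qed
  then have "(\<Union>X\<in>F. X) \<in> null_sets \<mu>" using F(2) by (intro null_sets_UN') auto
  moreover have "A \<subseteq> (\<Union>X\<in>F. X)" using A(2) V F(3) by auto
  ultimately have "A \<in> null_sets \<mu>" using A(1) sets by (auto intro: null_sets_subset)
  then show ?thesis by (simp add: measure_eq_0_null_sets)
qed

section \<open>The conformal chart and the two sides of \<Gamma>\<close>

context saddle_curve begin

definition f :: "complex \<Rightarrow> complex" where "f z = W i z - W j z"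

lemma f_derivative: "z \<in> D \<Longrightarrow> (f has_field_derivative (u j z - u i z) / of_real t) (at z)"
proof -
  assume z: "z \<in> D"
  show ?thesis unfolding f_def[abs_def]
    using DERIV_diff[OF W_derivative[OF ijK(1) z] W_derivative[OF ijK(2) z]] by (simp add: diff_divide_distrib)
qed

lemma f_holomorphic: "f holomorphic_on D"
  unfolding holomorphic_on_open[OF D'(1)] using f_derivative by blast

lemma f_deriv: "z \<in> D \<Longrightarrow> deriv f z = (u j z - u i z) / of_real t"
  using f_derivative by (rule DERIV_imp_deriv)

lemma f_deriv_nonzero: "z \<in> D \<Longrightarrow> deriv f z \<noteq> 0"
  using f_deriv u_distinct[OF ijK(2,1) _ ijK(3)[symmetric]] t by simp

lemma \<Gamma>_eq_f: "\<Gamma> = {z \<in> D. Re (f z) = 0}"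
  unfolding \<Gamma>_eq f_def by auto

lemma f_cont: "S \<subseteq> D \<Longrightarrow> continuous_on S f"
  using holomorphic_on_imp_continuous_on[OF f_holomorphic] continuous_on_subset by blast

text \<open>The lower Lipschitz bound for the inverse, required by the locale
  \<open>potential_limit\<close>, comes from an upper bound for the derivative of
  \<open>f\<close>.\<close>

lemma chart_exists:
  assumes p: "p \<in> D"
  obtains \<kappa> R K where "R > 0" "K > 0" "\<kappa> holomorphic_on ball (f p) R" "\<kappa> ` ball (f p) R \<subseteq> D" "\<kappa> (f p) = p"
    "\<And>v. v \<in> ball (f p) R \<Longrightarrow> f (\<kappa> v) = v"
    "\<And>x y. x \<in> ball (f p) R \<Longrightarrow> y \<in> ball (f p) R \<Longrightarrow> 1 / K * cmod (x - y) \<le> cmod (\<kappa> x - \<kappa> y)"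
proof -
  obtain r where r: "r > 0" "ball p r \<subseteq> D" "open (f ` ball p r)" "inj_on f (ball p r)"
    using has_complex_derivative_locally_invertible[OF f_holomorphic p D'(1) f_deriv_nonzero[OF p]] by blast
  have hol: "f holomorphic_on ball p r" by (rule holomorphic_on_subset[OF f_holomorphic r(2)])
  obtain g where g: "g holomorphic_on (f ` ball p r)" "\<And>z. z \<in> ball p r \<Longrightarrow> deriv f z * deriv g (f z) = 1 \<and> g (f z) = z"
    using holomorphic_has_inverse[OF hol open_ball r(4)] by metis
  \<comment> \<open>Half the radius gives a compact disc inside the domain of injectivity, on which
    the derivative of \<open>f\<close> is bounded.\<close>
  let ?s = "r / 2"
  have s: "cball p ?s \<subseteq> ball p r" "ball p ?s \<subseteq> ball p r" using r(1) by auto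
  have os: "open (f ` ball p ?s)"
    by (rule invariance_of_domain[OF f_cont open_ball inj_on_subset[OF r(4) s(2)]]) (use s r in blast)
  obtain R where R: "R > 0" "ball (f p) R \<subseteq> f ` ball p ?s"
    using os r(1) by (meson centre_in_ball half_gt_zero imageI openE)
  have "continuous_on (cball p ?s) (deriv f)"
    using holomorphic_on_imp_continuous_on[OF holomorphic_deriv[OF hol open_ball]] s(1) continuous_on_subset by blast
  then have "bounded (deriv f ` cball p ?s)" by (intro compact_imp_bounded compact_continuous_image) auto
  then obtain K where K: "K > 0" "\<And>z. z \<in> cball p ?s \<Longrightarrow> cmod (deriv f z) \<le> K" by (force simp: bounded_pos)
  have g2: "g v \<in> ball p ?s \<and> f (g v) = v" if v: "v \<in> ball (f p) R" for v
  proof -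
    obtain z where z: "z \<in> ball p ?s" "v = f z" using v R(2) by blast
    then have "g v = z" using g(2)[of z] s(2) by blast
    then show ?thesis using z by simp
  qed
  show ?thesis
  proof (rule that[OF R(1) K(1)])
    show "g holomorphic_on ball (f p) R" by (rule holomorphic_on_subset[OF g(1)]) (use R(2) s(2) in blast)
    show "g ` ball (f p) R \<subseteq> D" using g2 s(2) r(2) by blast
    show "g (f p) = p" using g(2)[of p] r(1) by simp
    show "f (g v) = v" if "v \<in> ball (f p) R" for v using g2[OF that] by simp
    fix x y assume xy: "x \<in> ball (f p) R" "y \<in> ball (f p) R"
    have "cmod (f (g x) - f (g y)) \<le> K * cmod (g x - g y)"
    proof (rule field_differentiable_bound[OF convex_cball[of p ?s]])
      fix z assume z: "z \<in> cball p ?s"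
      then have "z \<in> ball p r" using s(1) by blast
      then show "(f has_field_derivative deriv f z) (at z within cball p ?s)"
        using holomorphic_derivI[OF hol open_ball] has_field_derivative_at_within by blast
      show "cmod (deriv f z) \<le> K" by (rule K(2)[OF z])
    qed (use g2 xy in \<open>auto simp: less_imp_le\<close>)
    then show "1 / K * cmod (x - y) \<le> cmod (g x - g y)" using g2 xy K(1) by (simp add: field_simps)
  qed
qed

lemma limit_chart:
  assumes \<kappa>: "\<kappa> holomorphic_on ball c R" and m: "m > 0" "\<And>x y. x \<in> ball c R \<Longrightarrow> y \<in> ball c R \<Longrightarrow> m * cmod (x - y) \<le> cmod (\<kappa> x - \<kappa> y)"
    and U: "continuous_on (ball c R) U"
    and relevant: "\<And>v. v \<in> ball c R \<Longrightarrow> Re v \<noteq> Re c \<Longrightarrow> \<exists>k\<in>Ks. \<kappa> v \<in> D \<and> \<kappa> v \<notin> \<Gamma> \<and> relevant k (\<kappa> v) \<and> U v = Re (W k (\<kappa> v))"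
  shows "potential_limit Z wt \<mu> \<kappa> c R m U"
proof (rule potential_limit.intro)
  fix v assume "v \<in> ball c R" "Re v \<noteq> Re c"
  then obtain k where "k \<in> Ks" "\<kappa> v \<in> D" "\<kappa> v \<notin> \<Gamma>" "relevant k (\<kappa> v)" "U v = Re (W k (\<kappa> v))" using relevant by blast
  then show "(\<lambda>n. \<Sum>w\<in>Z n. wt n w * ln (cmod (\<kappa> v - w))) \<longlonglongrightarrow> U v" using potential_limit by simp
qed (rule finite_Z wt_nonneg wt_sum prob sets \<kappa> m(1) U | (rule wt_weak m(2); assumption))+

text \<open>With the identity as chart, the limiting potential is harmonic near every point of
  \<open>S\<close>.\<close>

lemma measure_side_null:
  assumes S: "open S" "S \<subseteq> D" "S \<inter> \<Gamma> = {}" and k: "k \<in> Ks" "\<And>z. z \<in> S \<Longrightarrow> relevant k z"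
  shows "measure \<mu> S = 0"
proof (rule locally_null_imp_null[OF sets prob])
  fix z assume "z \<in> S"
  then obtain R where R: "R > 0" "ball z R \<subseteq> S" using S(1) openE by blast
  interpret potential_limit Z wt \<mu> "\<lambda>v. v" z R 1 "\<lambda>v. Re (W k v)"
  proof (rule limit_chart)
    show "continuous_on (ball z R) (\<lambda>v. Re (W k v))" using R(2) S(2) by (intro continuous_intros W_cont k) blast
    fix v assume "v \<in> ball z R"
    then show "\<exists>k'\<in>Ks. v \<in> D \<and> v \<notin> \<Gamma> \<and> relevant k' v \<and> Re (W k v) = Re (W k' v)" using R(2) S k by blast
  qed (auto intro: holomorphic_intros)
  have "measure \<mu> ((\<lambda>v. v) ` ball z (R / 2)) = 0"
    by (rule measure_ball_harmonic[of "W k"]) (use R S(2) holomorphic_on_subset[OF W_holomorphic[OF k(1)]] in auto)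
  then show "\<exists>V. open V \<and> z \<in> V \<and> measure \<mu> V = 0" using R(1) by (intro exI[of _ "ball z (R / 2)"]) auto
qed (use S(1) in auto)

text \<open>The sides are named by the sign of \<open>Re f\<close>, which is what the chart sees;
  \<open>sides\<close> matches them with \<open>D1\<close> and \<open>D2\<close>.\<close>

definition Dp where "Dp = {z \<in> D. Re (f z) > 0}"
definition Dm where "Dm = {z \<in> D. Re (f z) < 0}"

lemma sign_constant:
  assumes S: "connected S" "S \<subseteq> D" "S \<inter> \<Gamma> = {}"
  shows "S \<subseteq> Dp \<or> S \<subseteq> Dm"
proof (rule ccontr)
  assume "\<not> ?thesis"
  then obtain x y where xy: "x \<in> S" "x \<notin> Dp" "y \<in> S" "y \<notin> Dm" by blast
  then have "Re (f x) \<le> 0" "0 \<le> Re (f y)" using S(2) by (auto simp: Dp_def Dm_def)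
  moreover have "connected ((\<lambda>z. Re (f z)) ` S)" by (intro connected_continuous_image continuous_intros f_cont S)
  ultimately have "0 \<in> (\<lambda>z. Re (f z)) ` S" using xy connected_contains_Icc[of _ "Re (f x)" "Re (f y)"]
    by (meson atLeastAtMost_iff image_eqI subsetD)
  then show False using S by (auto simp: \<Gamma>_eq_f)
qed

text \<open>In the chart, a small real displacement of \<open>f p\<close> in either direction leads
  to the side of the corresponding sign.\<close>

lemma near_curve:
  assumes p: "p \<in> \<Gamma>"
  shows "p \<in> closure Dp" "p \<in> closure Dm"
proof -
  have pD: "p \<in> D" "Re (f p) = 0" using p by (auto simp: \<Gamma>_eq_f)
  obtain \<kappa> R K where c: "R > 0" "\<kappa> holomorphic_on ball (f p) R" "\<kappa> ` ball (f p) R \<subseteq> D" "\<kappa> (f p) = p"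
    "\<And>v. v \<in> ball (f p) R \<Longrightarrow> f (\<kappa> v) = v" using chart_exists[OF pD(1)] by metis
  have "isCont \<kappa> (f p)"
    using holomorphic_on_imp_continuous_on[OF c(2)] c(1) by (simp add: continuous_on_eq_continuous_at)
  then have lim: "(\<lambda>n. \<kappa> (f p + of_real s * of_real (R / real (n + 2)))) \<longlonglongrightarrow> p" for s
  proof (rule isCont_tendsto_compose[of _ \<kappa>, THEN tendsto_eq_rhs])
    have "(\<lambda>n. R / real (n + 2)) \<longlonglongrightarrow> 0" by real_asymp
    then have "(\<lambda>n. f p + of_real s * of_real (R / real (n + 2))) \<longlonglongrightarrow> f p + of_real s * of_real 0"
      by (intro tendsto_intros)
    then show "(\<lambda>n. f p + of_real s * of_real (R / real (n + 2))) \<longlonglongrightarrow> f p" by simp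
  qed (rule c(4))
  have inb: "f p + of_real s * of_real (R / real (n + 2)) \<in> ball (f p) R" if "\<bar>s\<bar> = 1" for s n
  proof -
    have "R / real (n + 2) < R / 1" using c(1) by (intro divide_strict_left_mono) auto
    then show ?thesis using c(1) that by (simp add: dist_norm norm_mult norm_divide del: of_real_divide)
  qed
  have pos: "R / real (n + 2) > 0" for n using c(1) by simp
  have "\<kappa> (f p + of_real 1 * of_real (R / real (n + 2))) \<in> Dp" for n
    using c(3,5) inb[of 1 n] pos[of n] pD(2) unfolding Dp_def by (auto simp del: of_real_divide)
  then show "p \<in> closure Dp" unfolding closure_sequential
    using lim[of 1] by (intro exI[of _ "\<lambda>n. \<kappa> (f p + of_real 1 * of_real (R / real (n + 2)))"] conjI allI)
  have "\<kappa> (f p + of_real (-1) * of_real (R / real (n + 2))) \<in> Dm" for n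
    using c(3,5) inb[of "-1" n] pos[of n] pD(2) unfolding Dm_def by (auto simp del: of_real_divide)
  then show "p \<in> closure Dm" unfolding closure_sequential
    using lim[of "-1"] by (intro exI[of _ "\<lambda>n. \<kappa> (f p + of_real (-1) * of_real (R / real (n + 2)))"] conjI allI)
qed

text \<open>\<open>Re f\<close> keeps its sign on each of \<open>D1\<close> and \<open>D2\<close>,
  and both signs occur next to a point of \<Gamma>, so the two carry opposite signs.\<close>

lemma sides: "Dp = D1 \<and> Dm = D2 \<or> Dp = D2 \<and> Dm = D1"
proof -
  obtain p where p: "p \<in> \<Gamma>" using \<Gamma>_nonempty by blast
  have ne: "Dp \<noteq> {}" "Dm \<noteq> {}" using near_curve[OF p] by auto
  have un: "D1 \<union> D2 = Dp \<union> Dm" using separation by (auto simp: Dp_def Dm_def \<Gamma>_eq_f)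
  have dis: "Dp \<inter> Dm = {}" by (auto simp: Dp_def Dm_def)
  have "D1 \<subseteq> Dp \<or> D1 \<subseteq> Dm" "D2 \<subseteq> Dp \<or> D2 \<subseteq> Dm"
    using sign_constant[of D1] sign_constant[of D2] D1' D2' separation by blast+
  then show ?thesis using un dis ne separation(2) by blast
qed

lemma Dpm: "open Dp" "open Dm" "connected Dp" "connected Dm" "Dp \<noteq> {}" "Dm \<noteq> {}" "Dp \<subseteq> D" "Dm \<subseteq> D" "Dp \<inter> \<Gamma> = {}" "Dm \<inter> \<Gamma> = {}"
  using sides D1' D2' by (auto simp: Dp_def Dm_def \<Gamma>_eq_f)

lemma relevant_closure:
  assumes k: "k \<in> Ks" "\<And>z. z \<in> S \<Longrightarrow> relevant k z" "S \<subseteq> D" and p: "p \<in> D" "p \<in> closure S"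
  shows "relevant k p"
proof -
  obtain C where C: "closed C" "{z \<in> D. relevant k z} = D \<inter> C"
    using relevant_closed[OF k(1) order_refl] unfolding closedin_closed by blast
  then have "S \<subseteq> C" using k by blast
  then have "closure S \<subseteq> C" using C(1) by (rule closure_minimal)
  then show ?thesis using C(2) p by blast
qed

text \<open>By closedness the branches of both sides are relevant at a point of \<Gamma>, so their
  heights agree there, and i, j is the only pair of distinct branches that may have equal
  heights.\<close>

theorem relevant_dichotomy:
  obtains (same) k where "k \<in> Ks" "\<And>z. z \<in> Dp \<union> Dm \<Longrightarrow> relevant k z"
  | (switch) "\<And>z. z \<in> Dp \<Longrightarrow> relevant i z" "\<And>z. z \<in> Dm \<Longrightarrow> relevant j z"
  | (anti) "\<And>z. z \<in> Dp \<Longrightarrow> relevant j z" "\<And>z. z \<in> Dm \<Longrightarrow> relevant i z"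
proof -
  obtain k where k: "k \<in> Ks" "\<And>z. z \<in> Dp \<Longrightarrow> relevant k z" using relevant_constant[OF Dpm(3,7,9,5)] by blast
  obtain l where l: "l \<in> Ks" "\<And>z. z \<in> Dm \<Longrightarrow> relevant l z" using relevant_constant[OF Dpm(4,8,10,6)] by blast
  obtain p where p: "p \<in> \<Gamma>" using \<Gamma>_nonempty by blast
  have pD: "p \<in> D" using p by (simp add: \<Gamma>_eq_f)
  have "relevant k p" "relevant l p"
    using relevant_closure[OF k Dpm(7) pD] relevant_closure[OF l Dpm(8) pD] near_curve[OF p] by blast+
  then have eq: "Re (W k p) = Re (W l p)" using al_pos unfolding relevant_def by (metis mult_cancel_left less_irrefl)
  have "k = l \<or> k = i \<and> l = j \<or> k = j \<and> l = i"
  proof -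
    have "k' = i \<and> l' = j" if "k' \<in> Ks" "l' \<in> Ks" "k' < l'" "Re (W k' p) = Re (W l' p)" for k' l'
    proof -
      have "p \<in> equal_height_set d lam a t D u k' l'"
        unfolding equal_height_set_def using height_u that pD by auto
      then show ?thesis using only_pair[of k' l'] that by auto
    qed
    then show ?thesis using k(1) l(1) eq by (metis linorder_neqE_nat)
  qed
  then show ?thesis using that k l by blast
qed

end

section \<open>The measure of an arc\<close>

text \<open>The local power series also converges for complex arguments in the disc of the same
  radius, so \<gamma> is locally the restriction of a holomorphic function.\<close>

lemma real_analytic_derivative:
  assumes \<gamma>: "real_analytic_on \<gamma> I" and I: "open I"
  shows "\<And>s. s \<in> I \<Longrightarrow> (\<gamma> has_vector_derivative vector_derivative \<gamma> (at s)) (at s)"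
    and "continuous_on I (\<lambda>s. vector_derivative \<gamma> (at s))"
proof -
  have loc: "\<exists>r>0. \<exists>G. continuous_on (ball x r) G \<and> (\<forall>y\<in>ball x r. (\<gamma> has_vector_derivative G y) (at y))" if x: "x \<in> I" for x
  proof -
    obtain r c where r: "r > 0" and c: "\<And>y. \<bar>y - x\<bar> < r \<Longrightarrow> (\<lambda>n. (y - x) ^ n *\<^sub>R c n) sums \<gamma> y"
      using \<gamma> x unfolding real_analytic_on_def by blast
    define F where "F \<zeta> = (\<Sum>n. c n * \<zeta> ^ n)" for \<zeta> :: complex
    have sm: "summable (\<lambda>n. c n * of_real h ^ n)" if "\<bar>h\<bar> < r" for h
    proof -
      have "(\<lambda>n. h ^ n *\<^sub>R c n) sums \<gamma> (x + h)" using c[of "x + h"] that by simp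
      then show ?thesis by (simp add: sums_iff scaleR_conv_of_real mult.commute)
    qed
    have Fd: "(F has_field_derivative (\<Sum>n. diffs c n * \<zeta> ^ n)) (at \<zeta>)" if z: "cmod \<zeta> < r" for \<zeta>
    proof -
      \<comment> \<open>Summability at the single real point \<open>h\<close> gives convergence and
        differentiability on the complex disc of radius h.\<close>
      obtain h where h: "cmod \<zeta> < h" "h < r" using z dense by blast
      have h0: "h > 0" using h(1) norm_ge_zero[of \<zeta>] by linarith
      show ?thesis unfolding F_def[abs_def]
        by (rule termdiffs_strong[where K = "of_real h"]) (use sm[of h] h h0 in auto)
    qed
    have hol: "F holomorphic_on ball 0 r"
      unfolding holomorphic_on_open[OF open_ball] by (intro ballI exI, rule Fd) simp
    have eq: "\<gamma> y = F (of_real (y - x))" if "\<bar>y - x\<bar> < r" for y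
      using c[OF that] unfolding F_def by (simp add: sums_iff scaleR_conv_of_real mult.commute)
    define G where "G y = deriv F (of_real (y - x))" for y
    have "continuous_on (ball x r) G" unfolding G_def
      by (intro continuous_on_compose2[OF holomorphic_on_imp_continuous_on[OF holomorphic_deriv[OF hol open_ball]]] continuous_intros)
        (auto simp: dist_real_def abs_minus_commute simp flip: of_real_diff)
    moreover have "(\<gamma> has_vector_derivative G y) (at y)" if y: "y \<in> ball x r" for y
    proof -
      have "((\<lambda>y. complex_of_real (y - x)) has_vector_derivative 1) (at y)"
        by (auto intro!: derivative_eq_intros)
      moreover have "(F has_field_derivative deriv F (of_real (y - x))) (at (of_real (y - x)))"
        by (rule holomorphic_derivI[OF hol open_ball]) (use y in \<open>auto simp: dist_real_def abs_minus_commute simp flip: of_real_diff\<close>)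
      ultimately have "(F \<circ> (\<lambda>y. complex_of_real (y - x)) has_vector_derivative 1 * deriv F (of_real (y - x))) (at y)"
        by (rule field_vector_diff_chain_at)
      then have "((\<lambda>y. F (of_real (y - x))) has_vector_derivative G y) (at y)" by (simp add: o_def G_def)
      then show ?thesis
        by (rule has_vector_derivative_transform_within_open[OF _ open_ball y])
           (use eq in \<open>auto simp: dist_real_def abs_minus_commute\<close>)
    qed
    ultimately show ?thesis using r by blast
  qed
  show d: "(\<gamma> has_vector_derivative vector_derivative \<gamma> (at s)) (at s)" if "s \<in> I" for s
    using loc[OF that] by (metis centre_in_ball vector_derivative_at)
  show "continuous_on I (\<lambda>s. vector_derivative \<gamma> (at s))"
  proof (rule continuous_at_imp_continuous_on, rule ballI)
    fix x assume "x \<in> I"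
    then obtain r G where r: "r > 0" "continuous_on (ball x r) G" "\<And>y. y \<in> ball x r \<Longrightarrow> (\<gamma> has_vector_derivative G y) (at y)"
      using loc by blast
    have "continuous_on (ball x r) (\<lambda>s. vector_derivative \<gamma> (at s))"
      using r(2) by (rule continuous_on_eq) (metis r(3) vector_derivative_at)
    then show "isCont (\<lambda>s. vector_derivative \<gamma> (at s)) x"
      using r(1) by (simp add: continuous_on_eq_continuous_at)
  qed
qed

section \<open>The limiting potential across \<Gamma>\<close>

context saddle_curve begin

lemma subchart:
  assumes c: "c \<in> ball (f p) (R / 2)" shows "ball c (R / 2) \<subseteq> ball (f p) R"
proof
  fix v assume "v \<in> ball c (R / 2)"
  then have "dist (f p) v \<le> dist (f p) c + dist c v" "dist c v < R / 2" by (auto intro: dist_triangle)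
  then show "v \<in> ball (f p) R" using c by simp
qed

text \<open>Since f(\<kappa> v) = v and Re c = 0, the sides are Re v > 0 and Re v < 0, and the two
  heights differ by s Re v. The values 0, 1 and -1 of \<open>s\<close> serve the three cases of
  \<open>relevant_dichotomy\<close>.\<close>

lemma chart_kink:
  assumes kl: "k \<in> Ks" "l \<in> Ks" and relevant: "\<And>z. z \<in> Dp \<Longrightarrow> relevant k z" "\<And>z. z \<in> Dm \<Longrightarrow> relevant l z"
    and s: "\<And>z. z \<in> D \<Longrightarrow> Re (W k z) - Re (W l z) = s * Re (f z)" and K: "K > 0"
    and \<kappa>: "\<kappa> holomorphic_on ball (f p) R" "\<kappa> ` ball (f p) R \<subseteq> D" "\<And>v. v \<in> ball (f p) R \<Longrightarrow> f (\<kappa> v) = v"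
      "\<And>x y. x \<in> ball (f p) R \<Longrightarrow> y \<in> ball (f p) R \<Longrightarrow> 1 / K * cmod (x - y) \<le> cmod (\<kappa> x - \<kappa> y)"
    and c: "c \<in> ball (f p) (R / 2)" "Re c = 0"
  shows "potential_limit Z wt \<mu> \<kappa> c (R / 2) (1 / K) (\<lambda>v. Re (W l (\<kappa> v)) + s * max (Re (v - c)) 0)"
    and "(\<lambda>v. W l (\<kappa> v)) holomorphic_on ball c (R / 2)"
proof -
  note sub = subchart[OF c(1)]
  have hol: "\<kappa> holomorphic_on ball c (R / 2)" by (rule holomorphic_on_subset[OF \<kappa>(1) sub])
  show W: "(\<lambda>v. W l (\<kappa> v)) holomorphic_on ball c (R / 2)"
    by (rule holomorphic_on_compose_gen[OF hol W_holomorphic[OF kl(2)], unfolded o_def]) (use sub \<kappa>(2) in blast)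
  show "potential_limit Z wt \<mu> \<kappa> c (R / 2) (1 / K) (\<lambda>v. Re (W l (\<kappa> v)) + s * max (Re (v - c)) 0)"
  proof (rule limit_chart[OF hol])
    show "continuous_on (ball c (R / 2)) (\<lambda>v. Re (W l (\<kappa> v)) + s * max (Re (v - c)) 0)"
      by (intro continuous_intros holomorphic_on_imp_continuous_on[OF W])
    fix v assume v: "v \<in> ball c (R / 2)" "Re v \<noteq> Re c"
    then have vb: "v \<in> ball (f p) R" using sub by blast
    have zD: "\<kappa> v \<in> D" using \<kappa>(2) vb by blast
    have fz: "f (\<kappa> v) = v" by (rule \<kappa>(3)[OF vb])
    show "\<exists>k'\<in>Ks. \<kappa> v \<in> D \<and> \<kappa> v \<notin> \<Gamma> \<and> relevant k' (\<kappa> v) \<and> Re (W l (\<kappa> v)) + s * max (Re (v - c)) 0 = Re (W k' (\<kappa> v))"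
    proof (cases "Re v > 0")
      case True
      then have "\<kappa> v \<in> Dp" using zD fz by (simp add: Dp_def)
      then show ?thesis using relevant(1) kl(1) zD s[OF zD] Dpm(9) True c(2) fz by (intro bexI[of _ k]) auto
    next
      case False
      then have "\<kappa> v \<in> Dm" using zD fz v(2) c(2) by (simp add: Dm_def)
      then show ?thesis using relevant(2) kl(2) zD Dpm(10) False c(2) by (intro bexI[of _ l]) auto
    qed
  next
    show "1 / K > 0" using K by simp
  qed (use \<kappa>(4) sub in blast)
qed

lemma Re_f: "Re (f z) = Re (W i z) - Re (W j z)" by (simp add: f_def)

lemma not_anti:
  assumes "\<And>z. z \<in> Dp \<Longrightarrow> relevant j z" "\<And>z. z \<in> Dm \<Longrightarrow> relevant i z"
  shows False
proof -
  obtain p where p: "p \<in> \<Gamma>" using \<Gamma>_nonempty by blast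
  have pD: "p \<in> D" "Re (f p) = 0" using p by (auto simp: \<Gamma>_eq_f)
  obtain \<kappa> R K where c: "R > 0" "K > 0" "\<kappa> holomorphic_on ball (f p) R" "\<kappa> ` ball (f p) R \<subseteq> D"
    "\<And>v. v \<in> ball (f p) R \<Longrightarrow> f (\<kappa> v) = v"
    "\<And>x y. x \<in> ball (f p) R \<Longrightarrow> y \<in> ball (f p) R \<Longrightarrow> 1 / K * cmod (x - y) \<le> cmod (\<kappa> x - \<kappa> y)"
    using chart_exists[OF pD(1)] by metis
  have cen: "f p \<in> ball (f p) (R / 2)" using c(1) by simp
  have s: "Re (W j z) - Re (W i z) = (-1) * Re (f z)" for z by (simp add: Re_f)
  note ck = chart_kink[where s = "-1", OF ijK(2,1) assms s c(2-6) cen pD(2)]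
  show False
    by (rule potential_limit.no_negative_kink[OF ck(1) ck(2)]) (use c(1) in auto)
qed

lemma curve_null:
  assumes k: "k \<in> Ks" "\<And>z. z \<in> Dp \<union> Dm \<Longrightarrow> relevant k z"
  shows "measure \<mu> \<Gamma> = 0"
proof (rule locally_null_imp_null[OF sets prob, of \<Gamma>])
  fix p assume p: "p \<in> \<Gamma>"
  have pD: "p \<in> D" "Re (f p) = 0" using p by (auto simp: \<Gamma>_eq_f)
  obtain \<kappa> R K where c: "R > 0" "K > 0" "\<kappa> holomorphic_on ball (f p) R" "\<kappa> ` ball (f p) R \<subseteq> D"
    "\<And>v. v \<in> ball (f p) R \<Longrightarrow> f (\<kappa> v) = v"
    "\<And>x y. x \<in> ball (f p) R \<Longrightarrow> y \<in> ball (f p) R \<Longrightarrow> 1 / K * cmod (x - y) \<le> cmod (\<kappa> x - \<kappa> y)"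
    and \<kappa>p: "\<kappa> (f p) = p"
    using chart_exists[OF pD(1)] by metis
  have cen: "f p \<in> ball (f p) (R / 2)" using c(1) by simp
  have r: "\<And>z. z \<in> Dp \<Longrightarrow> relevant k z" "\<And>z. z \<in> Dm \<Longrightarrow> relevant k z" using k(2) by auto
  have s: "Re (W k z) - Re (W k z) = 0 * Re (f z)" for z by simp
  note ck = chart_kink[where s = 0, OF k(1) k(1) r s c(2-6) cen pD(2)]
  interpret potential_limit Z wt \<mu> \<kappa> "f p" "R / 2" "1 / K" "\<lambda>v. Re (W k (\<kappa> v)) + 0 * max (Re (v - f p)) 0" by (rule ck(1))
  have "measure \<mu> (\<kappa> ` ball (f p) (R / 4)) = 0"
    by (rule measure_ball_harmonic[OF ck(2)]) (use c(1) in auto)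
  moreover have "open (\<kappa> ` ball (f p) (R / 4))"
  proof (rule invariance_of_domain[OF _ open_ball])
    have sb: "ball (f p) (R / 4) \<subseteq> ball (f p) (R / 2)" using c(1) by (intro subset_ball) simp
    show "inj_on \<kappa> (ball (f p) (R / 4))" by (rule inj_on_subset[OF inj sb])
    show "continuous_on (ball (f p) (R / 4)) \<kappa>"
      by (rule continuous_on_subset[OF holomorphic_on_imp_continuous_on[OF c(3)]]) (use c(1) in auto)
  qed
  moreover have "p \<in> \<kappa> ` ball (f p) (R / 4)" using \<kappa>p c(1) by (intro image_eqI[of _ _ "f p"]) auto
  ultimately show "\<exists>V. open V \<and> p \<in> V \<and> measure \<mu> V = 0" by blast
next
  have "\<Gamma> = D - (Dp \<union> Dm)" by (auto simp: \<Gamma>_eq_f Dp_def Dm_def)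
  then show "\<Gamma> \<in> sets borel" using D'(1) Dpm(1,2) by simp
qed auto

lemma \<Gamma>_borel: "\<Gamma> \<in> sets borel"
proof -
  have "\<Gamma> = D - (Dp \<union> Dm)" by (auto simp: \<Gamma>_eq_f Dp_def Dm_def)
  then show "\<Gamma> \<in> sets borel" using D'(1) Dpm(1,2) by simp
qed

text \<open>A single relevant branch would have to coincide with \<open>u i\<close> at a point of
  one side and with \<open>u j\<close> at a point of the other, while distinct branches never
  meet.\<close>

lemma no_switch:
  assumes k: "k \<in> Ks" "\<And>z. z \<in> Dp \<union> Dm \<Longrightarrow> relevant k z"
  shows "\<not> branch_switches d lam a t u i j D1 D2"
proof
  assume b: "branch_switches d lam a t u i j D1 D2"
  have un: "D1 \<union> D2 = Dp \<union> Dm" using sides by auto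
  have m: "max_relevant_saddle d lam a t z = u k z \<and> z \<in> D" if "z \<in> D1 \<union> D2" for z
  proof -
    have "z \<in> Dp \<union> Dm" using that un by simp
    then have "z \<in> D" "z \<notin> \<Gamma>" "relevant k z" using Dpm k(2) by blast+
    then show ?thesis using max_relevant_eq[OF k(1)] by blast
  qed
  obtain z1 z2 where z: "z1 \<in> D1" "z2 \<in> D2" using D1' D2' by blast
  have "u k z1 = u i z1 \<and> u k z2 = u j z2 \<or> u k z1 = u j z1 \<and> u k z2 = u i z2"
    using b z m[of z1] m[of z2] unfolding branch_switches_def by auto
  then show False using u_distinct[OF k(1) ijK(1), of z1] u_distinct[OF k(1) ijK(2), of z1]
      u_distinct[OF k(1) ijK(1), of z2] u_distinct[OF k(1) ijK(2), of z2] m z ijK(3) by (metis UnI1 UnI2)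
qed

lemma switch_switches:
  assumes "\<And>z. z \<in> Dp \<Longrightarrow> relevant i z" "\<And>z. z \<in> Dm \<Longrightarrow> relevant j z"
  shows "branch_switches d lam a t u i j D1 D2"
proof -
  have "max_relevant_saddle d lam a t z = u i z" if "z \<in> Dp" for z
    using max_relevant_eq[OF ijK(1)] assms(1)[OF that] that Dpm(7,9) by blast
  moreover have "max_relevant_saddle d lam a t z = u j z" if "z \<in> Dm" for z
    using max_relevant_eq[OF ijK(2)] assms(2)[OF that] that Dpm(8,10) by blast
  ultimately show ?thesis unfolding branch_switches_def using sides by blast
qed

end

section \<open>The switching case\<close>

locale switching_curve = saddle_curve +
  assumes relevant_i: "\<And>z. z \<in> Dp \<Longrightarrow> relevant i z" and relevant_j: "\<And>z. z \<in> Dm \<Longrightarrow> relevant j z"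
begin

lemma sides_null: "measure \<mu> (Dp \<union> Dm) = 0"
proof -
  interpret prob_space \<mu> by (rule prob)
  have "measure \<mu> Dp = 0" "measure \<mu> Dm = 0"
    using measure_side_null[OF Dpm(1,7,9) ijK(1) relevant_i] measure_side_null[OF Dpm(2,8,10) ijK(2) relevant_j] by auto
  moreover have "measure \<mu> (Dp \<union> Dm) \<le> measure \<mu> Dp + measure \<mu> Dm"
    using Dpm(1,2) sets by (intro measure_Un_le) auto
  ultimately show ?thesis using measure_nonneg[of \<mu> "Dp \<union> Dm"] by linarith
qed

text \<open>The sides are null sets, so the full mass r/\<pi> of a chart disc lies on \<Gamma>. The
  centre varies along the axis near \<open>f p\<close> because every short arc of \<Gamma> is cut
  out by such a disc.\<close>

lemma curve_chart:
  assumes p: "p \<in> \<Gamma>"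
  obtains \<kappa> R where "R > 0" "\<kappa> (f p) = p" "open (\<kappa> ` ball (f p) R)" "\<kappa> ` ball (f p) R \<subseteq> D" "\<And>v. v \<in> ball (f p) R \<Longrightarrow> f (\<kappa> v) = v"
    "\<And>c r. c \<in> ball (f p) R \<Longrightarrow> Re c = 0 \<Longrightarrow> 0 < r \<Longrightarrow> r < R \<Longrightarrow> ball c r \<subseteq> ball (f p) R \<Longrightarrow> measure \<mu> (\<Gamma> \<inter> \<kappa> ` ball c r) = r / pi"
proof -
  interpret P: prob_space \<mu> by (rule prob)
  have pD: "p \<in> D" "Re (f p) = 0" using p by (auto simp: \<Gamma>_eq_f)
  obtain \<kappa> R K where c: "R > 0" "K > 0" "\<kappa> holomorphic_on ball (f p) R" "\<kappa> ` ball (f p) R \<subseteq> D"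
    "\<And>v. v \<in> ball (f p) R \<Longrightarrow> f (\<kappa> v) = v"
    "\<And>x y. x \<in> ball (f p) R \<Longrightarrow> y \<in> ball (f p) R \<Longrightarrow> 1 / K * cmod (x - y) \<le> cmod (\<kappa> x - \<kappa> y)"
    and \<kappa>p: "\<kappa> (f p) = p"
    using chart_exists[OF pD(1)] by metis
  have s: "Re (W i z) - Re (W j z) = 1 * Re (f z)" for z by (simp add: Re_f)
  have sb: "ball (f p) (R / 2) \<subseteq> ball (f p) R" using c(1) by (intro subset_ball) simp
  have ij': "inj_on \<kappa> (ball (f p) R)" using c(5) by (rule inj_on_inverseI)
  show ?thesis
  proof (rule that[of "R / 2" \<kappa>])
    show "open (\<kappa> ` ball (f p) (R / 2))"
      by (rule invariance_of_domain[OF continuous_on_subset[OF holomorphic_on_imp_continuous_on[OF c(3)] sb] open_ball inj_on_subset[OF ij' sb]])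
    fix cc r assume cc: "cc \<in> ball (f p) (R / 2)" "Re cc = 0" and r: "0 < r" "r < R / 2"
    note ck = chart_kink[where s = 1, OF ijK(1,2) relevant_i relevant_j s c(2-6) cc]
    interpret potential_limit Z wt \<mu> \<kappa> cc "R / 2" "1 / K" "\<lambda>v. Re (W j (\<kappa> v)) + 1 * max (Re (v - cc)) 0" by (rule ck(1))
    have m: "measure \<mu> (\<kappa> ` ball cc r) = r / pi"
      by (rule measure_ball_kink[OF ck(2) refl r])
    have b: "\<kappa> ` ball cc r \<in> sets borel" by (rule image_ball_borel) (use r in simp)
    have "\<kappa> ` ball cc r \<subseteq> D" using c(4) subchart[OF cc(1)] r subset_ball[of r "R / 2" cc] by fastforce
    then have sub: "\<kappa> ` ball cc r \<subseteq> (\<Gamma> \<inter> \<kappa> ` ball cc r) \<union> (Dp \<union> Dm)"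
      by (auto simp: \<Gamma>_eq_f Dp_def Dm_def)
    have sets': "\<Gamma> \<inter> \<kappa> ` ball cc r \<in> sets \<mu>" "Dp \<union> Dm \<in> sets \<mu>" "\<kappa> ` ball cc r \<in> sets \<mu>"
      using sets b \<Gamma>_borel Dpm(1,2) by auto
    have "measure \<mu> (\<kappa> ` ball cc r) \<le> measure \<mu> ((\<Gamma> \<inter> \<kappa> ` ball cc r) \<union> (Dp \<union> Dm))"
      using sets' sub by (intro P.finite_measure_mono) auto
    also have "\<dots> \<le> measure \<mu> (\<Gamma> \<inter> \<kappa> ` ball cc r) + measure \<mu> (Dp \<union> Dm)"
      using sets' by (intro measure_Un_le) auto
    finally have "measure \<mu> (\<kappa> ` ball cc r) \<le> measure \<mu> (\<Gamma> \<inter> \<kappa> ` ball cc r)" using sides_null by simp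
    moreover have "measure \<mu> (\<Gamma> \<inter> \<kappa> ` ball cc r) \<le> measure \<mu> (\<kappa> ` ball cc r)"
      using sets' by (intro P.finite_measure_mono) auto
    ultimately show "measure \<mu> (\<Gamma> \<inter> \<kappa> ` ball cc r) = r / pi" using m by simp
  qed (use c(1,4,5) sb \<kappa>p in auto)
qed

lemma curve_positive: "measure \<mu> \<Gamma> > 0"
proof -
  interpret P: prob_space \<mu> by (rule prob)
  obtain p where p: "p \<in> \<Gamma>" using \<Gamma>_nonempty by blast
  obtain \<kappa> R where c: "R > 0" 
    "\<And>c r. c \<in> ball (f p) R \<Longrightarrow> Re c = 0 \<Longrightarrow> 0 < r \<Longrightarrow> r < R \<Longrightarrow> ball c r \<subseteq> ball (f p) R \<Longrightarrow> measure \<mu> (\<Gamma> \<inter> \<kappa> ` ball c r) = r / pi"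
    using curve_chart[OF p] by metis
  have "measure \<mu> (\<Gamma> \<inter> \<kappa> ` ball (f p) (R / 2)) = R / 2 / pi"
    by (rule c(2)) (use c(1) p in \<open>auto simp: \<Gamma>_eq_f\<close>)
  moreover have "measure \<mu> (\<Gamma> \<inter> \<kappa> ` ball (f p) (R / 2)) \<le> measure \<mu> \<Gamma>"
    using \<Gamma>_borel sets by (intro P.finite_measure_mono) auto
  moreover have "R / 2 / pi > 0" using c(1) by simp
  ultimately show ?thesis by linarith
qed

end

lemma strict_between_inj:
  fixes g :: "real \<Rightarrow> real"
  assumes g: "continuous_on {x..y} g" "inj_on g {x..y}" and s: "x < s" "s < y"
  shows "min (g x) (g y) < g s \<and> g s < max (g x) (g y)"
  using continuous_inj_imp_mono[OF s g] by auto

lemma image_open_interval_inj: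
  fixes g :: "real \<Rightarrow> real"
  assumes g: "continuous_on {x..y} g" "inj_on g {x..y}" and xy: "x < y"
  shows "g ` {x<..<y} = {min (g x) (g y)<..<max (g x) (g y)}"
proof (intro equalityI subsetI)
  fix v assume "v \<in> g ` {x<..<y}"
  then show "v \<in> {min (g x) (g y)<..<max (g x) (g y)}" using strict_between_inj[OF g] by auto
next
  fix v assume v: "v \<in> {min (g x) (g y)<..<max (g x) (g y)}"
  have "\<exists>s. x \<le> s \<and> s \<le> y \<and> g s = v"
    using v xy g(1) IVT'[of g x v y] IVT2'[of g y v x] by (cases "g x \<le> g y") auto
  then obtain s where s: "x \<le> s" "s \<le> y" "g s = v" by blast
  then have "s \<noteq> x" "s \<noteq> y" using v by auto
  then show "v \<in> g ` {x<..<y}" using s by auto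
qed

section \<open>Comparison with arc length\<close>

context switching_curve begin

definition "\<rho> z = cmod (u i z - u j z) / (2 * pi * t)"

context
  fixes \<gamma> :: "real \<Rightarrow> complex" and I :: "real set"
  assumes par: "analytic_parametrization \<gamma> I \<Gamma>"
begin

abbreviation "\<gamma>' s \<equiv> vector_derivative \<gamma> (at s)"
text \<open>\<open>f\<close> maps \<Gamma> into the imaginary axis, so this is the chart coordinate
  along the curve.\<close>

definition "\<tau> s = Im (f (\<gamma> s))"
definition "\<tau>' s = Im (\<gamma>' s * deriv f (\<gamma> s))"
lemma I_open: "open I" and I_interval: "is_interval I" and I_ne: "I \<noteq> {}" and \<gamma>_inj: "inj_on \<gamma> I" and \<gamma>_image: "\<gamma> ` I = \<Gamma>"
  and \<gamma>'_nz: "s \<in> I \<Longrightarrow> \<gamma>' s \<noteq> 0"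
  using par unfolding analytic_parametrization_def by auto

lemma \<gamma>_deriv: "s \<in> I \<Longrightarrow> (\<gamma> has_vector_derivative \<gamma>' s) (at s)"
  and \<gamma>'_cont: "continuous_on I \<gamma>'"
  using real_analytic_derivative[OF _ I_open] par unfolding analytic_parametrization_def by auto

lemma \<gamma>_cont: "continuous_on I \<gamma>"
  using \<gamma>_deriv by (intro continuous_at_imp_continuous_on ballI) (rule has_vector_derivative_continuous)

lemma \<gamma>_in: "s \<in> I \<Longrightarrow> \<gamma> s \<in> \<Gamma>" "s \<in> I \<Longrightarrow> \<gamma> s \<in> D"
  using \<gamma>_image by (auto simp: \<Gamma>_eq_f)

lemma f_\<gamma>: "s \<in> I \<Longrightarrow> f (\<gamma> s) = \<i> * of_real (\<tau> s)"
  using \<gamma>_in(1)[of s] by (auto simp: \<Gamma>_eq_f \<tau>_def complex_eq_iff)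

lemma f_\<gamma>_deriv: "s \<in> I \<Longrightarrow> ((\<lambda>s. f (\<gamma> s)) has_vector_derivative \<gamma>' s * deriv f (\<gamma> s)) (at s)"
proof -
  assume s: "s \<in> I"
  have "(f \<circ> \<gamma> has_vector_derivative \<gamma>' s * deriv f (\<gamma> s)) (at s)"
    by (rule field_vector_diff_chain_at[OF \<gamma>_deriv[OF s] holomorphic_derivI[OF f_holomorphic D'(1) \<gamma>_in(2)[OF s]]])
  then show ?thesis by (simp add: o_def)
qed

lemma \<tau>_deriv: "s \<in> I \<Longrightarrow> (\<tau> has_real_derivative \<tau>' s) (at s)"
  unfolding has_real_derivative_iff_has_vector_derivative \<tau>_def[abs_def] \<tau>'_def
  using bounded_linear.has_vector_derivative[OF bounded_linear_Im f_\<gamma>_deriv] .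

text \<open>\<open>Re f\<close> vanishes along \<gamma>, so the derivative of f \<circ> \<gamma> is
  purely imaginary and loses nothing in the imaginary part. The factor |f'| = |u_i - u_j|/t equals
  2\<pi> times the claimed density.\<close>

lemma \<tau>'_abs: assumes s: "s \<in> I" shows "\<bar>\<tau>' s\<bar> = 2 * pi * (\<rho> (\<gamma> s) * cmod (\<gamma>' s))" "\<tau>' s \<noteq> 0"
proof -
  have "((\<lambda>s. Re (f (\<gamma> s))) has_vector_derivative Re (\<gamma>' s * deriv f (\<gamma> s))) (at s)"
    by (rule bounded_linear.has_vector_derivative[OF bounded_linear_Re f_\<gamma>_deriv[OF s]])
  moreover have "((\<lambda>s. Re (f (\<gamma> s))) has_vector_derivative 0) (at s)"
    by (rule has_vector_derivative_transform_within_open[OF has_vector_derivative_const I_open s])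
       (use f_\<gamma> in simp)
  ultimately have "Re (\<gamma>' s * deriv f (\<gamma> s)) = 0" using vector_derivative_unique_at by blast
  then have "\<bar>\<tau>' s\<bar> = cmod (\<gamma>' s * deriv f (\<gamma> s))" unfolding \<tau>'_def by (simp add: cmod_def)
  also have "\<dots> = cmod (\<gamma>' s) * (cmod (u j (\<gamma> s) - u i (\<gamma> s)) / t)"
    unfolding norm_mult f_deriv[OF \<gamma>_in(2)[OF s]] using t by (simp add: norm_divide)
  finally show 1: "\<bar>\<tau>' s\<bar> = 2 * pi * (\<rho> (\<gamma> s) * cmod (\<gamma>' s))"
    unfolding \<rho>_def by (simp add: norm_minus_commute)
  have "\<bar>\<tau>' s\<bar> = cmod (\<gamma>' s * deriv f (\<gamma> s))" by fact
  then show "\<tau>' s \<noteq> 0" using \<gamma>'_nz[OF s] f_deriv_nonzero[OF \<gamma>_in(2)[OF s]] by auto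
qed

lemma Icc_sub: "x \<in> I \<Longrightarrow> y \<in> I \<Longrightarrow> {x..y} \<subseteq> I"
  by (rule connected_contains_Icc[OF is_interval_connected[OF I_interval]])

lemma \<tau>_cont: "continuous_on I \<tau>"
  using \<tau>_deriv by (intro continuous_at_imp_continuous_on ballI DERIV_isCont)

lemma \<tau>_inj: "inj_on \<tau> I"
proof -
  have *: "\<tau> x \<noteq> \<tau> y" if xy: "x \<in> I" "y \<in> I" "x < y" for x y
  proof
    assume eq: "\<tau> x = \<tau> y"
    have "\<exists>z. x < z \<and> z < y \<and> \<tau> y - \<tau> x = (y - x) * \<tau>' z"
      using Icc_sub[OF xy(1,2)] by (intro MVT2 xy(3) \<tau>_deriv) auto
    then obtain z where "x < z" "z < y" "(y - x) * \<tau>' z = 0" using eq by auto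
    then show False using \<tau>'_abs(2)[of z] subsetD[OF Icc_sub[OF xy(1,2)], of z] xy(3) by auto
  qed
  show ?thesis by (rule inj_onI) (metis * linorder_neqE)
qed

text \<open>\<open>\<tau>'\<close> is continuous without zeros, so it keeps its sign on the
  interval, and the integral of its modulus is the modulus of the increment of \<tau>.\<close>

lemma arc_length_integral:
  assumes xy: "x \<in> I" "y \<in> I" "x < y"
  shows "((\<lambda>s. \<rho> (\<gamma> s) * cmod (\<gamma>' s)) has_integral \<bar>\<tau> y - \<tau> x\<bar> / (2 * pi)) {x<..<y}"
proof -
  have sub: "{x..y} \<subseteq> I" by (rule Icc_sub[OF xy(1,2)])
  have int: "(\<tau>' has_integral \<tau> y - \<tau> x) {x..y}"
  proof (rule fundamental_theorem_of_calculus)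
    fix s assume "s \<in> {x..y}"
    then have "(\<tau> has_real_derivative \<tau>' s) (at s)" using sub \<tau>_deriv by blast
    then show "(\<tau> has_vector_derivative \<tau>' s) (at s within {x..y})"
      unfolding has_real_derivative_iff_has_vector_derivative by (rule has_vector_derivative_at_within)
  qed (use xy in simp)
  have mono: "(\<forall>s\<in>{x..y}. \<tau>' s > 0) \<or> (\<forall>s\<in>{x..y}. \<tau>' s < 0)"
  proof (rule ccontr)
    assume "\<not> ?thesis"
    then obtain r s where rs: "r \<in> {x..y}" "s \<in> {x..y}" "\<tau>' r \<le> 0" "0 \<le> \<tau>' s" by force
    have "connected (\<tau>' ` {x..y})"
    proof (rule connected_continuous_image)
      have cd: "continuous_on D (deriv f)" by (intro holomorphic_on_imp_continuous_on holomorphic_deriv f_holomorphic D'(1))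
      have "continuous_on I (\<lambda>s. deriv f (\<gamma> s))" by (rule continuous_on_compose2[OF cd \<gamma>_cont]) (use \<gamma>_in in auto)
      then show "continuous_on {x..y} \<tau>'" unfolding \<tau>'_def
        by (intro continuous_on_subset[OF _ sub] continuous_intros \<gamma>'_cont)
    qed simp
    then have "{\<tau>' r..\<tau>' s} \<subseteq> \<tau>' ` {x..y}" by (rule connected_contains_Icc) (use rs in auto)
    then have "0 \<in> \<tau>' ` {x..y}" using rs(3,4) by auto
    then show False using \<tau>'_abs(2) sub by auto
  qed
  have "((\<lambda>s. \<bar>\<tau>' s\<bar>) has_integral \<bar>\<tau> y - \<tau> x\<bar>) {x..y}"
  proof (cases "\<forall>s\<in>{x..y}. \<tau>' s > 0")
    case True
    have "\<tau> y - \<tau> x \<ge> 0" by (rule has_integral_nonneg[OF int]) (use True in \<open>auto intro: less_imp_le\<close>)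
    then have e: "\<bar>\<tau> y - \<tau> x\<bar> = \<tau> y - \<tau> x" by simp
    show ?thesis unfolding e by (rule has_integral_eq[OF _ int]) (metis True abs_of_pos)
  next
    case False
    then have neg: "\<forall>s\<in>{x..y}. \<tau>' s < 0" using mono by blast
    have "- (\<tau> y - \<tau> x) \<ge> 0" by (rule has_integral_nonneg[OF has_integral_neg[OF int]]) (use neg in \<open>auto intro: less_imp_le\<close>)
    then have e: "\<bar>\<tau> y - \<tau> x\<bar> = - (\<tau> y - \<tau> x)" by simp
    show ?thesis unfolding e by (rule has_integral_eq[OF _ has_integral_neg[OF int]]) (metis neg abs_of_neg)
  qed
  from has_integral_divide[OF this, of "2 * pi"]
  have "((\<lambda>s. \<rho> (\<gamma> s) * cmod (\<gamma>' s)) has_integral \<bar>\<tau> y - \<tau> x\<bar> / (2 * pi)) {x..y}"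
    by (rule has_integral_eq[rotated]) (use \<tau>'_abs(1) sub in auto)
  then show ?thesis by (simp add: has_integral_Icc_iff_Ioo)
qed

text \<open>Unfolding both densities leads to an integral over the parameter interval; injectivity
  of \<gamma> turns the indicator of the arc into that of the interval.\<close>

lemma length_density_interval:
  assumes xy: "x \<in> I" "y \<in> I" "x < y" and meas: "\<gamma> ` {x<..<y} \<in> sets borel"
  shows "emeasure (density (length_measure \<gamma> I) (\<lambda>z. ennreal (\<rho> z))) (\<gamma> ` {x<..<y}) = ennreal (\<bar>\<tau> y - \<tau> x\<bar> / (2 * pi))"
proof -
  let ?A = "\<gamma> ` {x<..<y}"
  have sub: "{x<..<y} \<subseteq> I" using Icc_sub[OF xy(1,2)] by auto
  have I_sets: "I \<in> sets borel" using I_open by simp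
  have sI: "sets (restrict_space lborel I) = sets (restrict_space borel I)"
    by (rule sets_restrict_space_cong) simp
  have m\<gamma>: "\<gamma> \<in> measurable (restrict_space borel I) (restrict_space borel (\<gamma> ` I))"
    by (rule measurable_restrict_space2) (auto simp: space_restrict_space intro: borel_measurable_continuous_on_restrict \<gamma>_cont)
  have m\<gamma>': "(\<lambda>s. ennreal (cmod (\<gamma>' s))) \<in> borel_measurable (restrict_space lborel I)"
    unfolding measurable_cong_sets[OF sI refl]
    by (intro measurable_compose[OF _ measurable_ennreal] borel_measurable_continuous_on_restrict continuous_intros \<gamma>'_cont)
  have "continuous_on \<Gamma> \<rho>"
  proof -
    have "continuous_on D (u i)" "continuous_on D (u j)"
      using u_holomorphic ijK holomorphic_on_imp_continuous_on by auto
    then have "continuous_on D \<rho>" unfolding \<rho>_def using t by (intro continuous_intros) auto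
    then show ?thesis by (rule continuous_on_subset) (auto simp: \<Gamma>_eq_f)
  qed
  then have m\<rho>: "(\<lambda>z. ennreal (\<rho> z)) \<in> borel_measurable (restrict_space borel (\<gamma> ` I))"
    unfolding \<gamma>_image by (intro measurable_compose[OF _ measurable_ennreal] borel_measurable_continuous_on_restrict)
  have A: "?A \<in> sets (restrict_space borel (\<gamma> ` I))"
    using meas sub by (auto simp: sets_restrict_space intro!: image_eqI[of _ _ ?A])
  let ?M = "density (restrict_space lborel I) (\<lambda>s. ennreal (cmod (\<gamma>' s)))"
  have m1: "\<gamma> \<in> measurable ?M (restrict_space borel (\<gamma> ` I))"
    using m\<gamma> by (simp add: measurable_cong_sets[OF sI refl])
  have sl: "sets (length_measure \<gamma> I) = sets (restrict_space borel (\<gamma> ` I))" by (simp add: length_measure_def)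
  have "emeasure (density (length_measure \<gamma> I) (\<lambda>z. ennreal (\<rho> z))) ?A = (\<integral>\<^sup>+z. ennreal (\<rho> z) * indicator ?A z \<partial>length_measure \<gamma> I)"
    by (rule emeasure_density) (use m\<rho> A in \<open>simp_all add: sl measurable_cong_sets[OF sl refl]\<close>)
  also have "\<dots> = (\<integral>\<^sup>+s. ennreal (\<rho> (\<gamma> s)) * indicator ?A (\<gamma> s) \<partial>?M)"
    unfolding length_measure_def using m\<rho> A
    by (intro nn_integral_distr[OF m1] borel_measurable_times_ennreal borel_measurable_indicator) auto
  also have "\<dots> = (\<integral>\<^sup>+s. ennreal (cmod (\<gamma>' s)) * (ennreal (\<rho> (\<gamma> s)) * indicator ?A (\<gamma> s)) \<partial>restrict_space lborel I)"
  proof (rule nn_integral_density[OF m\<gamma>'])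
    have "(\<lambda>z. ennreal (\<rho> z) * indicator ?A z) \<in> borel_measurable (restrict_space borel (\<gamma> ` I))"
      using m\<rho> A by (intro borel_measurable_times_ennreal borel_measurable_indicator) auto
    then show "(\<lambda>s. ennreal (\<rho> (\<gamma> s)) * indicator ?A (\<gamma> s)) \<in> borel_measurable (restrict_space lborel I)"
      unfolding measurable_cong_sets[OF sI refl] by (rule measurable_compose[OF m\<gamma>])
  qed
  also have "\<dots> = (\<integral>\<^sup>+s. ennreal (cmod (\<gamma>' s)) * (ennreal (\<rho> (\<gamma> s)) * indicator ?A (\<gamma> s)) * indicator I s \<partial>lborel)"
    by (rule nn_integral_restrict_space) (use I_sets in simp)
  also have "\<dots> = (\<integral>\<^sup>+s. ennreal (indicator {x<..<y} s * (\<rho> (\<gamma> s) * cmod (\<gamma>' s))) \<partial>lborel)"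
  proof (intro nn_integral_cong)
    fix s
    show "ennreal (cmod (\<gamma>' s)) * (ennreal (\<rho> (\<gamma> s)) * indicator ?A (\<gamma> s)) * indicator I s = ennreal (indicator {x<..<y} s * (\<rho> (\<gamma> s) * cmod (\<gamma>' s)))"
    proof (cases "s \<in> I")
      case True
      then have "\<gamma> s \<in> ?A \<longleftrightarrow> s \<in> {x<..<y}" using \<gamma>_inj sub by (auto dest: inj_onD)
      moreover have "\<rho> (\<gamma> s) \<ge> 0" using t by (simp add: \<rho>_def)
      ultimately show ?thesis using True by (auto simp: indicator_def ennreal_mult mult.commute)
    next
      case False
      then have "s \<notin> {x<..<y}" using sub by blast
      then show ?thesis using False by (auto simp: indicator_def)
    qed
  qed
  also have "\<dots> = ennreal (\<bar>\<tau> y - \<tau> x\<bar> / (2 * pi))"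
    by (rule nn_integral_has_integral_lebesgue[OF _ arc_length_integral[OF xy]]) (use t in \<open>simp add: \<rho>_def\<close>)
  finally show ?thesis .
qed

text \<open>Between nearby parameters the arc is the part of \<Gamma> in the chart disc with
  diameter from i \<tau>(x) to i \<tau>(y). Its radius r is |\<tau>(y) - \<tau>(x)|/2, and
  \<open>curve_chart\<close> assigns it the mass r/\<pi>.\<close>

lemma local_arc_measure:
  assumes s0: "s0 \<in> I"
  obtains \<delta> where "\<delta> > 0" "{s0 - \<delta><..<s0 + \<delta>} \<subseteq> I"
    "\<And>x y. x \<in> {s0 - \<delta><..<s0 + \<delta>} \<Longrightarrow> y \<in> {s0 - \<delta><..<s0 + \<delta>} \<Longrightarrow> x < y \<Longrightarrow> measure \<mu> (\<gamma> ` {x<..<y}) = \<bar>\<tau> y - \<tau> x\<bar> / (2 * pi)"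
    "\<And>x y. x \<in> {s0 - \<delta><..<s0 + \<delta>} \<Longrightarrow> y \<in> {s0 - \<delta><..<s0 + \<delta>} \<Longrightarrow> x < y \<Longrightarrow> \<gamma> ` {x<..<y} \<in> sets borel"
proof -
  define p where "p = \<gamma> s0"
  have p: "p \<in> \<Gamma>" using \<gamma>_in(1)[OF s0] by (simp add: p_def)
  obtain \<kappa> R where R: "R > 0" and \<kappa>p: "\<kappa> (f p) = p" and op: "open (\<kappa> ` ball (f p) R)"
    and f\<kappa>: "\<And>v. v \<in> ball (f p) R \<Longrightarrow> f (\<kappa> v) = v"
    and ms: "\<And>c r. c \<in> ball (f p) R \<Longrightarrow> Re c = 0 \<Longrightarrow> 0 < r \<Longrightarrow> r < R \<Longrightarrow> ball c r \<subseteq> ball (f p) R \<Longrightarrow> measure \<mu> (\<Gamma> \<inter> \<kappa> ` ball c r) = r / pi"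
    using curve_chart[OF p] by metis
  let ?V = "\<kappa> ` ball (f p) R"
  have inV: "\<kappa> (f z) = z \<and> f z \<in> ball (f p) R" if "z \<in> ?V" for z using that f\<kappa> by auto
  have pV: "p \<in> ?V" using \<kappa>p R by (intro image_eqI[of _ _ "f p"]) auto
  have fp: "f p = \<i> * of_real (\<tau> s0)" using f_\<gamma>[OF s0] by (simp add: p_def)
  have "open (I \<inter> \<gamma> -` ?V)" using continuous_open_preimage[OF \<gamma>_cont I_open op] .
  moreover have "open ((I \<inter> \<tau> -` ball (\<tau> s0) (R / 2)))" using continuous_open_preimage[OF \<tau>_cont I_open open_ball] .
  \<comment> \<open>The first condition keeps the arc in the chart; the second makes the discs over
    its subarcs fit into the chart ball.\<close>
  ultimately have "open ((I \<inter> \<gamma> -` ?V) \<inter> (I \<inter> \<tau> -` ball (\<tau> s0) (R / 2)))" by blast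
  moreover have "s0 \<in> (I \<inter> \<gamma> -` ?V) \<inter> (I \<inter> \<tau> -` ball (\<tau> s0) (R / 2))" using s0 pV R by (simp add: p_def)
  ultimately obtain \<delta> where \<delta>: "\<delta> > 0" "ball s0 \<delta> \<subseteq> (I \<inter> \<gamma> -` ?V) \<inter> (I \<inter> \<tau> -` ball (\<tau> s0) (R / 2))"
    by (rule openE)
  have b: "ball s0 \<delta> = {s0 - \<delta><..<s0 + \<delta>}" by (auto simp: ball_def dist_real_def)
  have key: "\<gamma> ` {x<..<y} = \<Gamma> \<inter> \<kappa> ` ball (\<i> * of_real ((\<tau> x + \<tau> y) / 2)) (\<bar>\<tau> y - \<tau> x\<bar> / 2)"
    "ball (\<i> * of_real ((\<tau> x + \<tau> y) / 2)) (\<bar>\<tau> y - \<tau> x\<bar> / 2) \<subseteq> ball (f p) R"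
    "\<i> * of_real ((\<tau> x + \<tau> y) / 2) \<in> ball (f p) R" "\<bar>\<tau> y - \<tau> x\<bar> / 2 < R" "\<bar>\<tau> y - \<tau> x\<bar> > 0"
    if xy: "x \<in> ball s0 \<delta>" "y \<in> ball s0 \<delta>" "x < y" for x y
  proof -
    let ?c = "\<i> * complex_of_real ((\<tau> x + \<tau> y) / 2)" and ?r = "\<bar>\<tau> y - \<tau> x\<bar> / 2"
    have Ixy: "x \<in> I" "y \<in> I" using xy(1,2) \<delta>(2) by blast+
    have \<tau>xy: "\<bar>\<tau> x - \<tau> s0\<bar> < R / 2" "\<bar>\<tau> y - \<tau> s0\<bar> < R / 2"
      using xy(1,2) \<delta>(2) by (auto simp: dist_real_def abs_minus_commute)
    have sub: "{x..y} \<subseteq> I" by (rule Icc_sub[OF Ixy])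
    have subb: "{x<..<y} \<subseteq> ball s0 \<delta>" using xy unfolding b by auto
    note im = image_open_interval_inj[OF continuous_on_subset[OF \<tau>_cont sub] inj_on_subset[OF \<tau>_inj sub] xy(3)]
    have dc: "dist (f p) ?c = \<bar>\<tau> s0 - (\<tau> x + \<tau> y) / 2\<bar>"
      unfolding fp dist_norm right_diff_distrib[symmetric] of_real_diff[symmetric] norm_mult norm_of_real by simp
    also have "\<tau> s0 - (\<tau> x + \<tau> y) / 2 = - (((\<tau> x - \<tau> s0) + (\<tau> y - \<tau> s0)) / 2)" by (simp add: field_simps)
    also have "\<bar>\<dots>\<bar> < R / 2"
      using \<tau>xy abs_triangle_ineq[of "\<tau> x - \<tau> s0" "\<tau> y - \<tau> s0"] by simp
    finally have dc': "dist (f p) ?c < R / 2" .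
    then show "?c \<in> ball (f p) R" using R by simp
    have r: "?r < R / 2"
      using \<tau>xy abs_triangle_ineq4[of "\<tau> y - \<tau> s0" "\<tau> x - \<tau> s0"] by simp
    then show "?r < R" using R by simp
    show "\<bar>\<tau> y - \<tau> x\<bar> > 0" using inj_onD[OF \<tau>_inj _ Ixy(2,1)] xy(3) by auto
    show subR: "ball ?c ?r \<subseteq> ball (f p) R"
    proof
      fix v assume "v \<in> ball ?c ?r"
      then have "dist (f p) v < R / 2 + R / 2" using dist_triangle[of "f p" v ?c] dc' r by simp
      then show "v \<in> ball (f p) R" by simp
    qed
    have inball: "\<i> * of_real h \<in> ball ?c ?r \<longleftrightarrow> h \<in> {min (\<tau> x) (\<tau> y)<..<max (\<tau> x) (\<tau> y)}" for h
    proof -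
      have "dist ?c (\<i> * of_real h) = \<bar>(\<tau> x + \<tau> y) / 2 - h\<bar>"
        unfolding dist_norm right_diff_distrib[symmetric] of_real_diff[symmetric] norm_mult norm_of_real by simp
      then show ?thesis by (auto simp: min_def max_def abs_if field_simps split: if_splits)
    qed
    show "\<gamma> ` {x<..<y} = \<Gamma> \<inter> \<kappa> ` ball ?c ?r"
    proof (intro equalityI subsetI)
      fix z assume "z \<in> \<gamma> ` {x<..<y}"
      then obtain s where s: "s \<in> {x<..<y}" "z = \<gamma> s" by blast
      then have sI: "s \<in> I" "\<gamma> s \<in> ?V" using subb \<delta>(2) by blast+
      have "\<tau> s \<in> {min (\<tau> x) (\<tau> y)<..<max (\<tau> x) (\<tau> y)}" using im s(1) by blast
      then have "f z \<in> ball ?c ?r" using inball f_\<gamma>[OF sI(1)] s(2) by simp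
      moreover have "z = \<kappa> (f z)" using inV[OF sI(2)] s(2) by simp
      ultimately show "z \<in> \<Gamma> \<inter> \<kappa> ` ball ?c ?r" using \<gamma>_in(1)[OF sI(1)] s(2) by blast
    next
      fix z assume z: "z \<in> \<Gamma> \<inter> \<kappa> ` ball ?c ?r"
      then obtain v where v: "v \<in> ball ?c ?r" "z = \<kappa> v" by blast
      have fz: "f z = v" using f\<kappa> subR v by blast
      have "Re (f z) = 0" using z by (simp add: \<Gamma>_eq_f)
      then have "v = \<i> * of_real (Im v)" using fz by (simp add: complex_eq_iff)
      then have "Im v \<in> {min (\<tau> x) (\<tau> y)<..<max (\<tau> x) (\<tau> y)}" using v(1) inball by metis
      then obtain s where s: "s \<in> {x<..<y}" "Im v = \<tau> s" unfolding im[symmetric] by blast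
      then have sI: "s \<in> I" "\<gamma> s \<in> ?V" using subb \<delta>(2) by blast+
      have "f (\<gamma> s) = v" using f_\<gamma>[OF sI(1)] s(2) \<open>v = \<i> * of_real (Im v)\<close> by simp
      then have "\<gamma> s = z" using inV[OF sI(2)] v(2) by simp
      then show "z \<in> \<gamma> ` {x<..<y}" using s(1) by blast
    qed
  qed
  show ?thesis
  proof (rule that[OF \<delta>(1)])
    show "{s0 - \<delta><..<s0 + \<delta>} \<subseteq> I" using \<delta>(2) unfolding b by blast
    fix x y assume xy: "x \<in> {s0 - \<delta><..<s0 + \<delta>}" "y \<in> {s0 - \<delta><..<s0 + \<delta>}" "x < y"
    note k = key[unfolded b, OF xy]
    have "measure \<mu> (\<gamma> ` {x<..<y}) = (\<bar>\<tau> y - \<tau> x\<bar> / 2) / pi"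
      unfolding k(1) by (rule ms[OF k(3) _ _ k(4) k(2)]) (use k(5) in auto)
    then show "measure \<mu> (\<gamma> ` {x<..<y}) = \<bar>\<tau> y - \<tau> x\<bar> / (2 * pi)" by simp
    have sub: "{x..y} \<subseteq> I" using xy \<delta>(2) unfolding b by (intro Icc_sub) blast+
    have "compact (\<gamma> ` {x..y})" by (intro compact_continuous_image continuous_on_subset[OF \<gamma>_cont sub]) auto
    then have "\<gamma> ` {x..y} \<in> sets borel" by (simp add: compact_imp_closed)
    moreover have "\<gamma> ` {x<..<y} = \<gamma> ` {x..y} - {\<gamma> x, \<gamma> y}"
    proof -
      have "\<gamma> ` ({x..y} - {x, y}) = \<gamma> ` {x..y} - \<gamma> ` {x, y}"
        by (rule inj_on_image_set_diff[OF \<gamma>_inj]) (use sub xy(3) in auto)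
      moreover have "{x..y} - {x, y} = {x<..<y}" by auto
      ultimately show ?thesis by simp
    qed
    ultimately show "\<gamma> ` {x<..<y} \<in> sets borel" by (simp add: sets.Diff)
  qed
qed

text \<open>Short arcs, each inside a window where \<open>local_arc_measure\<close> applies, form a
  generator stable under intersection on which both measures agree. Countably many of them cover
  \<Gamma>.\<close>

lemma restrict_measure_eq:
  "restrict_space \<mu> \<Gamma> = density (length_measure \<gamma> I) (\<lambda>z. ennreal (\<rho> z))"
proof -
  interpret P: prob_space \<mu> by (rule prob)
  let ?M = "restrict_space \<mu> \<Gamma>" and ?N = "density (length_measure \<gamma> I) (\<lambda>z. ennreal (\<rho> z))"
  have "\<exists>\<delta>. \<forall>s\<in>I. \<delta> s > 0 \<and> {s - \<delta> s<..<s + \<delta> s} \<subseteq> I \<and>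
     (\<forall>x y. x \<in> {s - \<delta> s<..<s + \<delta> s} \<longrightarrow> y \<in> {s - \<delta> s<..<s + \<delta> s} \<longrightarrow> x < y \<longrightarrow>
        measure \<mu> (\<gamma> ` {x<..<y}) = \<bar>\<tau> y - \<tau> x\<bar> / (2 * pi) \<and> \<gamma> ` {x<..<y} \<in> sets borel)"
    by (rule bchoice, rule ballI, rule local_arc_measure, assumption) blast
  then obtain \<delta> where \<delta>: "\<And>s. s \<in> I \<Longrightarrow> \<delta> s > 0" "\<And>s. s \<in> I \<Longrightarrow> {s - \<delta> s<..<s + \<delta> s} \<subseteq> I"
    "\<And>s x y. s \<in> I \<Longrightarrow> x \<in> {s - \<delta> s<..<s + \<delta> s} \<Longrightarrow> y \<in> {s - \<delta> s<..<s + \<delta> s} \<Longrightarrow> x < y \<Longrightarrow>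
        measure \<mu> (\<gamma> ` {x<..<y}) = \<bar>\<tau> y - \<tau> x\<bar> / (2 * pi) \<and> \<gamma> ` {x<..<y} \<in> sets borel"
    by metis
  define G where "G = {(x, y). \<exists>s\<in>I. x \<in> {s - \<delta> s<..<s + \<delta> s} \<and> y \<in> {s - \<delta> s<..<s + \<delta> s}}"
  define E where "E = (\<lambda>(x, y). \<gamma> ` {x<..<y}) ` G"
  have GI: "x \<in> I" "y \<in> I" if "(x, y) \<in> G" for x y using that \<delta>(2) unfolding G_def by blast+
  have Gsub: "{x<..<y} \<subseteq> I" if "(x, y) \<in> G" for x y
    using Icc_sub[OF GI[OF that]] by auto
  have Gb: "\<gamma> ` {x<..<y} \<in> sets borel" if "(x, y) \<in> G" for x y
  proof (cases "x < y")
    case True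
    then show ?thesis using that \<delta>(3) unfolding G_def by blast
  qed simp
  have EG: "X \<subseteq> \<Gamma>" "X \<in> sets borel" if X: "X \<in> E" for X
  proof -
    obtain x y where xy: "(x, y) \<in> G" "X = \<gamma> ` {x<..<y}" using X unfolding E_def by auto
    show "X \<subseteq> \<Gamma>" unfolding xy(2) \<gamma>_image[symmetric] by (rule image_mono[OF Gsub[OF xy(1)]])
    show "X \<in> sets borel" unfolding xy(2) by (rule Gb[OF xy(1)])
  qed
  have eq: "emeasure ?M X = emeasure ?N X" if X: "X \<in> E" for X
  proof -
    obtain x y where xy: "(x, y) \<in> G" "X = \<gamma> ` {x<..<y}" using X unfolding E_def by auto
    show ?thesis
    proof (cases "x < y")
      case True
      have m: "measure \<mu> X = \<bar>\<tau> y - \<tau> x\<bar> / (2 * pi)" using xy True \<delta>(3) unfolding G_def by blast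
      have "emeasure ?M X = emeasure \<mu> X"
        using EG[OF X] \<Gamma>_borel sets by (intro emeasure_restrict_space) auto
      also have "\<dots> = ennreal (\<bar>\<tau> y - \<tau> x\<bar> / (2 * pi))" by (simp add: P.emeasure_eq_measure m)
      also have "\<dots> = emeasure ?N X"
        unfolding xy(2) using length_density_interval[OF GI[OF xy(1)] True Gb[OF xy(1)]] by simp
      finally show ?thesis .
    next
      case False
      then have "X = {}" using xy(2) by auto
      then show ?thesis by simp
    qed
  qed
  have sM: "sets ?M = sets (restrict_space borel \<Gamma>)" by (rule sets_restrict_space_cong[OF sets])
  have sN: "sets ?N = sets (restrict_space borel \<Gamma>)" by (simp add: length_measure_def \<gamma>_image)
  have opens: "\<exists>F. F \<subseteq> E \<and> countable F \<and> \<Union>F = \<Gamma> \<inter> U" if U: "open U" for U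
  proof -
    \<comment> \<open>Rational end points reduce the arcs inside an open set to countably many,
      which still exhaust its intersection with \<Gamma>.\<close>
    define Q where "Q = {q \<in> \<rat> \<times> \<rat>. q \<in> G \<and> (case q of (x, y) \<Rightarrow> \<gamma> ` {x<..<y} \<subseteq> U)}"
    let ?F = "(\<lambda>(x, y). \<gamma> ` {x<..<y}) ` Q"
    have "countable (\<rat> \<times> \<rat> :: (real \<times> real) set)" by (intro countable_SIGMA countable_rat)
    then have "countable Q" unfolding Q_def by (rule countable_subset[rotated]) auto
    then have "countable ?F" by (rule countable_image)
    moreover have "?F \<subseteq> E" unfolding E_def Q_def by auto
    moreover have "\<Union>?F = \<Gamma> \<inter> U"
    proof (intro equalityI subsetI)
      fix z assume "z \<in> \<Union>?F"
      then obtain x y where "(x, y) \<in> G" "\<gamma> ` {x<..<y} \<subseteq> U" "z \<in> \<gamma> ` {x<..<y}" unfolding Q_def by auto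
      then show "z \<in> \<Gamma> \<inter> U" using Gsub \<gamma>_image by blast
    next
      fix z assume z: "z \<in> \<Gamma> \<inter> U"
      then obtain s where s: "s \<in> I" "z = \<gamma> s" using \<gamma>_image by blast
      have "open ((I \<inter> \<gamma> -` U) \<inter> {s - \<delta> s<..<s + \<delta> s})"
        by (rule open_Int[OF continuous_open_preimage[OF \<gamma>_cont I_open U] open_greaterThanLessThan])
      moreover have "s \<in> (I \<inter> \<gamma> -` U) \<inter> {s - \<delta> s<..<s + \<delta> s}" using s z \<delta>(1)[OF s(1)] by simp
      ultimately obtain e where e: "e > 0" "ball s e \<subseteq> (I \<inter> \<gamma> -` U) \<inter> {s - \<delta> s<..<s + \<delta> s}" by (rule openE)
      obtain x where x: "x \<in> \<rat>" "s - e < x" "x < s" using Rats_dense_in_real[of "s - e" s] e(1) by auto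
      obtain y where y: "y \<in> \<rat>" "s < y" "y < s + e" using Rats_dense_in_real[of s "s + e"] e(1) by auto
      have inb: "r \<in> ball s e" if "x \<le> r" "r \<le> y" for r using that x y by (simp add: dist_real_def abs_if)
      have "x \<in> ball s e" "y \<in> ball s e" using inb[of x] inb[of y] x y by simp_all
      then have "x \<in> {s - \<delta> s<..<s + \<delta> s}" "y \<in> {s - \<delta> s<..<s + \<delta> s}" using e(2) by blast+
      then have "(x, y) \<in> G" unfolding G_def using s(1) by blast
      moreover have "\<gamma> ` {x<..<y} \<subseteq> U"
      proof (rule image_subsetI)
        fix r assume "r \<in> {x<..<y}"
        then have "r \<in> ball s e" by (intro inb) auto
        then show "\<gamma> r \<in> U" using e(2) by blast
      qed
      ultimately have "(x, y) \<in> Q" using x y by (simp add: Q_def)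
      moreover have "z \<in> \<gamma> ` {x<..<y}" using s(2) x y by auto
      ultimately show "z \<in> \<Union>?F" by force
    qed
    ultimately show ?thesis by blast
  qed
  have gen: "sets (restrict_space borel \<Gamma>) = sigma_sets \<Gamma> E"
  proof -
    have "sets (restrict_space borel \<Gamma>) = (\<inter>) \<Gamma> ` sigma_sets UNIV {U :: complex set. open U}"
      by (simp add: sets_restrict_space sets_borel)
    also have "\<dots> = sigma_sets \<Gamma> ((\<inter>) \<Gamma> ` {U. open U})"
      by (rule sigma_sets_Int) (use \<Gamma>_borel in \<open>auto simp: sets_borel\<close>)
    also have "\<dots> = sigma_sets \<Gamma> E"
    proof (rule sigma_sets_eqI)
      fix X assume "X \<in> (\<inter>) \<Gamma> ` {U. open U}"
      then obtain U where U: "open U" "X = \<Gamma> \<inter> U" by blast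
      obtain F where F: "F \<subseteq> E" "countable F" "\<Union>F = X" using opens[OF U(1)] U(2) by blast
      interpret S: sigma_algebra \<Gamma> "sigma_sets \<Gamma> E" by (rule sigma_algebra_sigma_sets) (use EG in auto)
      have "\<Union>F \<in> sigma_sets \<Gamma> E" using F by (intro S.countable_Union) auto
      then show "X \<in> sigma_sets \<Gamma> E" by (simp add: F(3))
    next
      fix X assume X: "X \<in> E"
      have "X = \<Gamma> \<inter> X" using EG(1)[OF X] by blast
      moreover have "\<Gamma> \<inter> X \<in> (\<inter>) \<Gamma> ` sigma_sets UNIV {U. open U}" using EG(2)[OF X] unfolding sets_borel by (rule imageI)
      ultimately show "X \<in> sigma_sets \<Gamma> ((\<inter>) \<Gamma> ` {U. open U})"
        using sigma_sets_Int[of \<Gamma> UNIV "{U. open U}"] \<Gamma>_borel by (auto simp: sets_borel)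
    qed
    finally show ?thesis .
  qed
  obtain F where F: "F \<subseteq> E" "countable F" "\<Union>F = \<Gamma>" using opens[OF open_UNIV] by auto
  show ?thesis
  proof (rule measure_eqI_generator_eq_countable[where E = E and \<Omega> = \<Gamma> and A = F])
    show "Int_stable E"
    proof (rule Int_stableI)
      fix X Y assume "X \<in> E" "Y \<in> E"
      then obtain x y x' y' where g: "(x, y) \<in> G" "(x', y') \<in> G" and XY: "X = \<gamma> ` {x<..<y}" "Y = \<gamma> ` {x'<..<y'}"
        unfolding E_def by auto
      have "X \<inter> Y = \<gamma> ` ({x<..<y} \<inter> {x'<..<y'})"
        unfolding XY using inj_on_image_Int[OF \<gamma>_inj Gsub[OF g(1)] Gsub[OF g(2)]] by simp
      also have "{x<..<y} \<inter> {x'<..<y'} = {max x x'<..<min y y'}" by auto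
      finally have i: "X \<inter> Y = \<gamma> ` {max x x'<..<min y y'}" .
      show "X \<inter> Y \<in> E"
      proof (cases "max x x' < min y y'")
        case True
        obtain s where s: "s \<in> I" "x \<in> {s - \<delta> s<..<s + \<delta> s}" "y \<in> {s - \<delta> s<..<s + \<delta> s}" using g(1) unfolding G_def by blast
        have "(max x x', min y y') \<in> G" unfolding G_def using s True by (auto intro!: bexI[of _ s])
        then show ?thesis unfolding i E_def by force
      next
        case False
        obtain s where s: "s \<in> I" using I_ne by blast
        have "(s, s) \<in> G" unfolding G_def using s \<delta>(1)[OF s] by (auto intro!: bexI[of _ s])
        then have "\<gamma> ` {s<..<s} \<in> E" unfolding E_def by force
        then have "{} \<in> E" by simp
        moreover have "{max x x'<..<min y y'} = {}" by (rule greaterThanLessThan_empty[OF False[unfolded not_less]])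
        ultimately show ?thesis unfolding i by (simp only: image_empty)
      qed
    qed
    show "emeasure ?M X \<noteq> \<infinity>" if "X \<in> F" for X
    proof -
      have "emeasure ?M X = emeasure \<mu> X"
        using EG F(1) that \<Gamma>_borel sets by (intro emeasure_restrict_space) auto
      then show ?thesis by (simp add: P.emeasure_eq_measure)
    qed
  qed (use EG F eq sM sN gen in auto)
qed

end

lemma length_density: "has_length_density \<mu> \<Gamma> (\<lambda>z. cmod (u i z - u j z) / (2 * pi * t))"
  unfolding has_length_density_def using restrict_measure_eq unfolding \<rho>_def by blast

end

context saddle_curve begin

theorem curve_theorem:
  "(measure \<mu> \<Gamma> > 0 \<longleftrightarrow> branch_switches d lam a t u i j D1 D2) \<and>
   (branch_switches d lam a t u i j D1 D2 \<longrightarrow> has_length_density \<mu> \<Gamma> (\<lambda>z. cmod (u i z - u j z) / (2 * pi * t)))"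
proof (cases rule: relevant_dichotomy)
  case (same k)
  then show ?thesis using curve_null[OF same] no_switch[OF same] by simp
next
  case switch
  interpret switching_curve d lam a t \<mu> D D1 D2 \<Gamma> u i j by unfold_locales (use switch in auto)
  show ?thesis using curve_positive length_density switch_switches[OF switch] by blast
next
  case anti
  then show ?thesis using not_anti by blast
qed

end

theorem corollary4p2:
  fixes d :: nat and lam :: "nat \<Rightarrow> complex" and a :: "nat \<Rightarrow> nat" and t :: real
    and \<mu> :: "complex measure"
    and D D1 D2 \<Gamma> :: "complex set" and u :: "nat \<Rightarrow> complex \<Rightarrow> complex" and i j :: nat
  assumes d: "d \<ge> 1"
    and lam: "inj_on lam {1..d}"
    and a: "\<And>k. k \<in> {1..d} \<Longrightarrow> a k \<ge> 1"
    and t: "t > 0"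
    and \<mu>: "weak_limit (zero_measure d lam a t) \<mu>"
    and D: "simply_connected_domain D" "D \<inter> branch_set d lam a t = {}"
    and u: "saddle_branches d lam a t D u"
    and ij: "1 \<le> i" "i < j" "j \<le> d + 1"
    and \<Gamma>_def: "\<Gamma> = equal_height_set d lam a t D u i j"
    and \<Gamma>_nonempty: "\<Gamma> \<noteq> {}"
    and only_pair: "\<And>k l. 1 \<le> k \<Longrightarrow> k < l \<Longrightarrow> l \<le> d + 1 \<Longrightarrow>
                      equal_height_set d lam a t D u k l \<noteq> {} \<Longrightarrow> k = i \<and> l = j"
    and \<Gamma>_curve: "real_analytic_curve \<Gamma>"
    and separation: "D = D1 \<union> D2 \<union> \<Gamma>" "D1 \<inter> D2 = {}" "D1 \<inter> \<Gamma> = {}" "D2 \<inter> \<Gamma> = {}"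
      "simply_connected_domain D1" "simply_connected_domain D2"
  shows "(measure \<mu> \<Gamma> > 0 \<longleftrightarrow> branch_switches d lam a t u i j D1 D2) \<and>
         (branch_switches d lam a t u i j D1 D2 \<longrightarrow>
            has_length_density \<mu> \<Gamma> (\<lambda>z. cmod (u i z - u j z) / (2 * pi * t)))"
proof -
  interpret saddle_curve d lam a t \<mu> D D1 D2 \<Gamma> u i j
    by unfold_locales (fact d a t \<mu> D(1) u ij \<Gamma>_def \<Gamma>_nonempty only_pair separation)+
  show ?thesis by (rule curve_theorem)
qed

end
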